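(* For every $n\in\mathcal N_1$ one has $\mathrm m(\alpha_n)=0$, which equals $\mathrm m(C_1)=0$. For every fixed integer $k\ge 2$, $$\mathrm m(\alpha_n)\sim \mathrm m(C_k)\cdot n\quad\text{as } n\to+\infty,\ n\in\mathcal N_k.$$ In fact, for all integers $k\ge 1$ and all $n\in\mathcal N_k$, $$\Big|\frac{\mathrm m(\alpha_n)}{n}-\mathrm m(C_k)\Big|\le \frac{4\sqrt3\,k(k+1)}{p^{1/d}}+\frac{2\log k}{p},$$ where $p=kn+1$ and $d=\phi(k)$ (Euler totient).
   Context: For a positive integer $n$, $\kappa(n)$ is the smallest positive integer such that $p=p(n):=\kappa(n)n+1$ is prime; for $k\ge1$, $\mathcal N_k:=\{n\in\mathbf Z_{\ge1}:\kappa(n)=k\}$. For $n\in\mathcal N_k$ with $p=kn+1$, let $\zeta_p$ be a primitive $p$-th root of unity, $H$ the unique subgroup of order $k$ of the cyclic group $\mathrm{Gal}(\mathbf Q(\zeta_p)/\mathbf Q)$, and define the Gaussian period $\alpha_n:=\sum_{\sigma\in H}\zeta_p^{\sigma}$. Mahler measure: for a nonzero Laurent polynomial $f\in\mathbf C[x_1^{\pm1},\dots,x_N^{\pm1}]$, $\mathrm m(f):=\int_{[0,1]^N}\log|f(e^{2\pi i\theta_1},\dots,e^{2\pi i\theta_N})|\,d\theta_1\cdots d\theta_N$. For an algebraic integer $\alpha$, $\mathrm m(\alpha):=\mathrm m(f_\alpha)$ where $f_\alpha$ is its minimal polynomial over $\mathbf Q$; equivalently $\mathrm m(\alpha)=\sum_{\alpha'}\max\{0,\log|\alpha'|\}$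 over all conjugates $\alpha'$ of $\alpha$. Cyclovariety: let $k\ge1$, $d=\phi(k)$, $\zeta_k$ a primitive $k$-th root of unity. Every $k$-th root of unity is uniquely an integer linear combination of $1,\zeta_k,\dots,\zeta_k^{d-1}$; let $A_k\subset\mathbf Z^d$ be the set of the resulting $k$ coefficient vectors. Put $F_k(\mathbf x):=\sum_{\mathbf a\in A_k}\mathbf x^{\mathbf a}$ with $\mathbf x=(x_1,\dots,x_d)$, and $P_k(x_0,\mathbf x):=x_0+F_k(\mathbf x)$. The cyclovariety $C_k$ is the hypersurface $P_k=0$ in $\mathbf G_m^{d+1}$ and $\mathrm m(C_k):=\mathrm m(P_k)$ (with $x_0$ included among the integration variables). *)

theory Defs
  imports
    "HOL-Analysis.Analysis"
    "HOL-Library.Poly_Mapping"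
    "HOL-Library.Landau_Symbols"
    "HOL-Algebra.Bij"
    "HOL-Algebra.Generated_Fields"
    "HOL-Algebra.Algebraic_Closure_Type"
    "HOL-Number_Theory.Totient"
begin

hide_const (open) Divisibility.prime Divisibility.irreducible

definition kappa :: "nat \<Rightarrow> nat" where
  "kappa n = (LEAST k. k \<ge> 1 \<and> prime (k * n + 1))"

definition kappa_prime :: "nat \<Rightarrow> nat" where
  "kappa_prime n = kappa n * n + 1"

definition N_set :: "nat \<Rightarrow> nat set" where
  "N_set k = {n. n \<ge> 1 \<and> kappa n = k}"

definition primitive_root_of_unity :: "nat \<Rightarrow> complex \<Rightarrow> bool" where
  "primitive_root_of_unity m z \<longleftrightarrow> m \<ge> 1 \<and> z ^ m = 1 \<and> (\<forall>j. 1 \<le> j \<and> j < m \<longrightarrow> z ^ j \<noteq> 1)"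


text \<open>The group of automorphisms of the field \<open>L\<close> fixing \<open>K\<close> pointwise. As for \<^const>\<open>Bij\<close>,
  automorphisms are taken to be extensional, so that they are determined by their
  restriction to the carrier.\<close>

definition galois_group :: "('a, 'b) ring_scheme \<Rightarrow> 'a set \<Rightarrow> ('a \<Rightarrow> 'a) monoid" where
  "galois_group L K = BijGroup (carrier L)
     \<lparr>carrier := {\<sigma> \<in> ring_hom L L \<inter> Bij (carrier L). \<forall>x\<in>K. \<sigma> x = x}\<rparr>"

definition rat_adjoin :: "complex \<Rightarrow> complex ring" where
  "rat_adjoin z = ring_of_type_algebra
     \<lparr>carrier := generate_field ring_of_type_algebra (insert z \<rat>)\<rparr>"

text \<open>The sum of the images of \<open>z\<close> under the subgroup of order \<open>k\<close> of
  \<open>Gal(\<rat>(z)/\<rat>)\<close>. The definite description is meaningful when this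
  subgroup is unique, as it is when the Galois group is cyclic of order divisible by \<open>k\<close>.\<close>

definition gaussian_period :: "nat \<Rightarrow> complex \<Rightarrow> complex" where
  "gaussian_period k z =
     (\<Sum>\<sigma>\<in>(THE H. subgroup H (galois_group (rat_adjoin z) \<rat>) \<and> card H = k). \<sigma> z)"

text \<open>In the following, \<open>zeta m\<close> stands for a chosen primitive \<open>m\<close>-th root of unity.\<close>

definition alpha :: "(nat \<Rightarrow> complex) \<Rightarrow> nat \<Rightarrow> complex" where
  "alpha zeta n = gaussian_period (kappa n) (zeta (kappa_prime n))"


text \<open>A Laurent polynomial in the variables \<open>x\<^sub>0, x\<^sub>1, \<dots>\<close> maps each exponent vector, itself a
  finitely supported function from variable indices to integers, to its coefficient.
  The functions below taking an argument \<open>N\<close> are meant for Laurent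
  polynomials in the variables \<open>x\<^sub>0, \<dots>, x\<^bsub>N-1\<^esub>\<close>.\<close>

type_synonym laurent_mpoly = "(nat \<Rightarrow>\<^sub>0 int) \<Rightarrow>\<^sub>0 complex"

definition laurent_eval :: "nat \<Rightarrow> laurent_mpoly \<Rightarrow> (nat \<Rightarrow> complex) \<Rightarrow> complex" where
  "laurent_eval N f x =
     (\<Sum>a\<in>Poly_Mapping.keys f. Poly_Mapping.lookup f a * (\<Prod>i<N. x i powi Poly_Mapping.lookup a i))"

definition mahler :: "nat \<Rightarrow> laurent_mpoly \<Rightarrow> real" where
  "mahler N f = set_lebesgue_integral (PiM {..<N} (\<lambda>_. lborel)) (PiE {..<N} (\<lambda>_. {0..1}))
     (\<lambda>\<theta>. ln (cmod (laurent_eval N f (\<lambda>i. exp (2 * of_real pi * \<i> * of_real (\<theta> i))))))"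

definition laurent_of_poly :: "complex poly \<Rightarrow> laurent_mpoly" where
  "laurent_of_poly f = (\<Sum>j\<le>Polynomial.degree f.
     Poly_Mapping.single (Poly_Mapping.single 0 (int j)) (Polynomial.coeff f j))"

definition min_poly :: "complex \<Rightarrow> rat poly" where
  "min_poly z = (THE f. Polynomial.lead_coeff f = 1 \<and> irreducible f \<and> poly (map_poly of_rat f) z = 0)"

definition mahler_alg :: "complex \<Rightarrow> real" where
  "mahler_alg z = mahler 1 (laurent_of_poly (map_poly of_rat (min_poly z)))"


text \<open>The coefficient vectors are indexed by \<open>1, \<dots>, d\<close> with \<open>d = \<phi>(k)\<close>, the \<open>i\<close>-th entry being the
  coefficient of \<open>zeta k ^ (i - 1)\<close>. The index \<open>0\<close> is reserved for the variable \<open>x\<^sub>0\<close>.\<close>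

definition A_set :: "(nat \<Rightarrow> complex) \<Rightarrow> nat \<Rightarrow> (nat \<Rightarrow>\<^sub>0 int) set" where
  "A_set zeta k = {a. Poly_Mapping.keys a \<subseteq> {1..totient k} \<and>
     (\<exists>w. w ^ k = 1 \<and> w = (\<Sum>i=1..totient k. of_int (Poly_Mapping.lookup a i) * zeta k ^ (i - 1)))}"

definition F_poly :: "(nat \<Rightarrow> complex) \<Rightarrow> nat \<Rightarrow> laurent_mpoly" where
  "F_poly zeta k = (\<Sum>a\<in>A_set zeta k. Poly_Mapping.single a 1)"

definition P_poly :: "(nat \<Rightarrow> complex) \<Rightarrow> nat \<Rightarrow> laurent_mpoly" where
  "P_poly zeta k = Poly_Mapping.single (Poly_Mapping.single 0 1) 1 + F_poly zeta k"

definition mahler_cyclovariety :: "(nat \<Rightarrow> complex) \<Rightarrow> nat \<Rightarrow> real" where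
  "mahler_cyclovariety zeta k = mahler (totient k + 1) (P_poly zeta k)"

end

theory Submission
  imports Defs "HOL-Number_Theory.Number_Theory" "HOL-Probability.Probability_Measure"
begin

text \<open>
  Let \<open>p = k n + 1\<close> be prime, \<open>d = \<phi>(k)\<close>, and let \<open>g\<close> have order \<open>k\<close> modulo \<open>p\<close>. The conjugates of the Gaussian period are the
  sums \<open>\<Sum>\<^sub>j e(c g\<^sup>j/p)\<close> with \<open>j < k\<close> and \<open>e(t) = exp(2 \<pi> \<i> t)\<close>, each of them for \<open>k\<close> values of \<open>c\<close> prime to \<open>p\<close>. As \<open>g\<close> is a root of
  the \<open>k\<close>-th cyclotomic polynomial modulo \<open>p\<close>, relations between the powers of \<open>\<zeta>\<^sub>k\<close> also hold for the powers of \<open>g\<close>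
  modulo \<open>p\<close>. So these sums are the values of \<open>F\<^sub>k\<close> at the points \<open>c (1, g, \<dots>, g\<^sup>d\<^sup>-\<^sup>1)/p\<close> of the torus. By Jensen's formula
  \<open>m(\<alpha>\<^sub>n)\<close> is \<open>1/k\<close> times the sum of \<open>log\<^sup>+ \<bar>F\<^sub>k\<bar>\<close> over these points other than \<open>0\<close>, and \<open>m(C\<^sub>k)\<close> is the integral of
  \<open>log\<^sup>+ \<bar>F\<^sub>k\<bar>\<close> over the torus, where the formula is applied in the variable \<open>x\<^sub>0\<close>. What remains is an equidistribution
  statement with an error term.

  The points form a group, so the average of a function over its translates by them has the same integral over the torus, and is
  invariant under these translations. It is nearly constant as soon as every point of the torus is close to the group
  (lemma \<open>equidistribution\<close>). A point of the torus is regarded as an additive map from \<open>\<int>[\<zeta>\<^sub>k]\<close> to \<open>\<real>\<close>, and its size is measured by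
  the sum of the squares of its values at the \<open>k\<close> powers of \<open>\<zeta>\<^sub>k\<close>. Multiplication by \<open>\<zeta>\<^sub>k\<close> permutes these values, so it preserves the
  size. Therefore a single nonzero vector \<open>\<lambda>\<close> of a lattice stable under \<open>\<zeta>\<^sub>k\<close> yields \<open>k\<close> vectors of the same size, which span because
  \<open>\<rat>(\<zeta>\<^sub>k)\<close> is a field, and rounding coefficients shows that every vector is within \<open>(\<surd>k/2) \<bar>\<lambda>\<bar>\<close> of the lattice (lemma
  \<open>exists_close_combination\<close>). This is used twice. The lattice of integral functionals contains a nonzero vector with values
  \<open>0\<close> and \<open>\<plusminus>1\<close> (lemma \<open>exists_short_integral_functional\<close>), so balls of radius \<open>k/(2s)\<close> around the points of order dividing \<open>s\<close> cover
  the torus. If \<open>s\<^sup>d < p\<close>, then one of these balls contains two of the \<open>p\<close> points, whose difference is a vector of length at most \<open>k/s\<close>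
  (lemma \<open>exists_short_functional_mod_prime\<close>), and applying the bound to this vector gives the distance from an arbitrary point to the group. Taking
  for \<open>s\<close> the largest integer below \<open>p\<^bsup>1/d\<^esup>\<close>, which is at least half of it, the error is at most \<open>2 \<pi> k\<^sup>2/p\<^bsup>1/d\<^esup>\<close>.

  The asymptotic formula follows because \<open>m(C\<^sub>k) > 0\<close> for \<open>k \<ge> 2\<close>, as \<open>F\<^sub>k\<close> is close to \<open>k\<close> near the origin. For \<open>k = 1\<close> all
  absolute values involved are \<open>1\<close>.

  The algebraic input is that all primitive \<open>k\<close>-th roots of unity are conjugate (theorem \<open>cyclotomic_polynomial\<close>). It makes
  the coefficient vectors of the roots of unity well defined, provides the automorphisms of \<open>\<rat>(\<zeta>\<^sub>p)\<close> (lemma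
  \<open>gaussian_period_eq_sum\<close>), and shows that the conjugates of the period coincide only in the obvious way.
\<close>

hide_const (open) Polynomials.degree Polynomials.lead_coeff up_ring.coeff up_ring.monom Module.smult
  Divisibility.prime Divisibility.irreducible

section \<open>Roots of unity and cyclotomic polynomials\<close>

lemma map_poly_hom_add:
  assumes "h 0 = 0" "\<And>x y. h (x + y) = h x + h y"
  shows "map_poly h (p + q) = map_poly h p + map_poly h q"
  by (rule poly_eqI) (simp add: coeff_map_poly assms)

lemma map_poly_hom_mult:
  fixes h :: "'a::comm_semiring_1 \<Rightarrow> 'b::comm_semiring_1"
  assumes "h 0 = 0" "\<And>x y. h (x + y) = h x + h y" "\<And>x y. h (x * y) = h x * h y"
  shows "map_poly h (p * q) = map_poly h p * map_poly h q"
proof (rule poly_eqI)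
  have "h (sum f A) = (\<Sum>x\<in>A. h (f x))" for f and A :: "nat set"
    by (induct A rule: infinite_finite_induct) (simp_all add: assms)
  then show "coeff (map_poly h (p * q)) n = coeff (map_poly h p * map_poly h q) n" for n
    by (simp add: coeff_map_poly coeff_mult assms)
qed

lemma of_int_poly_add: "map_poly of_int (p + q) = (map_poly of_int p + map_poly of_int q :: 'a::comm_ring_1 poly)"
  by (rule map_poly_hom_add) simp_all

lemma of_int_poly_mult: "map_poly of_int (p * q) = (map_poly of_int p * map_poly of_int q :: 'a::comm_ring_1 poly)"
  by (rule map_poly_hom_mult) simp_all

lemma of_int_poly_minus: "map_poly of_int (- p) = (- map_poly of_int p :: 'a::comm_ring_1 poly)"
  by (rule poly_eqI) (simp add: coeff_map_poly)

lemma of_int_poly_diff: "map_poly of_int (p - q) = (map_poly of_int p - map_poly of_int q :: 'a::comm_ring_1 poly)"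
  by (rule poly_eqI) (simp add: coeff_map_poly)

lemma of_int_poly_power: "map_poly of_int (p ^ n) = (map_poly of_int p ^ n :: 'a::comm_ring_1 poly)"
  by (induct n) (simp_all add: of_int_poly_mult)

lemma degree_of_int_poly [simp]: "degree (map_poly of_int p :: 'a::{comm_ring_1,ring_char_0} poly) = degree p"
  by (rule degree_map_poly) simp

lemma of_int_poly_eq_0_iff [simp]: "(map_poly of_int p :: 'a::{comm_ring_1,ring_char_0} poly) = 0 \<longleftrightarrow> p = 0"
  by (subst map_poly_eq_0_iff) simp_all

abbreviation ipoly :: "int poly \<Rightarrow> 'a::comm_ring_1 \<Rightarrow> 'a" where
  "ipoly g w \<equiv> poly (map_poly of_int g) w"

lemma ipoly_pcompose: "ipoly (pcompose p q) w = ipoly p (ipoly q w)"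
  by (induct p) (simp_all add: pcompose_pCons map_poly_pCons of_int_poly_add of_int_poly_mult)

lemma ipoly_monom: "ipoly (monom 1 j) w = w ^ j"
  by (simp add: map_poly_monom poly_monom)

lemma ipoly_smult: "ipoly (smult c p) w = of_int c * ipoly p w"
  by (simp add: map_poly_smult)

lemmas ipoly_simps = of_int_poly_add of_int_poly_mult of_int_poly_diff of_int_poly_power of_int_poly_minus
  ipoly_pcompose ipoly_monom ipoly_smult poly_power

lemma ipoly_dvd_root: "f dvd g \<Longrightarrow> ipoly f w = 0 \<Longrightarrow> ipoly g w = 0"
  by (auto simp: ipoly_simps)

lemma freshman_dvd:
  fixes x y :: "'a::comm_ring_1"
  assumes "prime q"
  shows "of_nat q dvd (x + y) ^ q - x ^ q - y ^ q"
proof -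
  have q: "q > 1" using prime_gt_1_nat[OF assms] .
  have split: "{..q} = insert 0 (insert q {0<..<q})" using q by auto
  have "(x + y) ^ q - x ^ q - y ^ q = (\<Sum>k\<in>{0<..<q}. of_nat (q choose k) * x ^ k * y ^ (q - k))"
    using q by (simp add: binomial_ring split)
  also have "of_nat q dvd \<dots>"
  proof (rule dvd_sum)
    fix k assume "k \<in> {0<..<q}"
    then have "q dvd (q choose k)" using assms by (intro dvd_choose_prime) auto
    then have "(of_nat q :: 'a) dvd of_nat (q choose k)" by (metis dvd_def of_nat_mult)
    then show "(of_nat q :: 'a) dvd of_nat (q choose k) * x ^ k * y ^ (q - k)"
      by (simp add: dvd_mult2)
  qed
  finally show ?thesis .
qed

lemma fermat_int_dvd:
  assumes q: "prime q"
  shows "int q dvd a ^ q - a"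
proof -
  have e: "a ^ q - a = a * (a ^ (q - 1) - 1)"
    using prime_gt_0_nat[OF q] by (simp add: right_diff_distrib flip: power_Suc)
  show ?thesis
  proof (cases "int q dvd a")
    case True
    then show ?thesis unfolding e by (rule dvd_mult2)
  next
    case False
    have "prime (int q)" using q by simp
    then have "coprime a (int q)" using False prime_imp_coprime coprime_commute by blast
    moreover have "residues (int q)" using prime_gt_1_nat[OF q] by (simp add: residues_def)
    ultimately have "[a ^ (q - 1) = 1] (mod int q)"
      using residues.euler_theorem[of "int q" a] q by (simp add: totient_prime)
    then show ?thesis unfolding e by (simp add: cong_iff_dvd_diff)
  qed
qed

text \<open>Modulo a prime \<open>q\<close> the \<open>q\<close>-th power map is additive and, by Fermat, fixes the coefficients.\<close>

lemma frobenius_dvd: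
  fixes f :: "int poly"
  assumes q: "prime q"
  shows "of_nat q dvd pcompose f (monom 1 q) - f ^ q"
proof (induct f)
  case 0
  then show ?case using prime_gt_0_nat[OF q] by (simp add: power_0_left)
next
  case (pCons a f)
  let ?X = "monom 1 1 :: int poly"
  have e: "pCons a f = [:a:] + ?X * f" by (simp add: monom_altdef)
  have 1: "of_nat q dvd ([:a:] + ?X * f) ^ q - [:a:] ^ q - (?X * f) ^ q"
    by (rule freshman_dvd[OF q])
  have "int q dvd a ^ q - a" by (rule fermat_int_dvd[OF q])
  then obtain b where "a ^ q - a = int q * b" ..
  then have "[:a:] ^ q - [:a:] = of_nat q * [:b:]"
    by (simp add: poly_const_pow of_nat_poly)
  then have 2: "of_nat q dvd [:a:] ^ q - [:a:]" by (rule dvdI)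
  have 3: "of_nat q dvd ?X ^ q * (pcompose f (monom 1 q) - f ^ q)"
    using pCons(2) by (rule dvd_mult)
  have X: "?X ^ q = monom 1 q" by (simp add: monom_power)
  have "pcompose (pCons a f) (monom 1 q) = [:a:] + ?X ^ q * pcompose f (monom 1 q)"
    by (simp only: pcompose_pCons X)
  moreover have "(pCons a f) ^ q = (([:a:] + ?X * f) ^ q - [:a:] ^ q - (?X * f) ^ q)
      + [:a:] ^ q + ?X ^ q * f ^ q"
    unfolding e by (simp only: power_mult_distrib diff_add_cancel)
  ultimately have "pcompose (pCons a f) (monom 1 q) - (pCons a f) ^ q =
    ?X ^ q * (pcompose f (monom 1 q) - f ^ q) - ([:a:] ^ q - [:a:])
     - (([:a:] + ?X * f) ^ q - [:a:] ^ q - (?X * f) ^ q)"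
    by (simp only: right_diff_distrib)
  then show ?case using 1 2 3 by (simp only: dvd_diff)
qed

text \<open>Gauss's lemma, in the form needed for algebraic integers: a primitive integer polynomial of
  least degree with root \<open>z\<close> divides all the others, hence also the given monic one.\<close>

lemma int_minimal_polynomial:
  fixes z :: complex
  assumes p: "lead_coeff p = 1" "ipoly p z = 0"
  obtains f where "lead_coeff f = 1" "\<And>g. ipoly g z = 0 \<longleftrightarrow> f dvd g"
proof -
  let ?P = "\<lambda>g::int poly. g \<noteq> 0 \<and> ipoly g z = 0"
  have "?P p" using p by auto
  then obtain g where g: "g \<noteq> 0" "ipoly g z = 0" and min: "\<And>h. ?P h \<Longrightarrow> degree g \<le> degree h"
    using ex_has_least_nat[of ?P p degree] by blast
  define f where "f = primitive_part g"
  have gf: "g = smult (content g) f" by (simp add: f_def)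
  have cf: "content f = 1" using g(1) by (simp add: f_def)
  have f0: "f \<noteq> 0" using gf g by auto
  have fz: "ipoly f z = 0" using g gf by (metis content_eq_zero_iff ipoly_smult mult_eq_0_iff of_int_eq_0_iff)
  have df: "degree f = degree g" by (simp add: f_def)
  have fd: "f dvd h" if h: "ipoly h z = 0" for h
  proof -
    obtain a q where a: "a \<noteq> 0" and e: "smult a h = f * q + pseudo_mod h f"
      using pseudo_mod(1)[OF f0] by blast
    have "ipoly (pseudo_mod h f) z = 0"
      using arg_cong[OF e, of "\<lambda>p. ipoly p z"] h fz by (simp add: ipoly_simps)
    then have r0: "pseudo_mod h f = 0"
      using min[of "pseudo_mod h f"] pseudo_mod(2)[OF f0, of h] df by fastforce
    have "[:a:] dvd f * q" using e r0 by (metis add.right_neutral const_poly_dvd_iff coeff_smult dvd_triv_left)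
    then have "a dvd content q" using cf by (simp add: const_poly_dvd_iff_dvd_content content_mult)
    then obtain q' where "q = [:a:] * q'" by (metis const_poly_dvd_iff_dvd_content dvdE)
    then have "smult a h = smult a (f * q')" using e r0 by simp
    then show ?thesis using a by (metis dvd_triv_left smult_eq_iff smult_cancel)
  qed
  define c where "c = lead_coeff f"
  have "f dvd p" using fd p by blast
  then have "c dvd 1" unfolding c_def using p(1) by (metis dvdE dvd_triv_left lead_coeff_mult)
  then have c: "c * c = 1" by (metis zmult_eq_1_iff dvdE mult_minus_left mult_minus_right minus_minus)
  show ?thesis
  proof
    show "lead_coeff (smult c f) = 1" using c f0 by (simp add: c_def)
    show "ipoly h z = 0 \<longleftrightarrow> smult c f dvd h" for h
    proof
      assume "ipoly h z = 0"
      then obtain q where "h = f * q" using fd by blast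
      then have "h = smult c f * smult c q" using c by simp
      then show "smult c f dvd h" by (rule dvdI)
    next
      assume "smult c f dvd h"
      then show "ipoly h z = 0" using fz ipoly_dvd_root[of "smult c f" h z] by (simp add: ipoly_smult)
    qed
  qed
qed

lemma int_poly_monic_div:
  fixes f g :: "int poly"
  assumes "lead_coeff f = 1" "degree f > 0"
  obtains s r where "g = f * s + r" "degree r < degree f"
proof -
  have f0: "f \<noteq> 0" using assms(2) by auto
  obtain q r where qr: "pseudo_divmod g f = (q, r)" by fastforce
  show ?thesis
    using that[of q r] pseudo_divmod[OF f0 qr] assms by auto
qed

context
  fixes k :: nat and w :: complex
  assumes w: "primitive_root_of_unity k w"
begin

lemma primitive_root_pos: "k > 0"
  using w by (simp add: primitive_root_of_unity_def)

lemma primitive_root_power: "w ^ k = 1"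
  using w by (simp add: primitive_root_of_unity_def)

lemma primitive_root_nonzero: "w \<noteq> 0"
  using primitive_root_power primitive_root_pos by (auto simp: power_0_left)

lemma primitive_root_power_mod: "w ^ (i mod k) = w ^ i"
proof -
  have "w ^ i = w ^ (k * (i div k) + i mod k)" by simp
  also have "\<dots> = w ^ (i mod k)" by (simp only: power_add power_mult primitive_root_power) simp
  finally show ?thesis by simp
qed

lemma primitive_root_power_eq_1_iff: "w ^ i = 1 \<longleftrightarrow> k dvd i"
proof -
  have "w ^ (i mod k) = 1 \<longleftrightarrow> i mod k = 0"
    using w primitive_root_pos unfolding primitive_root_of_unity_def
    by (metis One_nat_def Suc_leI bot_nat_0.not_eq_extremum mod_less_divisor power_0)
  then show ?thesis by (simp add: primitive_root_power_mod dvd_eq_mod_eq_0)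
qed

lemma primitive_root_power_eq_iff: "w ^ i = w ^ j \<longleftrightarrow> [i = j] (mod k)"
proof -
  have *: "w ^ i = w ^ j \<longleftrightarrow> [i = j] (mod k)" if "i \<le> j" for i j
  proof -
    have "w ^ j = w ^ i * w ^ (j - i)" using that by (simp flip: power_add)
    then have "w ^ i = w ^ j \<longleftrightarrow> w ^ (j - i) = 1" using primitive_root_nonzero by auto
    also have "\<dots> \<longleftrightarrow> [j = i] (mod k)"
      using that by (simp add: primitive_root_power_eq_1_iff cong_altdef_nat)
    finally show ?thesis by (simp add: cong_sym_eq)
  qed
  show ?thesis using *[of i j] *[of j i] by (cases "i \<le> j") (auto simp: cong_sym_eq)
qed

lemma primitive_root_inj: "inj_on (\<lambda>i. w ^ i) {..<k}"
  by (auto simp: inj_on_def primitive_root_power_eq_iff cong_def)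

lemma roots_of_unity_eq_powers: "{u. u ^ k = 1} = (\<lambda>i. w ^ i) ` {..<k}"
proof (rule sym, rule card_subset_eq)
  show "finite {u::complex. u ^ k = 1}" using primitive_root_pos by (intro finite_roots_unity) auto
  show "(\<lambda>i. w ^ i) ` {..<k} \<subseteq> {u. u ^ k = 1}"
    by (auto simp: primitive_root_power simp flip: power_mult) (metis mult.commute power_mult power_one primitive_root_power)
  show "card ((\<lambda>i. w ^ i) ` {..<k}) = card {u::complex. u ^ k = 1}"
    using primitive_root_pos by (simp add: card_image primitive_root_inj card_complex_roots_unity)
qed

lemma primitive_root_power_primitive_iff: "primitive_root_of_unity k (w ^ m) \<longleftrightarrow> coprime m k"
proof
  assume "coprime m k"
  show "primitive_root_of_unity k (w ^ m)"
    unfolding primitive_root_of_unity_def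
  proof (intro conjI allI impI)
    show "k \<ge> 1" using primitive_root_pos by simp
    show "(w ^ m) ^ k = 1" by (metis mult.commute power_mult power_one primitive_root_power)
    show "(w ^ m) ^ j \<noteq> 1" if "1 \<le> j \<and> j < k" for j
    proof -
      have "\<not> k dvd j" using that by (auto dest: dvd_imp_le)
      then have "\<not> k dvd m * j" using \<open>coprime m k\<close> by (simp add: coprime_dvd_mult_right_iff coprime_commute)
      then show ?thesis by (simp add: primitive_root_power_eq_1_iff flip: power_mult)
    qed
  qed
next
  assume prim: "primitive_root_of_unity k (w ^ m)"
  define d where "d = gcd m k"
  have d0: "d > 0" using primitive_root_pos by (simp add: d_def)
  have "k dvd m * (k div d)"
    by (metis d_def div_mult_swap dvd_div_mult dvd_triv_right gcd_dvd1 gcd_dvd2 mult.commute dvd_triv_left)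
  then have "(w ^ m) ^ (k div d) = 1" by (simp add: primitive_root_power_eq_1_iff flip: power_mult)
  moreover have "k div d \<ge> 1"
    using primitive_root_pos d0 by (metis d_def div_greater_zero_iff One_nat_def Suc_leI gcd_le2_nat not_gr_zero)
  ultimately have "\<not> k div d < k" using prim by (auto simp: primitive_root_of_unity_def)
  then have "d = 1" using d0 primitive_root_pos by (metis Suc_lessI One_nat_def div_less_dividend)
  then show "coprime m k" unfolding d_def coprime_iff_gcd_eq_1 .
qed

lemma primitive_root_obtain_power:
  assumes "u ^ k = 1"
  obtains i where "i < k" "u = w ^ i"
  using assms roots_of_unity_eq_powers by blast

lemma card_primitive_roots: "card {u. primitive_root_of_unity k u} = totient k"
proof -
  have "bij_betw (\<lambda>i. w ^ i) (totatives k) {u. primitive_root_of_unity k u}"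
  proof (rule bij_betwI')
    fix x y assume xy: "x \<in> totatives k" "y \<in> totatives k"
    show "(w ^ x = w ^ y) = (x = y)"
    proof (cases "k = 1")
      case True
      then have "w = 1" using primitive_root_power by simp
      moreover have "x = 1" "y = 1" using xy True by (auto simp: totatives_def)
      ultimately show ?thesis by simp
    next
      case False
      then have "k > 1" using primitive_root_pos by simp
      then have "x < k" "y < k" using xy by (simp_all add: totatives_less)
      then show ?thesis by (simp add: primitive_root_power_eq_iff cong_def)
    qed
  next
    fix x assume "x \<in> totatives k"
    then show "w ^ x \<in> {u. primitive_root_of_unity k u}"
      by (simp add: primitive_root_power_primitive_iff totatives_def)
  next
    fix y assume y: "y \<in> {u. primitive_root_of_unity k u}"
    then have "y ^ k = 1" by (simp add: primitive_root_of_unity_def)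
    then obtain i where i: "i < k" "y = w ^ i" by (rule primitive_root_obtain_power)
    then have c: "coprime i k" using y by (simp add: primitive_root_power_primitive_iff)
    show "\<exists>x\<in>totatives k. y = w ^ x"
    proof (cases "i = 0")
      case True
      then have "k = 1" using c by simp
      then have "w = 1" using primitive_root_power by simp
      then show ?thesis using i \<open>k = 1\<close> by (intro bexI[of _ 1]) (simp_all add: totatives_def)
    next
      case False
      then have "i \<in> totatives k" using i(1) c by (simp add: totatives_def)
      then show ?thesis using i(2) by blast
    qed
  qed
  then show ?thesis unfolding totient_def by (rule bij_betw_same_card[symmetric])
qed

end


lemma primitive_root_sum_powers:
  assumes z: "primitive_root_of_unity k z"
  shows "(\<Sum>u | u ^ k = 1. (u::complex) ^ j) = (if k dvd j then of_nat k else 0)"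
proof -
  have "(\<Sum>u | u ^ k = 1. (u::complex) ^ j) = (\<Sum>i<k. (z ^ i) ^ j)"
    unfolding roots_of_unity_eq_powers[OF z] by (subst sum.reindex[OF primitive_root_inj[OF z]]) simp
  also have "\<dots> = (\<Sum>i<k. (z ^ j) ^ i)" by (intro sum.cong refl) (simp add: mult.commute flip: power_mult)
  also have "\<dots> = (if k dvd j then of_nat k else 0)"
  proof (cases "k dvd j")
    case True
    then have "z ^ j = 1" by (simp add: primitive_root_power_eq_1_iff[OF z])
    then show ?thesis using True by simp
  next
    case False
    then have "z ^ j \<noteq> 1" by (simp add: primitive_root_power_eq_1_iff[OF z])
    moreover have "(z ^ j) ^ k = 1"
      by (metis mult.commute power_mult power_one primitive_root_power[OF z])
    ultimately show ?thesis using False by (simp add: geometric_sum)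
  qed
  finally show ?thesis .
qed

text \<open>Landau's argument. The remainder of \<open>f(X\<^sup>j)\<close> modulo \<open>f\<close> depends only on \<open>j mod k\<close>, so the coefficients
  of these remainders are bounded. For a prime \<open>q\<close> the remainder is divisible by \<open>q\<close>, by the
  Frobenius congruence, so it vanishes once \<open>q\<close> exceeds the bound.\<close>

lemma minimal_polynomial_dvd_frobenius:
  fixes z :: complex
  assumes z: "primitive_root_of_unity k z"
    and monic: "lead_coeff f = 1" and dvd: "\<And>g. ipoly g z = 0 \<longleftrightarrow> f dvd g" and deg: "degree f > 0"
  obtains M where "\<And>q. prime q \<Longrightarrow> q > M \<Longrightarrow> f dvd pcompose f (monom 1 q)"
proof -
  have "\<exists>s r. pcompose f (monom 1 j) = f * s + r \<and> degree r < degree f" for j :: nat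
    using int_poly_monic_div[OF monic deg, of "pcompose f (monom 1 j)"] by blast
  then have "\<forall>j::nat. \<exists>sr. pcompose f (monom 1 j) = f * fst sr + snd sr \<and> degree (snd sr) < degree f"
    by simp
  then obtain sr where "\<forall>j::nat. pcompose f (monom 1 j) = f * fst (sr j) + snd (sr j) \<and> degree (snd (sr j)) < degree f"
    unfolding choice_iff by blast
  then obtain s r where sr: "\<And>j::nat. pcompose f (monom 1 j) = f * s j + r j" "\<And>j. degree (r j) < degree f"
    using that[of "\<lambda>j. fst (sr j)" "\<lambda>j. snd (sr j)"] by blast
  define M where "M = (\<Sum>j<k. \<Sum>i\<le>degree f. nat \<bar>coeff (r j) i\<bar>)"
  show ?thesis
  proof
    fix q :: nat
    assume q: "prime q" "q > M"
    obtain h where h: "pcompose f (monom 1 q) - f ^ q = of_nat q * h" using frobenius_dvd[OF q(1), of f] by blast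
    obtain s' t where t: "h = f * s' + t" "degree t < degree f" using int_poly_monic_div[OF monic deg, of h] by blast
    define j where "j = q mod k"
    have j: "j < k" using primitive_root_pos[OF z] by (simp add: j_def)
    have "ipoly (pcompose f (monom 1 q) - pcompose f (monom 1 j)) z = 0"
      by (simp add: ipoly_simps j_def primitive_root_power_mod[OF z])
    then have 1: "f dvd pcompose f (monom 1 q) - pcompose f (monom 1 j)" using dvd by blast
    have 2: "f dvd f ^ q" using prime_gt_0_nat[OF q(1)] by (simp add: dvd_power)
    have e: "of_nat q * t - r j = (pcompose f (monom 1 q) - pcompose f (monom 1 j)) - f ^ q
        + f * (s j - of_nat q * s')"
    proof -
      have "of_nat q * t = of_nat q * h - f * (of_nat q * s')" by (simp add: t(1) algebra_simps)
      also have "of_nat q * h = pcompose f (monom 1 q) - f ^ q" by (simp only: h)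
      finally show ?thesis using sr(1)[of j] by (simp add: algebra_simps)
    qed
    have 3: "f dvd of_nat q * t - r j" unfolding e by (rule dvd_add[OF dvd_diff[OF 1 2] dvd_triv_left])
    have "degree (of_nat q * t - r j) < degree f"
    proof (rule degree_diff_less)
      have "degree (of_nat q * t) \<le> degree t" by (simp add: of_nat_poly degree_smult_le)
      then show "degree (of_nat q * t) < degree f" using t(2) by simp
    qed (rule sr(2))
    then have "of_nat q * t - r j = 0" using dvd_imp_degree_le[OF 3] by (cases "of_nat q * t - r j = 0") auto
    then have 4: "of_nat q * t = r j" by simp
    have "t = 0"
    proof (rule poly_eqI)
      fix i
      have c: "coeff (r j) i = int q * coeff t i" unfolding 4[symmetric] by (simp add: of_nat_poly)
      show "coeff t i = coeff 0 i"
      proof (cases "i \<le> degree f")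
        case True
        have "nat \<bar>coeff (r j) i\<bar> \<le> (\<Sum>i\<le>degree f. nat \<bar>coeff (r j) i\<bar>)"
          using True by (intro member_le_sum) auto
        also have "\<dots> \<le> M" unfolding M_def using j
          by (intro member_le_sum[of j "{..<k}" "\<lambda>j. \<Sum>i\<le>degree f. nat \<bar>coeff (r j) i\<bar>"]) auto
        finally have "\<bar>coeff (r j) i\<bar> < int q" using q(2) by linarith
        then have "int q * \<bar>coeff t i\<bar> < int q * 1" using c by (simp add: abs_mult)
        then have "\<bar>coeff t i\<bar> < 1" using prime_gt_0_nat[OF q(1)] by (subst (asm) mult_less_cancel_left_pos) auto
        then show ?thesis by simp
      next
        case False
        then show ?thesis using t(2) by (simp add: coeff_eq_0)
      qed
    qed
    then have "r j = 0" using 4 by simp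
    then have "f dvd pcompose f (monom 1 j)" using sr(1)[of j] by simp
    then show "f dvd pcompose f (monom 1 q)" using 1 by (metis dvd_add_right_iff diff_add_cancel)
  qed
qed

text \<open>Adding to \<open>m\<close> the product of \<open>k\<close> and the small primes not dividing \<open>m\<close>
  makes every small prime divide exactly one of the two summands.\<close>

lemma exists_coprime_to_small_primes:
  fixes m k M :: nat
  assumes "coprime m k" "k > 0"
  obtains j where "[j = m] (mod k)" "j > 0" "\<And>q. prime q \<Longrightarrow> q dvd j \<Longrightarrow> q > M"
proof -
  define P where "P = {q. prime q \<and> q \<le> M \<and> \<not> q dvd m}"
  have fin: "finite P" by (rule finite_subset[of _ "{..M}"]) (auto simp: P_def)
  define j where "j = m + k * \<Prod>P"
  have "\<Prod>P > 0" by (rule prod_pos) (auto simp: P_def prime_gt_0_nat)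
  then have j0: "j > 0" using assms(2) by (simp add: j_def)
  have "q > M" if q: "prime q" "q dvd j" for q
  proof (rule ccontr)
    assume "\<not> q > M"
    then have qM: "q \<le> M" by simp
    show False
    proof (cases "q dvd m")
      case True
      then have "q dvd k * \<Prod>P" using q(2) by (simp add: j_def dvd_add_right_iff)
      moreover have "\<not> q dvd k" using True assms(1) q(1) by (metis coprime_common_divisor_nat not_prime_1 prime_nat_iff)
      ultimately have "q dvd \<Prod>P" using q(1) prime_dvd_mult_iff by blast
      then obtain p where "p \<in> P" "q dvd p" using prime_dvd_prod_iff[OF fin q(1), of "\<lambda>x. x"] by auto
      then have "q = p" using q(1) by (simp add: P_def primes_dvd_imp_eq)
      then show False using True \<open>p \<in> P\<close> by (simp add: P_def)
    next
      case False
      then have "q \<in> P" using q(1) qM by (simp add: P_def)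
      then have "q dvd \<Prod>P" using fin dvd_prodI[of P q "\<lambda>x. x"] by simp
      then show False using q(2) False by (simp add: j_def dvd_add_left_iff)
    qed
  qed
  moreover have "[j = m] (mod k)" by (simp add: j_def cong_def)
  ultimately show ?thesis using that j0 by blast
qed

text \<open>The primitive \<open>k\<close>-th roots of unity are conjugate: the exponents attainable by repeated use of the previous
  lemma include a representative of every residue class coprime to \<open>k\<close>.\<close>

lemma minimal_polynomial_conjugate_root:
  fixes z :: complex
  assumes z: "primitive_root_of_unity k z"
    and monic: "lead_coeff f = 1" and dvd: "\<And>g. ipoly g z = 0 \<longleftrightarrow> f dvd g" and deg: "degree f > 0"
    and m: "coprime m k"
  shows "ipoly f (z ^ m) = 0"
proof -
  obtain M where M: "\<And>q. prime q \<Longrightarrow> q > M \<Longrightarrow> f dvd pcompose f (monom 1 q)"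
    using minimal_polynomial_dvd_frobenius[OF z monic dvd deg] by blast
  obtain j where j: "[j = m] (mod k)" "j > 0" "\<And>q. prime q \<Longrightarrow> q dvd j \<Longrightarrow> q > M"
    using exists_coprime_to_small_primes[OF m primitive_root_pos[OF z]] by blast
  have "ipoly f (u ^ j) = 0" if "ipoly f u = 0" for u :: complex
    using j(2,3) that
  proof (induct j arbitrary: u rule: less_induct)
    case (less j)
    show ?case
    proof (cases "j = 1")
      case True
      then show ?thesis using less by simp
    next
      case False
      then obtain q where q: "prime q" "q dvd j" using prime_factor_nat by blast
      then obtain i where i: "j = q * i" by blast
      have "f dvd pcompose f (monom 1 q)" using M q less(3) by blast
      then have "ipoly (pcompose f (monom 1 q)) u = 0" using less(4) ipoly_dvd_root by blast
      then have "ipoly f (u ^ q) = 0" by (simp add: ipoly_simps)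
      moreover have "i < j" "0 < i" using i less(2) prime_gt_1_nat[OF q(1)] by auto
      ultimately have "ipoly f ((u ^ q) ^ i) = 0"
        using less(1)[of i "u ^ q"] less(3) i by (simp add: dvd_mult)
      then show ?thesis by (simp add: i power_mult)
    qed
  qed
  moreover have "ipoly f z = 0" using dvd by simp
  moreover have "z ^ j = z ^ m" using j(1) primitive_root_power_eq_iff[OF z] by blast
  ultimately show ?thesis by metis
qed

text \<open>Used to see that minimal polynomials have no proper factors with the same root.\<close>

lemma dvd_cofactor_imp_unit:
  fixes f :: "'a::idom"
  assumes "f = h * c" "f \<noteq> 0" "f dvd c"
  shows "h dvd 1"
proof -
  obtain b where "c = f * b" using assms(3) by blast
  then have "f * (h * b) = f * 1" using assms(1) by (metis mult.assoc mult.commute mult_1_right)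
  then have "h * b = 1" using assms(2) by (metis mult_cancel_left)
  then show ?thesis by (metis dvd_triv_left)
qed

text \<open>The minimal polynomial of one primitive root is that of all of them, as they are conjugate. It has no other
  roots: a root \<open>u\<close> of smaller order \<open>j\<close> would have the same minimal polynomial, which
  then divides \<open>X\<^sup>j - 1\<close>. It is squarefree, being a divisor of \<open>X\<^sup>k - 1\<close>, so
  its degree is the number of its roots.\<close>

theorem cyclotomic_polynomial:
  fixes z :: complex
  assumes z: "primitive_root_of_unity k z"
  obtains f :: "int poly" where
    "lead_coeff f = 1" "degree f = totient k"
    "\<And>u. ipoly f u = 0 \<longleftrightarrow> primitive_root_of_unity k u"
    "\<And>u g. primitive_root_of_unity k u \<Longrightarrow> ipoly g u = 0 \<longleftrightarrow> f dvd g"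
proof -
  define p :: "int poly" where "p = monom 1 k + [:-1:]"
  have k: "k > 0" using primitive_root_pos[OF z] .
  have pe: "ipoly p u = u ^ k - 1" for u :: complex by (simp add: p_def ipoly_simps map_poly_pCons)
  have dp: "degree p = k"
    unfolding p_def using k by (subst degree_add_eq_left) (auto simp: degree_monom_eq)
  have "lead_coeff p = 1" unfolding dp using k by (simp add: p_def coeff_pCons split: nat.splits)
  moreover have "ipoly p z = 0" using primitive_root_power[OF z] by (simp add: pe)
  ultimately obtain f where monic: "lead_coeff f = 1" and dvd: "\<And>g. ipoly g z = 0 \<longleftrightarrow> f dvd g"
    using int_minimal_polynomial by metis
  have fz: "ipoly f z = 0" using dvd by simp
  have deg: "degree f > 0"
  proof (rule ccontr)
    assume "\<not> degree f > 0"
    then have "f = 1" using monic by (metis degree_eq_zeroE bot_nat_0.not_eq_extremum lead_coeff_pCons(2) one_pCons)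
    then show False using fz by simp
  qed
  have f0: "f \<noteq> 0" using deg by auto
  have prim: "ipoly f u = 0" if "primitive_root_of_unity k u" for u
  proof -
    have "u ^ k = 1" using that by (simp add: primitive_root_of_unity_def)
    then obtain m where m: "u = z ^ m" by (rule primitive_root_obtain_power[OF z])
    then have "coprime m k" using that primitive_root_power_primitive_iff[OF z] by simp
    then show ?thesis using minimal_polynomial_conjugate_root[OF z monic dvd deg] m by simp
  qed
  have dvd': "ipoly g u = 0 \<longleftrightarrow> f dvd g" if u: "primitive_root_of_unity k u" for g u
  proof
    assume g: "ipoly g u = 0"
    obtain h where h: "lead_coeff h = 1" "\<And>g. ipoly g u = 0 \<longleftrightarrow> h dvd g"
    proof -
      have "ipoly p u = 0" using u by (simp add: pe primitive_root_power)
      then show ?thesis using int_minimal_polynomial[of p u] \<open>lead_coeff p = 1\<close> that by blast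
    qed
    have "h dvd f" using h(2) prim[OF u] by blast
    then obtain c where c: "f = h * c" by blast
    have "ipoly h z = 0 \<or> ipoly c z = 0" using fz by (simp add: c ipoly_simps)
    then have "f dvd h"
    proof
      assume "ipoly c z = 0"
      then have "f dvd c" using dvd by blast
      then have "h dvd 1" using dvd_cofactor_imp_unit[OF c f0] by blast
      then have "ipoly 1 u = (0::complex)" using h(2) by blast
      then show ?thesis by simp
    qed (use dvd in blast)
    then show "f dvd g" using h(2) g dvd_trans by blast
  next
    assume "f dvd g"
    then show "ipoly g u = 0" using prim[OF u] ipoly_dvd_root by blast
  qed
  have roots: "ipoly f u = 0 \<longleftrightarrow> primitive_root_of_unity k u" for u
  proof
    assume u: "ipoly f u = 0"
    have "f dvd p" using dvd \<open>ipoly p z = 0\<close> by blast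
    then have uk: "u ^ k = 1" using u ipoly_dvd_root[of f p u] by (simp add: pe)
    have "u ^ j \<noteq> 1" if j: "1 \<le> j" "j < k" for j
    proof
      assume uj: "u ^ j = 1"
      obtain m where m: "u = z ^ m" using primitive_root_obtain_power[OF z uk] by blast
      obtain h where h: "lead_coeff h = 1" "\<And>g. ipoly g u = 0 \<longleftrightarrow> h dvd g"
        using int_minimal_polynomial[of p u] \<open>lead_coeff p = 1\<close> uk by (metis pe diff_self)
      have "h dvd f" using h(2) u by blast
      then obtain c where c: "f = h * c" by blast
      have "ipoly (monom 1 j - 1) u = 0" using uj by (simp add: ipoly_simps)
      then have "h dvd monom 1 j - 1" using h(2) by blast
      moreover have "ipoly (monom 1 j - 1) z \<noteq> 0"
        using z j unfolding primitive_root_of_unity_def by (simp add: ipoly_simps)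
      ultimately have "ipoly h z \<noteq> 0" using ipoly_dvd_root by blast
      then have "ipoly c z = 0" using fz by (simp add: c ipoly_simps)
      then have "f dvd c" using dvd by blast
      then have "h dvd 1" using dvd_cofactor_imp_unit[OF c f0] by blast
      then have "ipoly 1 u = (0::complex)" using h(2) by blast
      then show False by simp
    qed
    then show "primitive_root_of_unity k u" using uk k by (simp add: primitive_root_of_unity_def)
  qed (rule prim)
  have "degree f = totient k"
  proof -
    let ?F = "map_poly of_int f :: complex poly"
    have sq: "rsquarefree ?F"
      unfolding rsquarefree_roots
    proof (intro allI notI, elim conjE)
      fix a assume a: "poly ?F a = 0" "poly (pderiv ?F) a = 0"
      obtain q where q: "p = f * q" using dvd \<open>ipoly p z = 0\<close> by blast
      have "map_poly of_int p = ?F * map_poly of_int q" by (simp add: q of_int_poly_mult)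
      then have "poly (pderiv (map_poly of_int p)) a = 0" using a by (simp add: pderiv_mult)
      moreover have "map_poly of_int p = (monom 1 k + [:-1:] :: complex poly)"
        by (simp add: p_def of_int_poly_add map_poly_monom map_poly_pCons)
      ultimately have "of_nat k * a ^ (k - 1) = 0" by (simp add: pderiv_add pderiv_monom pderiv_pCons poly_monom)
      moreover have "primitive_root_of_unity k a" using a roots by simp
      then have "a \<noteq> 0" by (rule primitive_root_nonzero)
      ultimately show False using k by simp
    qed
    have "degree f = degree ?F" by simp
    also have "?F = smult (lead_coeff ?F) (\<Prod>u|poly ?F u = 0. [:-u, 1:])"
      using complex_poly_decompose_rsquarefree[OF sq] by simp
    also have "degree \<dots> = card {u. poly ?F u = 0}"
      using monic by (simp add: coeff_map_poly degree_prod_eq_sum_degree)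
    also have "\<dots> = totient k" using card_primitive_roots[OF z] by (simp add: roots)
    finally show ?thesis .
  qed
  then show ?thesis using that monic roots dvd' by blast
qed

section \<open>The Galois group of a cyclotomic field of prime conductor\<close>

text \<open>The greatest common divisor has no complex root, so it is constant. The field of coefficients is left open
  because this is needed over the rationals and over the reals.\<close>

lemma bezout_no_common_root:
  fixes a b :: "'a::field_gcd poly" and h :: "'a \<Rightarrow> complex"
  assumes h: "h 0 = 0" "\<And>x y. h (x + y) = h x + h y" "\<And>x y. h (x * y) = h x * h y"
    and inj: "\<And>x. h x = 0 \<Longrightarrow> x = 0"
    and b: "b \<noteq> 0"
    and root: "\<And>w. poly (map_poly h a) w = 0 \<Longrightarrow> poly (map_poly h b) w \<noteq> 0"
  obtains u v where "u * a + v * b = 1"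
proof -
  let ?g = "gcd a b"
  have g0: "?g \<noteq> 0" using b by simp
  have "degree ?g = 0"
  proof (rule ccontr)
    assume "degree ?g \<noteq> 0"
    moreover have "degree (map_poly h ?g) = degree ?g" by (rule degree_map_poly) (use inj in auto)
    ultimately obtain w where w: "poly (map_poly h ?g) w = 0"
      using alg_closed_imp_poly_has_root[of "map_poly h ?g"] by auto
    have "poly (map_poly h c) w = 0" if "?g dvd c" for c
    proof -
      from that obtain d where "c = ?g * d" by blast
      then have "map_poly h c = map_poly h ?g * map_poly h d"
        using map_poly_hom_mult[of h ?g d] h by simp
      then show ?thesis using w by simp
    qed
    then show False using root[of w] by simp
  qed
  then have "is_unit ?g" unfolding is_unit_iff_degree[OF g0] .
  then have "?g = 1" by (simp only: is_unit_gcd_iff)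
  then have "fst (bezout_coefficients a b) * a + snd (bezout_coefficients a b) * b = 1"
    by (simp add: bezout_coefficients_fst_snd)
  then show ?thesis by (rule that)
qed

abbreviation rpoly :: "rat poly \<Rightarrow> complex \<Rightarrow> complex" where
  "rpoly q w \<equiv> poly (map_poly of_rat q) w"

lemma rpoly_simps:
  "rpoly (p + q) w = rpoly p w + rpoly q w" "rpoly (p * q) w = rpoly p w * rpoly q w"
  "rpoly (p - q) w = rpoly p w - rpoly q w" "rpoly (smult c q) w = of_rat c * rpoly q w"
  "rpoly (monom 1 j) w = w ^ j" "rpoly [:c:] w = of_rat c"
proof -
  show "rpoly (p + q) w = rpoly p w + rpoly q w" for p q
    by (subst map_poly_hom_add) (simp_all add: of_rat_add)
  show "rpoly (p * q) w = rpoly p w * rpoly q w"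
    by (subst map_poly_hom_mult) (simp_all add: of_rat_add of_rat_mult)
  show s: "rpoly (smult c q) w = of_rat c * rpoly q w" for c q
    by (simp add: map_poly_smult of_rat_mult)
  show "rpoly (p - q) w = rpoly p w - rpoly q w"
  proof -
    have "map_poly of_rat (p - q) = (map_poly of_rat p - map_poly of_rat q :: complex poly)"
      by (rule poly_eqI) (simp add: coeff_map_poly of_rat_diff)
    then show ?thesis by simp
  qed
  show "rpoly (monom 1 j) w = w ^ j" by (simp add: map_poly_monom poly_monom)
  show "rpoly [:c:] w = of_rat c" by (simp add: map_poly_pCons)
qed

lemma rpoly_pCons: "rpoly (pCons a q) w = of_rat a + w * rpoly q w"
  by (simp add: map_poly_pCons)

lemma rpoly_pcompose_monom: "rpoly (pcompose q (monom 1 j)) w = rpoly q (w ^ j)"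
  by (induct q) (simp_all add: pcompose_pCons rpoly_simps rpoly_pCons)

lemma rat_poly_clear_denominators:
  fixes q :: "rat poly"
  obtains c :: int and q' where "c \<noteq> 0" "smult (of_int c) q = map_poly of_int q'"
proof -
  have "\<exists>c q'. c \<noteq> 0 \<and> smult (of_int c) q = map_poly of_int q'"
  proof (induct q)
    case 0
    have "smult (of_int 1) (0::rat poly) = map_poly of_int 0" by simp
    then show ?case by (intro exI[of _ "1::int"] exI[of _ 0]) simp
  next
    case (pCons a q)
    then obtain c q' where c: "c \<noteq> 0" "smult (of_int c) q = map_poly of_int q'" by blast
    obtain n d where nd: "quotient_of a = (n, d)" by fastforce
    have d: "d > 0" using quotient_of_denom_pos[OF nd] .
    have a: "a = of_int n / of_int d" using quotient_of_div[OF nd] .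
    have "smult (of_int (c * d)) (pCons a q) = pCons (of_int (c * n)) (smult (of_int d) (smult (of_int c) q))"
      using d by (simp add: a mult.commute)
    also have "\<dots> = map_poly of_int (pCons (c * n) (smult d q'))"
      unfolding c(2) by (simp add: map_poly_pCons map_poly_smult)
    finally show ?case using c(1) d by (intro exI[of _ "c * d"] exI[of _ "pCons (c * n) (smult d q')"]) simp
  qed
  then show ?thesis using that by blast
qed

text \<open>Primitive roots of unity of the same order have the same minimal polynomial.\<close>

lemma rat_poly_root_primitive:
  assumes u: "primitive_root_of_unity k u" and v: "primitive_root_of_unity k v" and q: "rpoly q u = 0"
  shows "rpoly q v = 0"
proof -
  obtain c :: int and q' where c: "c \<noteq> 0" "smult (of_int c) q = map_poly of_int q'"
    by (rule rat_poly_clear_denominators)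
  have e: "of_int c * rpoly q w = ipoly q' w" for w
  proof -
    have "of_int c * rpoly q w = rpoly (smult (of_int c) q) w" by (simp add: rpoly_simps)
    also have "\<dots> = ipoly q' w" unfolding c(2) by (simp add: map_poly_map_poly o_def)
    finally show ?thesis .
  qed
  obtain f where "lead_coeff f = 1" "degree f = totient k"
    "\<And>u. ipoly f u = (0::complex) \<longleftrightarrow> primitive_root_of_unity k u"
    and f: "\<And>u g. primitive_root_of_unity k u \<Longrightarrow> ipoly g u = (0::complex) \<longleftrightarrow> f dvd g"
    by (rule cyclotomic_polynomial[OF u]) (rule that)
  have "ipoly q' u = 0" using e[of u] q by simp
  then have "ipoly q' v = 0" using f[OF u] f[OF v] by blast
  then show ?thesis using e[of v] c(1) by simp
qed

lemma ring_of_type_algebra_simps [simp]: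
  "carrier (ring_of_type_algebra :: complex ring) = UNIV"
  "x \<otimes>\<^bsub>ring_of_type_algebra\<^esub> y = (x * y :: complex)" "x \<oplus>\<^bsub>ring_of_type_algebra\<^esub> y = (x + y :: complex)"
  "\<one>\<^bsub>ring_of_type_algebra\<^esub> = (1 :: complex)" "\<zero>\<^bsub>ring_of_type_algebra\<^esub> = (0 :: complex)"
  by (simp_all add: ring_of_type_algebra_def)

lemma ring_of_type_algebra_minus: "\<ominus>\<^bsub>ring_of_type_algebra\<^esub> x = (- x :: complex)"
proof -
  interpret ring "ring_of_type_algebra :: complex ring" by (rule ring_from_type_algebra)
  show ?thesis by (rule minus_equality) simp_all
qed

lemma ring_of_type_algebra_inv: "x \<noteq> 0 \<Longrightarrow> inv\<^bsub>ring_of_type_algebra\<^esub> x = (inverse x :: complex)"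
proof -
  assume x: "x \<noteq> 0"
  interpret R: cring "ring_of_type_algebra :: complex ring" by (rule cring_from_type_algebra)
  show ?thesis using x by (intro R.comm_inv_char) simp_all
qed

lemma rat_adjoin_simps [simp]:
  "x \<otimes>\<^bsub>rat_adjoin z\<^esub> y = x * y" "x \<oplus>\<^bsub>rat_adjoin z\<^esub> y = x + y" "\<one>\<^bsub>rat_adjoin z\<^esub> = 1"
  by (simp_all add: rat_adjoin_def ring_of_type_algebra_def)

text \<open>The polynomial expressions in \<open>z\<close> already form a field: an expression \<open>q(z) \<noteq>
  0\<close> is inverted by means of a Bezout relation between \<open>q\<close> and the cyclotomic polynomial.\<close>

lemma carrier_rat_adjoin:
  assumes z: "primitive_root_of_unity k z"
  shows "carrier (rat_adjoin z) = range (\<lambda>q. rpoly q z)"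
proof -
  let ?G = "generate_field (ring_of_type_algebra :: complex ring) (insert z \<rat>)"
  obtain f where monic: "lead_coeff f = 1" and "degree f = totient k"
    and f_root: "\<And>u. ipoly f u = (0::complex) \<longleftrightarrow> primitive_root_of_unity k u"
    and "\<And>u g. primitive_root_of_unity k u \<Longrightarrow> ipoly g u = (0::complex) \<longleftrightarrow> f dvd g"
    by (rule cyclotomic_polynomial[OF z]) (rule that)
  let ?F = "map_poly of_int f :: rat poly"
  have F: "rpoly ?F w = ipoly f w" for w by (simp add: map_poly_map_poly o_def)
  have F0: "?F \<noteq> 0" using monic by auto
  have "rpoly q z \<in> ?G" for q
  proof (induct q)
    case 0
    have "of_rat 0 \<in> ?G" by (intro generate_field.incl insertI2 Rats_of_rat)
    then show ?case by simp
  next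
    case (pCons a q)
    have "of_rat a \<in> ?G" by (intro generate_field.incl insertI2 Rats_of_rat)
    moreover have "z \<in> ?G" by (intro generate_field.incl insertI1)
    then have "z * rpoly q z \<in> ?G" using generate_field.eng_mult[of z ring_of_type_algebra "insert z \<rat>" "rpoly q z"] pCons by simp
    ultimately show ?case
      using generate_field.eng_add[of "of_rat a" ring_of_type_algebra "insert z \<rat>" "z * rpoly q z"] by (simp add: rpoly_pCons)
  qed
  moreover have "x \<in> range (\<lambda>q. rpoly q z)" if "x \<in> ?G" for x
    using that
  proof (induct x rule: generate_field.induct)
    case one
    show ?case by (rule range_eqI[of _ _ "[:1:]"]) (simp add: rpoly_simps)
  next
    case (incl h)
    then consider "h = z" | r where "h = of_rat r" by (auto elim: Rats_cases)
    then show ?case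
    proof cases
      case 1
      then show ?thesis by (intro range_eqI[of _ _ "monom 1 1"]) (simp add: rpoly_simps)
    next
      case 2
      then show ?thesis by (intro range_eqI[of _ _ "[:r:]"]) (simp add: rpoly_simps)
    qed
  next
    case (a_inv h)
    then obtain q where "h = rpoly q z" by blast
    then have "- h = rpoly (smult (-1) q) z" unfolding rpoly_simps by simp
    then show ?case unfolding ring_of_type_algebra_minus by (rule range_eqI)
  next
    case (m_inv h)
    then obtain q where q: "h = rpoly q z" by blast
    have h0: "h \<noteq> 0" using m_inv by simp
    have "ipoly f w \<noteq> 0" if "rpoly q w = 0" for w
    proof
      assume "ipoly f w = 0"
      then have "primitive_root_of_unity k w" by (simp add: f_root)
      then have "rpoly q z = 0" by (rule rat_poly_root_primitive[OF _ z that])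
      then show False using h0 q by simp
    qed
    then have "rpoly ?F w \<noteq> 0" if "rpoly q w = 0" for w using that unfolding F by blast
    then obtain u v where uv: "u * q + v * ?F = 1"
      by (rule bezout_no_common_root[of of_rat ?F q, rotated 5]) (use F0 in \<open>simp_all add: of_rat_add of_rat_mult\<close>)
    have fz: "ipoly f z = 0" using f_root z by blast
    have "rpoly (u * q + v * ?F) z = 1" by (simp add: uv)
    then have "rpoly u z * h = 1" by (simp only: rpoly_simps F q fz mult_zero_right add_0_right)
    then have "inverse h = rpoly u z" using h0 by (metis inverse_unique mult.commute)
    then show ?case unfolding ring_of_type_algebra_inv[OF h0] by (rule range_eqI)
  next
    case (eng_add a b)
    then obtain p q where "a = rpoly p z" "b = rpoly q z" by blast
    then show ?case by (intro range_eqI[of _ _ "p + q"]) (simp add: rpoly_simps)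
  next
    case (eng_mult a b)
    then obtain p q where "a = rpoly p z" "b = rpoly q z" by blast
    then show ?case by (intro range_eqI[of _ _ "p * q"]) (simp add: rpoly_simps)
  qed
  ultimately have "?G = range (\<lambda>q. rpoly q z)" by blast
  then show ?thesis by (simp add: rat_adjoin_def)
qed

text \<open>The automorphism sending \<open>z\<close> to the conjugate \<open>u\<close>: replace \<open>z\<close> by \<open>u\<close> in a polynomial expression. The chosen
  expression does not matter because \<open>z\<close> and \<open>u\<close> satisfy the same rational equations.\<close>

definition conj_map :: "complex \<Rightarrow> complex \<Rightarrow> complex \<Rightarrow> complex" where
  "conj_map z u = (\<lambda>x\<in>carrier (rat_adjoin z). rpoly (SOME q. rpoly q z = x) u)"

context
  fixes p :: nat and z :: complex
  assumes p: "prime p" and z: "primitive_root_of_unity p z"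
begin

abbreviation Gal :: "(complex \<Rightarrow> complex) monoid" where
  "Gal \<equiv> galois_group (rat_adjoin z) \<rat>"

lemma rpoly_in_carrier: "rpoly q z \<in> carrier (rat_adjoin z)"
  by (simp add: carrier_rat_adjoin[OF z])

lemma conj_map_rpoly:
  assumes u: "primitive_root_of_unity p u"
  shows "conj_map z u (rpoly q z) = rpoly q u"
proof -
  define q' where "q' = (SOME q'. rpoly q' z = rpoly q z)"
  have "rpoly q' z = rpoly q z" unfolding q'_def by (rule someI[of _ q]) simp
  then have "rpoly (q' - q) z = 0" by (simp add: rpoly_simps)
  then have "rpoly (q' - q) u = 0" by (rule rat_poly_root_primitive[OF z u])
  then have "rpoly q' u = rpoly q u" by (simp add: rpoly_simps)
  then show ?thesis using rpoly_in_carrier by (simp add: conj_map_def q'_def)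
qed

lemma conj_map_generator: "primitive_root_of_unity p u \<Longrightarrow> conj_map z u z = u"
  using conj_map_rpoly[of u "monom 1 1"] by (simp add: rpoly_simps)

lemma primitive_power: "\<not> p dvd a \<Longrightarrow> primitive_root_of_unity p (z ^ a)"
  using p by (simp add: primitive_root_power_primitive_iff[OF z] prime_imp_coprime coprime_commute[of a])

lemma conj_map_power_rpoly:
  "\<not> p dvd a \<Longrightarrow> conj_map z (z ^ a) (rpoly q z) = rpoly (pcompose q (monom 1 a)) z"
  by (simp add: conj_map_rpoly primitive_power rpoly_pcompose_monom)

lemma compose_conj_map:
  assumes a: "\<not> p dvd a" and b: "\<not> p dvd b"
  shows "compose (carrier (rat_adjoin z)) (conj_map z (z ^ a)) (conj_map z (z ^ b)) = conj_map z (z ^ (a * b))"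
proof
  fix x
  have ab: "\<not> p dvd a * b" using p a b by (simp add: prime_dvd_mult_iff)
  show "compose (carrier (rat_adjoin z)) (conj_map z (z ^ a)) (conj_map z (z ^ b)) x = conj_map z (z ^ (a * b)) x"
  proof (cases "x \<in> carrier (rat_adjoin z)")
    case True
    then obtain q where x: "x = rpoly q z" by (auto simp: carrier_rat_adjoin[OF z])
    have "conj_map z (z ^ a) (conj_map z (z ^ b) x) = rpoly (pcompose q (monom 1 b)) (z ^ a)"
      unfolding x conj_map_power_rpoly[OF b] by (rule conj_map_rpoly[OF primitive_power[OF a]])
    also have "\<dots> = rpoly q (z ^ (a * b))" by (simp add: rpoly_pcompose_monom power_mult)
    also have "\<dots> = conj_map z (z ^ (a * b)) x" unfolding x by (simp only: conj_map_rpoly[OF primitive_power[OF ab]])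
    finally show ?thesis using True by (simp add: compose_def)
  next
    case False
    then show ?thesis by (simp add: compose_def conj_map_def)
  qed
qed

lemma inverse_exponent:
  assumes "\<not> p dvd a"
  obtains b where "\<not> p dvd b" "[b * a = 1] (mod p)"
proof -
  have "coprime a p" using p assms by (metis coprime_commute prime_imp_coprime)
  then obtain b where b: "[a * b = 1] (mod p)" using coprime_iff_invertible_nat by auto
  have "\<not> p dvd b"
  proof
    assume "p dvd b"
    then have "[a * b = 0] (mod p)" by (simp add: cong_0_iff)
    then have "[1 = 0] (mod p)" using b cong_sym cong_trans by blast
    then show False using p by (simp add: cong_0_iff)
  qed
  then show ?thesis using that b by (simp add: mult.commute)
qed

lemma power_cong: "[a = b] (mod p) \<Longrightarrow> z ^ a = z ^ b"
  by (simp add: primitive_root_power_eq_iff[OF z])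

lemma not_dvd_one: "\<not> p dvd 1"
  using prime_gt_1_nat[OF p] by simp

lemma conj_map_one: "conj_map z (z ^ 1) = (\<lambda>x\<in>carrier (rat_adjoin z). x)"
proof
  fix x
  show "conj_map z (z ^ 1) x = (\<lambda>x\<in>carrier (rat_adjoin z). x) x"
  proof (cases "x \<in> carrier (rat_adjoin z)")
    case True
    then obtain q where x: "x = rpoly q z" by (auto simp: carrier_rat_adjoin[OF z])
    then show ?thesis using True conj_map_rpoly[OF z, of q] by simp
  next
    case False
    then show ?thesis by (simp add: conj_map_def)
  qed
qed

lemma conj_map_Bij:
  assumes a: "\<not> p dvd a"
  shows "conj_map z (z ^ a) \<in> Bij (carrier (rat_adjoin z))"
proof -
  let ?K = "carrier (rat_adjoin z)"
  have into: "conj_map z (z ^ a) x \<in> ?K" if a: "\<not> p dvd a" and xK: "x \<in> ?K" for a x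
  proof -
    obtain q where x: "x = rpoly q z" using xK by (auto simp: carrier_rat_adjoin[OF z])
    show ?thesis unfolding x conj_map_power_rpoly[OF a] by (rule rpoly_in_carrier)
  qed
  obtain b where b: "\<not> p dvd b" "[b * a = 1] (mod p)" using inverse_exponent[OF a] .
  have inv: "conj_map z (z ^ b) (conj_map z (z ^ a) x) = x" "conj_map z (z ^ a) (conj_map z (z ^ b) x) = x"
    if x: "x \<in> ?K" for x
  proof -
    have 1: "z ^ (b * a) = z ^ 1" "z ^ (a * b) = z ^ 1" using b(2) by (simp_all only: power_cong mult.commute[of a b])
    have "compose ?K (conj_map z (z ^ b)) (conj_map z (z ^ a)) x = x"
      unfolding compose_conj_map[OF b(1) a] 1 conj_map_one using x by simp
    then show "conj_map z (z ^ b) (conj_map z (z ^ a) x) = x" using x by (simp add: compose_def)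
    have "compose ?K (conj_map z (z ^ a)) (conj_map z (z ^ b)) x = x"
      unfolding compose_conj_map[OF a b(1)] 1 conj_map_one using x by simp
    then show "conj_map z (z ^ a) (conj_map z (z ^ b) x) = x" using x by (simp add: compose_def)
  qed
  have "bij_betw (conj_map z (z ^ a)) ?K ?K"
    by (rule bij_betw_byWitness[of _ "conj_map z (z ^ b)"]) (use inv into a b(1) in auto)
  then show ?thesis by (simp add: Bij_def conj_map_def)
qed

lemma conj_map_in_Gal:
  assumes a: "\<not> p dvd a"
  shows "conj_map z (z ^ a) \<in> carrier Gal"
proof -
  let ?K = "carrier (rat_adjoin z)"
  let ?s = "conj_map z (z ^ a)"
  note u = primitive_power[OF a]
  have "?s \<in> ring_hom (rat_adjoin z) (rat_adjoin z)"
  proof (rule ring_hom_memI)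
    show "?s x \<in> ?K" if "x \<in> ?K" for x
      using conj_map_Bij[OF a] that by (auto simp: Bij_def bij_betw_def)
    fix x y assume xy: "x \<in> ?K" "y \<in> ?K"
    then obtain q r where x: "x = rpoly q z" and y: "y = rpoly r z" by (auto simp: carrier_rat_adjoin[OF z])
    show "?s (x \<otimes>\<^bsub>rat_adjoin z\<^esub> y) = ?s x \<otimes>\<^bsub>rat_adjoin z\<^esub> ?s y"
      using conj_map_rpoly[OF u, of "q * r"] by (simp add: x y conj_map_rpoly[OF u] rpoly_simps)
    show "?s (x \<oplus>\<^bsub>rat_adjoin z\<^esub> y) = ?s x \<oplus>\<^bsub>rat_adjoin z\<^esub> ?s y"
      using conj_map_rpoly[OF u, of "q + r"] by (simp add: x y conj_map_rpoly[OF u] rpoly_simps)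
  next
    show "?s \<one>\<^bsub>rat_adjoin z\<^esub> = \<one>\<^bsub>rat_adjoin z\<^esub>"
      using conj_map_rpoly[OF u, of "[:1:]"] by (simp add: rpoly_simps)
  qed
  moreover have "?s x = x" if x: "x \<in> \<rat>" for x
  proof -
    obtain r where "x = of_rat r" using x by (rule Rats_cases)
    then show ?thesis using conj_map_rpoly[OF u, of "[:r:]"] by (simp add: rpoly_simps)
  qed
  ultimately show ?thesis using conj_map_Bij[OF a] by (simp add: galois_group_def)
qed

text \<open>An automorphism is determined by the image of \<open>z\<close>, which is again a \<open>p\<close>-th root of
  unity, and is not \<open>1\<close> by injectivity.\<close>

lemma carrier_Gal: "s \<in> carrier Gal \<Longrightarrow> \<exists>a. a < p \<and> \<not> p dvd a \<and> s = conj_map z (z ^ a)"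
proof -
  let ?K = "carrier (rat_adjoin z)"
  assume "s \<in> carrier Gal"
  then have hom: "s \<in> ring_hom (rat_adjoin z) (rat_adjoin z)" and bij: "s \<in> Bij ?K"
    and fixed: "\<And>x. x \<in> \<rat> \<Longrightarrow> s x = x" by (auto simp: galois_group_def)
  have add: "s (x + y) = s x + s y" and mult: "s (x * y) = s x * s y" if "x \<in> ?K" "y \<in> ?K" for x y
    using ring_hom_add[OF hom that] ring_hom_mult[OF hom that] by simp_all
  have zK: "z \<in> ?K" using rpoly_in_carrier[of "monom 1 1"] by (simp add: rpoly_simps)
  have ratK: "of_rat r \<in> ?K" for r using rpoly_in_carrier[of "[:r:]"] by (simp add: rpoly_simps)
  have val: "s (rpoly q z) = rpoly q (s z)" for q
  proof (induct q)
    case 0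
    then show ?case using fixed[of 0] by simp
  next
    case (pCons a q)
    have "z * rpoly q z \<in> ?K" using rpoly_in_carrier[of "monom 1 1 * q"] by (simp only: rpoly_simps) simp
    then have "s (of_rat a + z * rpoly q z) = s (of_rat a) + s z * s (rpoly q z)"
      by (simp only: add[OF ratK] mult[OF zK rpoly_in_carrier])
    then show ?case by (simp only: rpoly_pCons pCons fixed[OF Rats_of_rat])
  qed
  have "s (rpoly (monom 1 p) z) = s z ^ p" unfolding val by (simp only: rpoly_simps)
  then have "s z ^ p = 1" using fixed[of 1] by (simp add: rpoly_simps primitive_root_power[OF z])
  then obtain a where a: "a < p" "s z = z ^ a" by (rule primitive_root_obtain_power[OF z])
  have "\<not> p dvd a"
  proof
    assume "p dvd a"
    then have "s z = 1" using a primitive_root_power_eq_1_iff[OF z] by simp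
    then have "s z = s 1" using fixed[of 1] by simp
    moreover have "1 \<in> ?K" using ratK[of 1] by simp
    ultimately have "z = 1" using bij zK by (auto simp: Bij_def bij_betw_def inj_on_def)
    then show False using primitive_root_power_eq_1_iff[OF z, of 1] not_dvd_one by simp
  qed
  moreover have "s = conj_map z (z ^ a)"
  proof
    fix x
    show "s x = conj_map z (z ^ a) x"
    proof (cases "x \<in> ?K")
      case True
      then obtain q where x: "x = rpoly q z" by (auto simp: carrier_rat_adjoin[OF z])
      show ?thesis unfolding x val a(2) by (rule conj_map_rpoly[OF primitive_power[OF \<open>\<not> p dvd a\<close>], symmetric])
    next
      case False
      then show ?thesis using bij by (simp add: Bij_def extensional_def conj_map_def)
    qed
  qed
  ultimately show ?thesis using a(1) by blast
qed

lemma mult_Gal: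
  assumes "\<not> p dvd a" "\<not> p dvd b"
  shows "conj_map z (z ^ a) \<otimes>\<^bsub>Gal\<^esub> conj_map z (z ^ b) = conj_map z (z ^ (a * b))"
  using assms by (simp add: galois_group_def BijGroup_def conj_map_Bij compose_conj_map)

lemma one_Gal: "\<one>\<^bsub>Gal\<^esub> = conj_map z (z ^ 1)"
  unfolding conj_map_one by (simp add: galois_group_def BijGroup_def)

lemma not_dvd_mult: "\<not> p dvd a \<Longrightarrow> \<not> p dvd b \<Longrightarrow> \<not> p dvd a * b"
  using p by (simp add: prime_dvd_mult_iff)

lemma not_dvd_power: "\<not> p dvd a \<Longrightarrow> \<not> p dvd a ^ n"
  using p prime_dvd_power by blast

lemma group_Gal: "group Gal"
proof (rule groupI)
  fix x y w assume x: "x \<in> carrier Gal" and y: "y \<in> carrier Gal" and w: "w \<in> carrier Gal"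
  obtain a where a: "\<not> p dvd a" "x = conj_map z (z ^ a)" using carrier_Gal[OF x] by blast
  obtain b where b: "\<not> p dvd b" "y = conj_map z (z ^ b)" using carrier_Gal[OF y] by blast
  obtain c where c: "\<not> p dvd c" "w = conj_map z (z ^ c)" using carrier_Gal[OF w] by blast
  show "x \<otimes>\<^bsub>Gal\<^esub> y \<in> carrier Gal"
    unfolding a(2) b(2) mult_Gal[OF a(1) b(1)] by (rule conj_map_in_Gal[OF not_dvd_mult[OF a(1) b(1)]])
  show "x \<otimes>\<^bsub>Gal\<^esub> y \<otimes>\<^bsub>Gal\<^esub> w = x \<otimes>\<^bsub>Gal\<^esub> (y \<otimes>\<^bsub>Gal\<^esub> w)"
    unfolding a(2) b(2) c(2) mult_Gal[OF a(1) b(1)] mult_Gal[OF b(1) c(1)]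
      mult_Gal[OF not_dvd_mult[OF a(1) b(1)] c(1)] mult_Gal[OF a(1) not_dvd_mult[OF b(1) c(1)]]
    by (simp only: mult.assoc)
next
  show "\<one>\<^bsub>Gal\<^esub> \<in> carrier Gal" unfolding one_Gal by (rule conj_map_in_Gal[OF not_dvd_one])
  fix x assume x: "x \<in> carrier Gal"
  obtain a where a: "\<not> p dvd a" "x = conj_map z (z ^ a)" using carrier_Gal[OF x] by blast
  show "\<one>\<^bsub>Gal\<^esub> \<otimes>\<^bsub>Gal\<^esub> x = x" unfolding one_Gal a(2) mult_Gal[OF not_dvd_one a(1)] by simp
  obtain b where b: "\<not> p dvd b" "[b * a = 1] (mod p)" using inverse_exponent[OF a(1)] .
  have "conj_map z (z ^ b) \<otimes>\<^bsub>Gal\<^esub> x = \<one>\<^bsub>Gal\<^esub>"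
    unfolding one_Gal a(2) mult_Gal[OF b(1) a(1)] power_cong[OF b(2)] ..
  then show "\<exists>y\<in>carrier Gal. y \<otimes>\<^bsub>Gal\<^esub> x = \<one>\<^bsub>Gal\<^esub>" using conj_map_in_Gal[OF b(1)] by blast
qed

lemma pow_Gal:
  assumes a: "\<not> p dvd a"
  shows "conj_map z (z ^ a) [^]\<^bsub>Gal\<^esub> (n::nat) = conj_map z (z ^ (a ^ n))"
proof (induct n)
  case 0
  then show ?case by (simp add: one_Gal nat_pow_def)
next
  case (Suc n)
  interpret group Gal by (rule group_Gal)
  show ?case
    unfolding nat_pow_Suc Suc mult_Gal[OF not_dvd_power[OF a] a] by (simp add: mult.commute)
qed

text \<open>In the cyclic group of units modulo \<open>p\<close> the equation \<open>h\<^sup>k = 1\<close> has no more than \<open>k\<close> solutions,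
  so they are the powers of \<open>g\<close>, and they make up the only subgroup of order \<open>k\<close>.\<close>

lemma cong_power_ord:
  assumes g: "ord p g = k" and k: "k > 0" and h: "[h ^ k = 1] (mod p)"
  obtains i where "i < k" "[h = g ^ i] (mod p)"
proof -
  let ?S = "{x\<in>{..<p}. [x ^ k = 1] (mod p)}"
  have cop: "coprime p g" using g k ord_gt_0_iff[of p g] by simp
  have inj: "inj_on (\<lambda>i. g ^ i mod p) {..<k}" using inj_power_mod[OF cop] g by simp
  have "(\<lambda>i. g ^ i mod p) ` {..<k} \<subseteq> ?S"
  proof (intro image_subsetI CollectI conjI)
    fix i
    show "g ^ i mod p \<in> {..<p}" using prime_gt_0_nat[OF p] by simp
    have "[(g ^ k) ^ i = 1 ^ i] (mod p)" using ord[of g p] unfolding g by (rule cong_pow)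
    then have "[(g ^ i) ^ k = 1] (mod p)" by (simp only: power_one power_mult[symmetric] mult.commute)
    then show "[(g ^ i mod p) ^ k = 1] (mod p)" by (simp add: cong_def power_mod)
  qed
  moreover have "finite ?S" by simp
  moreover have "card ?S \<le> card ((\<lambda>i. g ^ i mod p) ` {..<k})"
    using roots_mod_prime_bound[OF p k, of 1] inj by (simp add: card_image)
  ultimately have "(\<lambda>i. g ^ i mod p) ` {..<k} = ?S" by (intro card_seteq)
  moreover have "h mod p \<in> ?S" using h prime_gt_0_nat[OF p] by (simp add: cong_def power_mod)
  ultimately obtain i where "i < k" "h mod p = g ^ i mod p" by auto
  then show ?thesis using that by (simp add: cong_def)
qed

lemma gaussian_period_eq_sum:
  assumes g: "ord p g = k" and k: "k > 0"
  shows "gaussian_period k z = (\<Sum>i<k. z ^ (g ^ i))"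
proof -
  interpret G: group Gal by (rule group_Gal)
  have cop: "coprime p g" using g k ord_gt_0_iff[of p g] by simp
  have gp: "\<not> p dvd g" using cop p by (metis coprime_absorb_left not_prime_unit)
  note gi = not_dvd_power[OF gp]
  define s where "s i = conj_map z (z ^ (g ^ i))" for i
  define H where "H = s ` {..<k}"
  have s_z: "s i z = z ^ (g ^ i)" for i unfolding s_def by (rule conj_map_generator[OF primitive_power[OF gi]])
  have inj: "inj_on s {..<k}"
  proof (rule inj_onI)
    fix i j assume ij: "i \<in> {..<k}" "j \<in> {..<k}" "s i = s j"
    then have "z ^ (g ^ i) = z ^ (g ^ j)" using s_z by metis
    then have "g ^ i mod p = g ^ j mod p" by (simp add: primitive_root_power_eq_iff[OF z] cong_def)
    then show "i = j" using inj_power_mod[OF cop] ij g by (auto simp: inj_on_def)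
  qed
  have s_mod: "s (i mod k) = s i" for i
  proof -
    have "[g ^ (k * (i div k)) = 1] (mod p)" using ord_divides[of g "k * (i div k)" p] g by simp
    then have "[g ^ (k * (i div k)) * g ^ (i mod k) = 1 * g ^ (i mod k)] (mod p)" by (rule cong_mult) simp
    moreover have "g ^ (k * (i div k)) * g ^ (i mod k) = g ^ i" by (simp flip: power_add)
    ultimately show ?thesis unfolding s_def by (simp add: power_cong cong_sym_eq)
  qed
  have s_H: "s i \<in> H" for i unfolding H_def using k s_mod[of i] by (metis imageI lessThan_iff mod_less_divisor)
  have mult: "s i \<otimes>\<^bsub>Gal\<^esub> s j = s (i + j)" for i j
    unfolding s_def mult_Gal[OF gi gi] by (simp add: power_add)
  have sG: "s i \<in> carrier Gal" for i unfolding s_def by (rule conj_map_in_Gal[OF gi])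
  have s0: "s 0 = \<one>\<^bsub>Gal\<^esub>" unfolding s_def one_Gal by simp
  have sub: "subgroup H Gal"
  proof (rule G.subgroupI)
    show "H \<subseteq> carrier Gal" using sG by (auto simp: H_def)
    show "H \<noteq> {}" using k by (auto simp: H_def)
    fix x assume "x \<in> H"
    then obtain i where i: "i < k" "x = s i" by (auto simp: H_def)
    have "s (k - i) \<otimes>\<^bsub>Gal\<^esub> s i = \<one>\<^bsub>Gal\<^esub>" unfolding mult using i s_mod[of k] s0 by simp
    then have "inv\<^bsub>Gal\<^esub> x = s (k - i)" unfolding i(2) by (rule G.inv_equality[OF _ sG sG])
    then show "inv\<^bsub>Gal\<^esub> x \<in> H" using s_H by simp
    fix y assume "y \<in> H"
    then obtain j where j: "y = s j" by (auto simp: H_def)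
    show "x \<otimes>\<^bsub>Gal\<^esub> y \<in> H" unfolding i j mult by (rule s_H)
  qed
  have card: "card H = k" using inj by (simp add: H_def card_image)
  have uniq: "H' = H" if H': "subgroup H' Gal \<and> card H' = k" for H'
  proof -
    have "H' \<subseteq> H"
    proof
      fix x assume x: "x \<in> H'"
      interpret S: subgroup H' Gal using H' by simp
      interpret K: group "Gal\<lparr>carrier := H'\<rparr>" by (rule S.subgroup_is_group[OF group_Gal])
      have "x [^]\<^bsub>Gal\<lparr>carrier := H'\<rparr>\<^esub> order (Gal\<lparr>carrier := H'\<rparr>) = \<one>\<^bsub>Gal\<lparr>carrier := H'\<rparr>\<^esub>"
        using x by (intro K.pow_order_eq_1) simp
      then have pow: "x [^]\<^bsub>Gal\<^esub> k = \<one>\<^bsub>Gal\<^esub>" using H' by (simp add: order_def nat_pow_def)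
      obtain a where a: "\<not> p dvd a" "x = conj_map z (z ^ a)" using carrier_Gal S.subset x by blast
      have "conj_map z (z ^ (a ^ k)) = conj_map z (z ^ 1)" using pow unfolding a(2) pow_Gal[OF a(1)] one_Gal .
      then have "conj_map z (z ^ (a ^ k)) z = conj_map z (z ^ 1) z" by simp
      then have "z ^ (a ^ k) = z ^ 1"
        by (simp only: conj_map_generator[OF primitive_power[OF not_dvd_power[OF a(1)]]]
            conj_map_generator[OF primitive_power[OF not_dvd_one]])
      then have "[a ^ k = 1] (mod p)" by (simp only: primitive_root_power_eq_iff[OF z])
      then obtain i where i: "i < k" "[a = g ^ i] (mod p)" using cong_power_ord[OF g k] by blast
      then have "x = s i" unfolding a(2) s_def by (simp add: power_cong)
      then show "x \<in> H" using s_H by simp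
    qed
    moreover have "finite H" by (simp add: H_def)
    ultimately show ?thesis using H' card by (metis card_seteq order_refl)
  qed
  have "(THE H. subgroup H Gal \<and> card H = k) = H"
  proof (rule the_equality)
    show "subgroup H Gal \<and> card H = k" using sub card by simp
  qed (rule uniq)
  then have "gaussian_period k z = (\<Sum>\<sigma>\<in>H. \<sigma> z)" by (simp add: gaussian_period_def)
  also have "\<dots> = (\<Sum>i<k. z ^ (g ^ i))" unfolding H_def by (simp add: sum.reindex[OF inj] s_z)
  finally show ?thesis .
qed

end

section \<open>Primes congruent to 1 and elements of given order\<close>

text \<open>The elementary case of Dirichlet's theorem: a prime divisor \<open>p\<close> of \<open>\<Phi>\<^sub>n(n t)\<close> does not divide \<open>n\<close>,
  so \<open>n t\<close> has order exactly \<open>n\<close> modulo \<open>p\<close>.\<close>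

lemma exists_prime_cong_1:
  fixes z :: complex
  assumes z: "primitive_root_of_unity n z"
  obtains k where "k \<ge> 1" "prime (k * n + 1)"
proof -
  have n: "n > 0" using primitive_root_pos[OF z] .
  obtain f where monic: "lead_coeff f = 1" and df: "degree f = totient n"
    and dvd: "\<And>g. ipoly g z = 0 \<longleftrightarrow> f dvd g"
    using cyclotomic_polynomial[OF z] z by metis
  have fz: "ipoly f z = 0" using dvd by simp
  have deg: "degree f > 0" using df n by simp
  define P where "P = f * (f - 1) * (f + 1)"
  have "f \<noteq> 0" "f \<noteq> 1" using deg by auto
  moreover have "f + 1 \<noteq> 0" using deg by (metis add_eq_0_iff degree_1 degree_minus less_irrefl)
  ultimately have "P \<noteq> 0" by (simp add: P_def)
  then have "finite {x. poly P x = 0}" by (rule poly_roots_finite)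
  moreover have "infinite (range (\<lambda>t::nat. int (n * t)))"
    using n by (intro range_inj_infinite) (auto simp: inj_on_def)
  ultimately obtain t where t: "poly P (int (n * t)) \<noteq> 0"
    by (metis (mono_tags, lifting) infinite_super mem_Collect_eq rangeE subsetI)
  define x where "x = int (n * t)"
  have "poly f x \<noteq> 0" "poly f x \<noteq> 1" "poly f x \<noteq> -1"
    using t by (auto simp: P_def x_def)
  then have "\<bar>poly f x\<bar> \<noteq> 1" "poly f x \<noteq> 0" by auto
  then have "nat \<bar>poly f x\<bar> \<noteq> 1" by simp
  then obtain p where p: "prime p" "p dvd nat \<bar>poly f x\<bar>" using prime_factor_nat by blast
  have pf: "int p dvd poly f x" using p(2) by (metis abs_ge_zero dvd_abs_iff int_dvd_int_iff nat_0_le)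
  have f_dvd: "int p dvd poly g x" if "f dvd g" for g
    using that pf by (auto elim!: dvdE)
  have fx: "f dvd monom 1 n - 1"
    using primitive_root_power[OF z] by (simp flip: dvd add: ipoly_simps)
  have xn: "int p dvd x ^ n - 1" using f_dvd[OF fx] by (simp add: poly_monom)
  have "\<not> int p dvd x"
  proof
    assume "int p dvd x"
    then have "int p dvd x ^ n" using n by (metis dvd_power dvd_trans)
    then have "int p dvd 1" using dvd_diff[OF _ xn] by fastforce
    then show False using p(1) by (simp add: not_prime_unit)
  qed
  then have pn: "\<not> p dvd n" by (metis dvd_mult2 int_dvd_int_iff x_def)
  define y where "y = n * t"
  have cong: "int p dvd x ^ m - 1 \<longleftrightarrow> [y ^ m = 1] (mod p)" for m
  proof -
    have "[y ^ m = 1] (mod p) \<longleftrightarrow> [int (y ^ m) = int 1] (mod int p)" by (simp only: cong_int_iff)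
    also have "\<dots> \<longleftrightarrow> int p dvd x ^ m - 1" by (simp add: cong_iff_dvd_diff x_def y_def)
    finally show ?thesis by simp
  qed
  define m where "m = ord p y"
  have mn: "m dvd n" using xn unfolding cong ord_divides m_def .
  have "m = n"
  proof (rule ccontr)
    assume "m \<noteq> n"
    have m: "m > 0" "m < n" using mn n \<open>m \<noteq> n\<close> by (auto dest: dvd_imp_le intro: Nat.gr0I)
    obtain c where c: "n = m * c" using mn by blast
    define g :: "int poly" where "g = (\<Sum>i<c. monom 1 (m * i))"
    have geo: "(monom 1 m - 1) * g = monom 1 n - 1"
    proof -
      have "(monom 1 m - 1) * (\<Sum>i<c. (monom 1 m) ^ i) = (monom 1 m :: int poly) ^ c - 1"
        by (rule power_diff_1_eq[symmetric])
      then show ?thesis by (simp add: g_def monom_power c)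
    qed
    have "ipoly ((monom 1 m - 1) * g) z = 0" using dvd fx by (simp add: geo)
    moreover have "ipoly (monom 1 m - 1) z \<noteq> 0"
      using z m by (simp add: primitive_root_of_unity_def ipoly_simps)
    ultimately have "f dvd g" by (simp add: ipoly_simps flip: dvd)
    then have "int p dvd poly g x" by (rule f_dvd)
    moreover have "poly g x = (\<Sum>i<c. (x ^ m) ^ i)" by (simp add: g_def poly_sum poly_monom power_mult)
    moreover have "[(\<Sum>i<c. (x ^ m) ^ i) = (\<Sum>i<c. 1 ^ i)] (mod int p)"
    proof (rule cong_sum)
      have "int p dvd x ^ m - 1" unfolding cong m_def by (rule ord)
      then have "[x ^ m = 1] (mod int p)" by (simp add: cong_iff_dvd_diff)
      then show "[(x ^ m) ^ i = 1 ^ i] (mod int p)" for i by (rule cong_pow)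
    qed
    ultimately have "int p dvd int c" using cong_dvd_iff by fastforce
    then show False using pn c by simp
  qed
  then have "coprime p y" using n ord_eq_0[of p y] unfolding m_def by auto
  then have "n dvd p - 1"
    using order_divides_totient[of p y] totient_prime[OF p(1)] \<open>m = n\<close> unfolding m_def by simp
  then obtain k where k: "p - 1 = n * k" by blast
  have "p = k * n + 1" using k prime_gt_1_nat[OF p(1)] by (simp add: mult.commute)
  moreover from this have "k \<ge> 1" using prime_gt_1_nat[OF p(1)] by (cases k) auto
  ultimately show ?thesis using that p(1) by blast
qed

text \<open>The remainder on division by \<open>X\<^sup>k - 1\<close> has more roots than its degree allows.\<close>

lemma int_poly_dvd_of_roots_of_unity:
  fixes g :: "int poly"
  assumes k: "k > 0" and g: "\<And>u::complex. u ^ k = 1 \<Longrightarrow> ipoly g u = 0"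
  shows "monom 1 k - 1 dvd g"
proof -
  define p :: "int poly" where "p = monom 1 k + [:-1:]"
  have dp: "degree p = k"
    unfolding p_def using k by (subst degree_add_eq_left) (auto simp: degree_monom_eq)
  have "lead_coeff p = 1" unfolding dp using k by (simp add: p_def coeff_pCons split: nat.splits)
  then obtain s r where sr: "g = p * s + r" "degree r < degree p"
    using int_poly_monic_div[of p g] dp k by auto
  have "ipoly r u = 0" if "u ^ k = 1" for u :: complex
  proof -
    have "ipoly g u = ipoly p u * ipoly s u + ipoly r u" by (simp add: sr(1) ipoly_simps)
    moreover have "ipoly p u = 0" using that by (simp add: p_def ipoly_simps map_poly_pCons)
    ultimately show ?thesis using g[OF that] by simp
  qed
  then have sub: "{u::complex. u ^ k = 1} \<subseteq> {u. ipoly r u = 0}" by auto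
  have "r = 0"
  proof (rule ccontr)
    assume "r \<noteq> 0"
    then have r: "(map_poly of_int r :: complex poly) \<noteq> 0" by simp
    have "k = card {u::complex. u ^ k = 1}" using k by (simp add: card_complex_roots_unity)
    also have "\<dots> \<le> card {u::complex. ipoly r u = 0}" by (rule card_mono[OF poly_roots_finite[OF r] sub])
    also have "\<dots> \<le> degree r" using card_poly_roots_bound[OF r] by simp
    finally show False using sr(2) dp by simp
  qed
  moreover have "p = monom 1 k - 1" by (simp add: p_def one_pCons)
  ultimately show ?thesis using sr(1) by simp
qed

text \<open>Every root of \<open>X\<^sup>k - 1\<close> is a root of \<open>f \<Prod>\<^sub>m (X\<^sup>m - 1)\<close>, where
  \<open>m\<close> runs through \<open>1, \<dots>, k - 1\<close>: it is primitive or has smaller order. So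
  \<open>p\<close> divides the value of this product at \<open>g\<close>, but it divides no \<open>g\<^sup>m -
  1\<close>.\<close>

lemma cyclotomic_root_mod_prime:
  fixes z :: complex
  assumes z: "primitive_root_of_unity k z"
    and f: "\<And>u. primitive_root_of_unity k u \<Longrightarrow> ipoly f u = 0"
    and p: "prime p" and g: "ord p g = k"
  shows "int p dvd poly f (int g)"
proof -
  have k: "k > 0" using primitive_root_pos[OF z] .
  define h :: "int poly" where "h = f * (\<Prod>m\<in>{1..<k}. monom 1 m - 1)"
  have cong: "int p dvd int g ^ m - 1 \<longleftrightarrow> [g ^ m = 1] (mod p)" for m
  proof -
    have "[g ^ m = 1] (mod p) \<longleftrightarrow> [int (g ^ m) = int 1] (mod int p)" by (simp only: cong_int_iff)
    also have "\<dots> \<longleftrightarrow> int p dvd int g ^ m - 1" by (simp add: cong_iff_dvd_diff)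
    finally show ?thesis by simp
  qed
  have of_int_prod: "ipoly (\<Prod>m\<in>A. q m) u = (\<Prod>m\<in>A. ipoly (q m) u)" for q :: "nat \<Rightarrow> int poly" and A and u :: complex
    by (induct A rule: infinite_finite_induct) (simp_all add: of_int_poly_mult)
  have "monom 1 k - 1 dvd h"
  proof (rule int_poly_dvd_of_roots_of_unity[OF k])
    fix u :: complex assume u: "u ^ k = 1"
    show "ipoly h u = 0"
    proof (cases "primitive_root_of_unity k u")
      case True
      then show ?thesis by (simp add: h_def of_int_poly_mult f)
    next
      case False
      then obtain m where m: "1 \<le> m" "m < k" "u ^ m = 1" using u k by (auto simp: primitive_root_of_unity_def)
      have "(\<Prod>m\<in>{1..<k}. ipoly (monom 1 m - 1) u) = 0"
        using m by (intro prod_zero) (auto simp: ipoly_simps intro!: bexI[of _ m])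
      then show ?thesis by (simp add: h_def of_int_poly_mult of_int_prod)
    qed
  qed
  then obtain c where "h = (monom 1 k - 1) * c" by blast
  then have "poly h (int g) = (int g ^ k - 1) * poly c (int g)" by (simp add: poly_monom)
  moreover have "int p dvd int g ^ k - 1" unfolding cong using ord[of g p] g by simp
  ultimately have "int p dvd poly h (int g)" by simp
  also have "poly h (int g) = poly f (int g) * (\<Prod>m\<in>{1..<k}. int g ^ m - 1)"
    by (simp add: h_def poly_prod poly_monom)
  finally have *: "int p dvd poly f (int g) * (\<Prod>m\<in>{1..<k}. int g ^ m - 1)" .
  have pi: "prime (int p)" using p by simp
  have "\<not> int p dvd (\<Prod>m\<in>{1..<k}. int g ^ m - 1)"
  proof
    assume "int p dvd (\<Prod>m\<in>{1..<k}. int g ^ m - 1)"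
    then obtain m where m: "m \<in> {1..<k}" "int p dvd int g ^ m - 1"
      using prime_dvd_prod_iff[of "{1..<k}" "int p" "\<lambda>m. int g ^ m - 1"] pi by auto
    then have "k dvd m" using cong ord_divides g by blast
    then show False using m(1) by (auto dest: dvd_imp_le)
  qed
  then show ?thesis using * pi prime_dvd_mult_iff by blast
qed

lemma exists_ord_eq:
  assumes p: "prime p" and k: "k dvd p - 1"
  obtains g where "ord p g = k"
proof -
  have p1: "p > 1" using prime_gt_1_nat[OF p] .
  have "k > 0" using k p1 by (auto intro: Nat.gr0I)
  then have "card {x\<in>totatives p. ord p x = k} > 0"
    using prime_card_elements_with_ord_eq_totient[OF p1 p] k by simp
  then have "{x\<in>totatives p. ord p x = k} \<noteq> {}" by (metis card.empty less_irrefl)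
  then show ?thesis using that by blast
qed

section \<open>Rounding in a lattice\<close>

text \<open>If the real coefficients \<open>t\<^sub>i\<close> are rounded to neighbouring integers, at random and
  independently with the right means, then the cross terms have mean zero and each term contributes at most
  a quarter of its square. Rounding the coefficients one after the other, each to the better side,
  achieves this bound.\<close>

lemma exists_rounding:
  fixes w :: "nat \<Rightarrow> 'b \<Rightarrow> real" and t :: "nat \<Rightarrow> real"
  assumes J: "finite J"
  shows "\<exists>c::nat \<Rightarrow> int. (\<Sum>j\<in>J. (\<Sum>i<m. (t i - c i) * w i j)\<^sup>2) \<le> (\<Sum>i<m. \<Sum>j\<in>J. (w i j)\<^sup>2) / 4"
proof (induct m)
  case 0
  then show ?case by simp
next
  case (Suc m)
  then obtain c :: "nat \<Rightarrow> int" where c: "(\<Sum>j\<in>J. (\<Sum>i<m. (t i - c i) * w i j)\<^sup>2) \<le> (\<Sum>i<m. \<Sum>j\<in>J. (w i j)\<^sup>2) / 4"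
    by blast
  define y where "y j = (\<Sum>i<m. (t i - c i) * w i j)" for j
  define s where "s = frac (t m)"
  define B where "B = (\<Sum>j\<in>J. y j * w m j)"
  define W where "W = (\<Sum>j\<in>J. (w m j)\<^sup>2)"
  have s: "0 \<le> s" "s \<le> 1" by (auto simp: s_def frac_lt_1 less_imp_le)
  have W: "W \<ge> 0" unfolding W_def by (rule sum_nonneg) simp
  have Q: "(\<Sum>j\<in>J. (y j + r * w m j)\<^sup>2) = (\<Sum>j\<in>J. (y j)\<^sup>2) + (2 * r * B + r\<^sup>2 * W)" for r
    by (simp add: power2_sum power_mult_distrib sum.distrib B_def W_def sum_distrib_left algebra_simps)
  have ex: "\<exists>e::int. 2 * (t m - e) * B + (t m - e)\<^sup>2 * W \<le> W / 4"
  proof (rule ccontr)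
    assume "\<nexists>e::int. 2 * (t m - e) * B + (t m - e)\<^sup>2 * W \<le> W / 4"
    then have n: "2 * (t m - e) * B + (t m - e)\<^sup>2 * W > W / 4" for e :: int by (simp add: not_le)
    have 1: "2 * s * B + s\<^sup>2 * W > W / 4" using n[of "\<lfloor>t m\<rfloor>"] by (simp add: s_def frac_def)
    have 2: "2 * (s - 1) * B + (s - 1)\<^sup>2 * W > W / 4" using n[of "\<lfloor>t m\<rfloor> + 1"]
      by (simp add: s_def frac_def algebra_simps)
    \<comment> \<open>The two candidates have remainders \<open>s\<close> and \<open>s - 1\<close>. With the weights \<open>1 -
      s\<close> and \<open>s\<close> the term linear in the remainder averages to zero.\<close>
    have "W / 4 = (1 - s) * (W / 4) + s * (W / 4)" by (simp add: algebra_simps)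
    also have "\<dots> < (1 - s) * (2 * s * B + s\<^sup>2 * W) + s * (2 * (s - 1) * B + (s - 1)\<^sup>2 * W)"
    proof (cases "s = 0")
      case True
      then show ?thesis using 1 by simp
    next
      case False
      then show ?thesis using s 1 2 by (intro add_le_less_mono mult_left_mono mult_strict_left_mono) auto
    qed
    finally have "(1 - s) * (2 * s * B + s\<^sup>2 * W) + s * (2 * (s - 1) * B + (s - 1)\<^sup>2 * W) > W / 4" .
    moreover have "(1 - s) * (2 * s * B + s\<^sup>2 * W) + s * (2 * (s - 1) * B + (s - 1)\<^sup>2 * W) = s * (1 - s) * W"
      by (simp add: algebra_simps power2_eq_square)
    moreover have "s * (1 - s) \<le> 1 / 4"
      using zero_le_power2[of "s - 1 / 2"] by (simp add: power2_eq_square algebra_simps)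
    then have "s * (1 - s) * W \<le> 1 / 4 * W" using W by (rule mult_right_mono)
    ultimately show False by simp
  qed
  then obtain e :: int where e: "2 * (t m - e) * B + (t m - e)\<^sup>2 * W \<le> W / 4" by blast
  have "(\<Sum>j\<in>J. (\<Sum>i<Suc m. (t i - (c(m := e)) i) * w i j)\<^sup>2) = (\<Sum>j\<in>J. (y j + (t m - e) * w m j)\<^sup>2)"
    by (intro sum.cong refl) (simp add: y_def)
  also have "\<dots> \<le> (\<Sum>j\<in>J. (y j)\<^sup>2) + W / 4" unfolding Q using e by simp
  also have "\<dots> \<le> (\<Sum>i<Suc m. \<Sum>j\<in>J. (w i j)\<^sup>2) / 4" using c by (simp add: y_def W_def)
  finally show ?case by blast
qed

section \<open>Functionals on the ring of integers of a cyclotomic field\<close>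

locale cyclotomic =
  fixes k :: nat and z :: complex and f :: "int poly"
  assumes prim: "primitive_root_of_unity k z"
    and monic: "lead_coeff f = 1"
    and degree_f: "degree f = totient k"
    and f_root: "\<And>u::complex. ipoly f u = 0 \<longleftrightarrow> primitive_root_of_unity k u"
    and f_dvd: "\<And>(u::complex) g. primitive_root_of_unity k u \<Longrightarrow> ipoly g u = 0 \<longleftrightarrow> f dvd g"
begin

definition F :: "real poly" where "F = map_poly of_int f"

text \<open>The additive maps from \<open>\<int>[z]\<close> to the reals, as functionals on real polynomials that vanish on
  the multiples of \<open>f\<close>. They form a space of dimension \<open>\<phi>(k)\<close>, with the values at
  \<open>1, X, \<dots>, X\<^sup>d\<^sup>-\<^sup>1\<close> as coordinates, and real polynomials act on it. The
  exponents of the Laurent polynomial \<open>F\<^sub>k\<close> are the coordinates of the powers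
  \<open>X\<^sup>j\<close>, so the value of the functional \<open>L\<close> at \<open>X\<^sup>j\<close> is the
  phase of the \<open>j\<close>-th monomial of \<open>F\<^sub>k\<close> at the point of the torus that
  \<open>L\<close> represents.\<close>

definition functional :: "(real poly \<Rightarrow> real) \<Rightarrow> bool" where
  "functional L \<longleftrightarrow> (\<forall>p q. L (p + q) = L p + L q) \<and> (\<forall>c p. L (smult c p) = c * L p) \<and> (\<forall>p. L (F * p) = 0)"

text \<open>A quadratic form that treats the monomials of \<open>F\<^sub>k\<close> alike. Hence it is invariant under
  multiplication by \<open>X\<close>, which permutes them cyclically; this is what makes one short vector produce
  a whole basis of short vectors.\<close>

definition energy :: "(real poly \<Rightarrow> real) \<Rightarrow> real" where
  "energy L = (\<Sum>j<k. (L (monom 1 j))\<^sup>2)"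

lemma k_pos: "k > 0" using primitive_root_pos[OF prim] .

lemma degree_F: "degree F = totient k" by (simp add: F_def degree_f)

lemma F_nonzero: "F \<noteq> 0" using degree_F k_pos by (metis degree_0 less_irrefl totient_gt_0_iff)

lemma functional_add: "functional L \<Longrightarrow> L (p + q) = L p + L q"
  and functional_smult: "functional L \<Longrightarrow> L (smult c p) = c * L p"
  and functional_F: "functional L \<Longrightarrow> L (F * p) = 0"
  by (auto simp: functional_def)

lemma functional_0: "functional L \<Longrightarrow> L 0 = 0"
  using functional_smult[of L 0 0] by simp

lemma functional_diff: "functional L \<Longrightarrow> L (p - q) = L p - L q"
  using functional_add[of L p "smult (-1) q"] functional_smult[of L "-1" q] by simp

lemma functional_sum: "functional L \<Longrightarrow> L (\<Sum>i\<in>I. p i) = (\<Sum>i\<in>I. L (p i))"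
  by (induct I rule: infinite_finite_induct) (simp_all add: functional_0 functional_add)

lemma functional_times: "functional L \<Longrightarrow> functional (\<lambda>p. L (h * p))"
  unfolding functional_def by (simp add: distrib_left mult.left_commute[of h F])

lemma functional_mod: "functional L \<Longrightarrow> L (p mod F) = L p"
  using functional_add[of L "F * (p div F)" "p mod F"] functional_F[of L] by simp

lemma functional_mult_expand:
  assumes L: "functional L" and n: "\<And>i. i \<ge> n \<Longrightarrow> coeff p i = 0"
  shows "L (p * h) = (\<Sum>i<n. coeff p i * L (monom 1 i * h))"
proof -
  have "p = (\<Sum>i<n. monom (coeff p i) i)"
    using n by (intro poly_eqI) (simp add: coeff_sum sum.delta' not_less)
  then have "L (p * h) = L (\<Sum>i<n. smult (coeff p i) (monom 1 i * h))"
    by (simp add: sum_distrib_right flip: mult_smult_left smult_monom) (metis (no_types, lifting) smult_monom mult.right_neutral sum.cong sum_distrib_right)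
  then show ?thesis by (simp add: functional_sum[OF L] functional_smult[OF L])
qed

lemma functional_expand:
  assumes L: "functional L"
  shows "L p = (\<Sum>i<totient k. coeff (p mod F) i * L (monom 1 i))"
proof -
  have "coeff (p mod F) i = 0" if "i \<ge> totient k" for i
    using that degree_mod_less[OF F_nonzero, of p] by (auto simp: degree_F coeff_eq_0)
  then show ?thesis
    using functional_mult_expand[OF L, of "totient k" "p mod F" 1] by (simp add: functional_mod[OF L])
qed

lemma functional_eqI:
  assumes "functional L" "functional M" "\<And>i. i < totient k \<Longrightarrow> L (monom 1 i) = M (monom 1 i)"
  shows "L p = M p"
  unfolding functional_expand[OF assms(1), of p] functional_expand[OF assms(2), of p] using assms(3) by simp

definition extend :: "(nat \<Rightarrow> real) \<Rightarrow> real poly \<Rightarrow> real" where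
  "extend x p = (\<Sum>i<totient k. coeff (p mod F) i * x i)"

lemma functional_extend: "functional (extend x)"
  by (simp add: functional_def extend_def poly_mod_add_left mod_smult_left distrib_right sum.distrib
      sum_distrib_left mult.assoc)

text \<open>As \<open>f\<close> is monic, its division with remainder stays within the integers.\<close>

lemma monom_mod_F_int: "\<exists>r. monom 1 j mod F = map_poly of_int r \<and> f dvd monom 1 j - r \<and> degree r < totient k"
proof -
  have deg: "degree f > 0" using degree_f k_pos by simp
  obtain s r where sr: "monom 1 j = f * s + r" "degree r < degree f" using int_poly_monic_div[OF monic deg, of "monom 1 j"] by blast
  have "monom 1 j = map_poly of_int (monom 1 j)" by (simp add: map_poly_monom)
  also have "\<dots> = F * map_poly of_int s + map_poly of_int r" by (simp only: sr(1) of_int_poly_add of_int_poly_mult F_def)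
  finally have "monom 1 j mod F = map_poly of_int r mod F" by simp
  also have "\<dots> = map_poly of_int r" using sr(2) by (intro mod_poly_less) (simp add: degree_F degree_f)
  finally have "monom 1 j mod F = map_poly of_int r" .
  moreover have "f dvd monom 1 j - r" by (simp add: sr(1))
  ultimately show ?thesis using sr(2) degree_f by auto
qed

lemma coeff_monom_mod_F_int: "coeff (monom 1 j mod F) i \<in> \<int>"
  using monom_mod_F_int[of j] by (auto simp: coeff_map_poly)

lemma functional_monom_int:
  assumes L: "functional L" and i: "\<And>i. i < totient k \<Longrightarrow> L (monom 1 i) \<in> \<int>"
  shows "L (monom 1 j) \<in> \<int>"
  unfolding functional_expand[OF L, of "monom 1 j"] using i coeff_monom_mod_F_int
  by (intro Ints_sum Ints_mult) auto

lemma F_dvd: "F dvd monom 1 k - 1"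
proof -
  have "ipoly (monom 1 k - 1) z = 0" using primitive_root_power[OF prim] by (simp add: ipoly_simps)
  then have "f dvd monom 1 k - 1" using f_dvd[OF prim] by blast
  then obtain c where "monom 1 k - 1 = f * c" by blast
  then have "map_poly of_int (monom 1 k - 1) = F * map_poly of_int c" by (simp add: of_int_poly_mult F_def)
  then show ?thesis by (simp add: of_int_poly_diff map_poly_monom)
qed

lemma functional_dvd:
  assumes "functional L" "F dvd p"
  shows "L p = 0"
  using assms functional_F by (auto elim!: dvdE)

lemma functional_periodic:
  assumes L: "functional L"
  shows "L (monom 1 (j + k) * p) = L (monom 1 j * p)"
proof -
  have "L ((monom 1 k - 1) * (monom 1 j * p)) = 0" by (rule functional_dvd[OF L]) (simp add: F_dvd)
  moreover have "(monom 1 k - 1) * (monom 1 j * p) = monom 1 (j + k) * p - monom 1 j * p"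
    by (simp add: left_diff_distrib mult_monom add.commute flip: mult.assoc)
  ultimately show ?thesis by (simp add: functional_diff[OF L])
qed

text \<open>Multipliers matter only modulo \<open>X\<^sup>k - 1\<close>, a multiple of \<open>f\<close>, so \<open>k\<close>
  shifts suffice.\<close>

lemma functional_times_poly:
  assumes L: "functional L"
  shows "\<exists>t. \<forall>h. L (p * h) = (\<Sum>i<k. t i * L (monom 1 i * h))"
proof -
  let ?G = "monom 1 k + [:-1:] :: real poly"
  have dG: "degree ?G = k" using k_pos by (subst degree_add_eq_left) (auto simp: degree_monom_eq)
  then have G0: "?G \<noteq> 0" using k_pos by (metis degree_0 less_irrefl)
  define r where "r = p mod ?G"
  have "L (p * h) = L (r * h)" for h
  proof -
    have "p * h = ?G * ((p div ?G) * h) + r * h"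
      unfolding r_def by (metis distrib_right mult.assoc mult_div_mod_eq)
    moreover have "?G = monom 1 k - 1" by (simp add: one_pCons)
    then have "L (?G * ((p div ?G) * h)) = 0"
      using F_dvd by (intro functional_dvd[OF L] dvd_mult2) simp
    ultimately show ?thesis by (simp add: functional_add[OF L])
  qed
  moreover have "coeff r i = 0" if "i \<ge> k" for i
    using that degree_mod_less[OF G0, of p] dG by (auto simp: r_def coeff_eq_0)
  ultimately have "L (p * h) = (\<Sum>i<k. coeff r i * L (monom 1 i * h))" for h
    using functional_mult_expand[OF L, of k r h] by simp
  then show ?thesis by blast
qed

lemma energy_shift:
  assumes L: "functional L"
  shows "energy (\<lambda>p. L (monom 1 i * p)) = energy L"
proof (induct i)
  case 0
  then show ?case by (simp flip: one_pCons monom_0)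
next
  case (Suc i)
  have M: "functional (\<lambda>p. L (monom 1 i * p))" by (rule functional_times[OF L])
  let ?g = "\<lambda>j. (L (monom 1 i * monom 1 j))\<^sup>2"
  have "energy (\<lambda>p. L (monom 1 (Suc i) * p)) = (\<Sum>j<k. ?g (Suc j))"
    by (simp add: energy_def mult_monom)
  also have "\<dots> = (\<Sum>j<Suc k. ?g j) - ?g 0" by (simp add: sum.lessThan_Suc_shift del: sum.lessThan_Suc)
  also have "\<dots> = (\<Sum>j<k. ?g j) + ?g k - ?g 0" by simp
  also have "?g k = ?g 0"
    using functional_periodic[OF M, of 0 1] by (simp flip: one_pCons monom_0)
  finally show ?case using Suc by (simp add: energy_def)
qed

text \<open>The coefficient of \<open>X\<^sup>d\<^sup>-\<^sup>1\<close>, with \<open>d = \<phi>(k)\<close>, generates all functionals, with integrality preserved: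
  its values on \<open>1, X, \<dots>, X\<^sup>d\<^sup>-\<^sup>1\<close> are \<open>0, \<dots>, 0, 1\<close>, so a multiplier is found by solving a
  triangular system.\<close>

definition top_coeff :: "real poly \<Rightarrow> real" where
  "top_coeff p = coeff (p mod F) (totient k - 1)"

lemma functional_top_coeff: "functional top_coeff"
  by (simp add: functional_def top_coeff_def poly_mod_add_left mod_smult_left)

lemma top_coeff_monom: "i < totient k \<Longrightarrow> top_coeff (monom 1 i) = (if Suc i = totient k then 1 else 0)"
proof -
  assume i: "i < totient k"
  then have "monom 1 i mod F = monom 1 i" by (intro mod_poly_less) (simp add: degree_F degree_monom_eq)
  then show ?thesis using i by (auto simp: top_coeff_def)
qed

lemma functional_eq_times_top_coeff:
  assumes L: "functional L" and S: "\<And>i. i < totient k \<Longrightarrow> L (monom 1 i) \<in> S"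
    and closed: "\<int> \<subseteq> S" "\<And>x y. x \<in> S \<Longrightarrow> y \<in> S \<Longrightarrow> x + y \<in> S" "\<And>x y. x \<in> S \<Longrightarrow> y \<in> S \<Longrightarrow> x - y \<in> S"
      "\<And>x y. x \<in> S \<Longrightarrow> y \<in> S \<Longrightarrow> x * y \<in> S"
  obtains q where "\<And>i. coeff q i \<in> S" "\<And>p. L p = top_coeff (q * p)"
proof -
  note fn = functional_top_coeff
  have zero: "0 \<in> S" using closed(1) by (metis Ints_0 subsetD)
  have sums: "(\<Sum>i\<in>I. g i) \<in> S" if "\<And>i. i \<in> I \<Longrightarrow> g i \<in> S" for g :: "nat \<Rightarrow> real" and I
    using that by (induct I rule: infinite_finite_induct) (auto simp: zero closed(2))
  have val: "top_coeff (q * monom 1 n) \<in> S" if q: "\<And>i. coeff q i \<in> S" for q n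
  proof -
    have "top_coeff (q * monom 1 n) = (\<Sum>i<Suc (degree q). coeff q i * top_coeff (monom 1 (i + n)))"
      by (subst functional_mult_expand[OF fn, of "Suc (degree q)"]) (auto simp: coeff_eq_0 mult_monom)
    also have "\<dots> \<in> S"
    proof (rule sums)
      fix i
      have "top_coeff (monom 1 (i + n)) \<in> \<int>" unfolding top_coeff_def by (rule coeff_monom_mod_F_int)
      then show "coeff q i * top_coeff (monom 1 (i + n)) \<in> S" using q closed(1,4) by blast
    qed
    finally show ?thesis .
  qed
  have "\<exists>q. (\<forall>i. coeff q i \<in> S) \<and> (\<forall>n<m. L (monom 1 n) = top_coeff (q * monom 1 n))" if "m \<le> totient k" for m
    using that
  proof (induct m)
    case 0
    have "\<forall>i. coeff (0::real poly) i \<in> S" using zero by simp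
    then show ?case by blast
  next
    case (Suc m)
    then obtain q where q: "\<And>i. coeff q i \<in> S" "\<And>n. n < m \<Longrightarrow> L (monom 1 n) = top_coeff (q * monom 1 n)"
      by (meson Suc_leD)
    define c where "c = L (monom 1 m) - top_coeff (q * monom 1 m)"
    \<comment> \<open>The summand \<open>c X\<^sup>e\<close> corrects the value at \<open>X\<^sup>m\<close> and leaves the values at
      lower powers unchanged.\<close>
    define e where "e = totient k - 1 - m"
    have cS: "c \<in> S" unfolding c_def using S Suc(2) val[OF q(1)] closed(3) by simp
    have "coeff (q + monom c e) i \<in> S" for i using q(1) cS zero closed(2) by simp
    moreover have "L (monom 1 n) = top_coeff ((q + monom c e) * monom 1 n)" if n: "n < Suc m" for n
    proof -
      have "(q + monom c e) * monom 1 n = q * monom 1 n + smult c (monom 1 (e + n))"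
        by (simp add: distrib_right mult_monom smult_monom)
      then have "top_coeff ((q + monom c e) * monom 1 n) = top_coeff (q * monom 1 n) + c * top_coeff (monom 1 (e + n))"
        by (simp add: functional_add[OF fn] functional_smult[OF fn])
      also have "top_coeff (monom 1 (e + n)) = (if n = m then 1 else 0)"
        using n Suc(2) by (subst top_coeff_monom) (auto simp: e_def)
      finally show ?thesis using q(2)[of n] n by (auto simp: c_def)
    qed
    ultimately show ?case by blast
  qed
  from this[of "totient k"] obtain q where q: "\<And>i. coeff q i \<in> S"
    "\<And>n. n < totient k \<Longrightarrow> L (monom 1 n) = top_coeff (q * monom 1 n)" by blast
  have "L p = top_coeff (q * p)" for p
    by (rule functional_eqI[OF L functional_times[OF fn]]) (simp add: q(2))
  then show ?thesis using that q(1) by blast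
qed

end

section \<open>Geometry of numbers for cyclotomic lattices\<close>

context cyclotomic
begin

lemma functional_lincomb:
  "functional L \<Longrightarrow> functional M \<Longrightarrow> functional (\<lambda>p. a * L p + b * M p)"
  by (simp add: functional_def algebra_simps)

lemma functional_scale: "functional L \<Longrightarrow> functional (\<lambda>p. a * L p)"
  by (simp add: functional_def algebra_simps)

lemma functional_setsum:
  "(\<And>i. i \<in> I \<Longrightarrow> functional (L i)) \<Longrightarrow> functional (\<lambda>p. \<Sum>i\<in>I. L i p)"
  by (simp add: functional_def sum.distrib sum_distrib_left)

lemma sqrt_energy_lincomb:
  "sqrt (energy (\<lambda>p. a * L p + b * M p)) \<le> \<bar>a\<bar> * sqrt (energy L) + \<bar>b\<bar> * sqrt (energy M)"
proof -
  have e: "sqrt (energy G) = L2_set (\<lambda>j. G (monom 1 j)) {..<k}" for G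
    by (simp add: energy_def L2_set_def)
  have s: "L2_set (\<lambda>j. c * G (monom 1 j)) {..<k} = \<bar>c\<bar> * L2_set (\<lambda>j. G (monom 1 j)) {..<k}" for c G
    by (simp add: L2_set_def power_mult_distrib real_sqrt_mult flip: sum_distrib_left)
  show ?thesis unfolding e
    using L2_set_triangle_ineq[of "\<lambda>j. a * L (monom 1 j)" "\<lambda>j. b * M (monom 1 j)" "{..<k}"] by (simp add: s)
qed

lemma of_real_map_F: "map_poly of_real F = (map_poly of_int f :: complex poly)"
  by (simp add: F_def map_poly_map_poly o_def)

text \<open>An integer polynomial prime to \<open>f\<close> is invertible modulo \<open>f\<close> even over the reals: all complex
  roots of \<open>f\<close> have \<open>f\<close> as their minimal polynomial.\<close>

lemma bezout_real:
  assumes "\<not> f dvd q"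
  obtains u v where "u * map_poly of_int q + v * F = 1"
proof (rule bezout_no_common_root[of complex_of_real F "map_poly of_int q", OF _ _ _ _ F_nonzero])
  fix w
  assume "poly (map_poly complex_of_real (map_poly of_int q)) w = 0"
  then have "ipoly q w = 0" by (simp add: map_poly_map_poly o_def)
  then have "\<not> primitive_root_of_unity k w" using assms f_dvd by blast
  then show "poly (map_poly complex_of_real F) w \<noteq> 0" by (simp add: of_real_map_F f_root)
qed (simp_all add: that)

text \<open>A nonzero functional \<open>lam\<close>, integral up to a common factor, has multiples \<open>X\<^sup>i lam\<close> that span all functionals, as a
  number field has no zero divisors, and they all have the same energy. So rounding the
  coefficients bounds the covering radius of the lattice generated by them.\<close>

lemma exists_close_combination:
  fixes N :: real and lam L :: "real poly \<Rightarrow> real"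
  assumes lam: "functional lam" and N: "\<And>i. N * lam (monom 1 i) \<in> \<int>" and N0: "N \<noteq> 0"
    and nz: "lam (monom 1 i0) \<noteq> 0" and L: "functional L"
  obtains c :: "nat \<Rightarrow> int" where
    "energy (\<lambda>p. L p - (\<Sum>i<k. c i * lam (monom 1 i * p))) \<le> k / 4 * energy lam"
proof -
  note fn = functional_top_coeff
  \<comment> \<open>If \<open>L = r * top_coeff\<close> and \<open>N lam = q * top_coeff\<close>, then \<open>L = N r
    q\<^sup>-\<^sup>1 * lam\<close>.\<close>
  obtain r where r: "\<And>p. L p = top_coeff (r * p)"
    using functional_eq_times_top_coeff[OF L, of UNIV] by auto
  obtain q where qi: "\<And>i. coeff q i \<in> \<int>" and q: "\<And>p. N * lam p = top_coeff (q * p)"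
    using functional_eq_times_top_coeff[OF functional_scale[OF lam, of N], of \<int>] N
    by (auto intro: Ints_add Ints_diff Ints_mult)
  define q' where "q' = map_poly floor q"
  have qq: "q = map_poly of_int q'"
    using qi by (intro poly_eqI) (auto simp: q'_def coeff_map_poly elim: Ints_cases)
  have "\<not> f dvd q'"
  proof
    assume "f dvd q'"
    then have "F dvd q * monom 1 i0" by (auto simp: qq of_int_poly_mult F_def)
    then have "top_coeff (q * monom 1 i0) = 0" by (rule functional_dvd[OF fn])
    then show False using q[of "monom 1 i0"] N0 nz by simp
  qed
  then obtain u v where uv: "u * q + v * F = 1" using bezout_real qq by metis
  have "L p = lam (smult N (u * r) * p)" for p
  proof -
    have "r * p = (u * q + v * F) * (r * p)" by (simp add: uv)
    also have "\<dots> = q * (u * r * p) + F * (v * r * p)" by (simp add: algebra_simps)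
    finally have "L p = top_coeff (q * (u * r * p))"
      using r functional_add[OF fn] functional_F[OF fn] by simp
    also have "\<dots> = N * lam (u * r * p)" by (simp add: q)
    finally show ?thesis by (simp add: functional_smult[OF lam])
  qed
  moreover obtain t where "\<forall>h. lam (smult N (u * r) * h) = (\<Sum>i<k. t i * lam (monom 1 i * h))"
    using functional_times_poly[OF lam] by blast
  ultimately have t: "L h = (\<Sum>i<k. t i * lam (monom 1 i * h))" for h by simp
  obtain c :: "nat \<Rightarrow> int" where c: "(\<Sum>j<k. (\<Sum>i<k. (t i - c i) * lam (monom 1 i * monom 1 j))\<^sup>2)
      \<le> (\<Sum>i<k. \<Sum>j<k. (lam (monom 1 i * monom 1 j))\<^sup>2) / 4"
    using exists_rounding[where J = "{..<k}" and m = k and t = t and w = "\<lambda>i j. lam (monom 1 i * monom 1 j)"] by auto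
  have "energy (\<lambda>p. L p - (\<Sum>i<k. c i * lam (monom 1 i * p)))
      = (\<Sum>j<k. (\<Sum>i<k. (t i - c i) * lam (monom 1 i * monom 1 j))\<^sup>2)"
    by (simp add: energy_def t left_diff_distrib sum_subtractf)
  also note c
  also have "(\<Sum>i<k. \<Sum>j<k. (lam (monom 1 i * monom 1 j))\<^sup>2) = k * energy lam"
    using energy_shift[OF lam] by (simp add: energy_def)
  finally show ?thesis using that by simp
qed

text \<open>A short vector in the lattice of integral functionals sends \<open>X\<^sup>j\<close> to the coefficient of
  \<open>X\<^sup>0\<close> in \<open>X\<^sup>j \<Prod>\<^sub>q (X\<^bsup>k/q\<^esup> - 1)\<close> modulo \<open>X\<^sup>k - 1\<close>, the product being over the primes \<open>q\<close> dividing \<open>k\<close>.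
  As the product vanishes at all \<open>k\<close>-th roots of unity that are not primitive, this functional kills the multiples of \<open>f\<close>.
  No coefficients other than \<open>0\<close> and \<open>\<plusminus>1\<close> occur, because by the Chinese remainder theorem the terms of the expansion
  belong to different residue classes modulo \<open>k\<close>.\<close>

lemma trace_coefficients:
  assumes "finite P" "P \<subseteq> prime_factors k"
  shows "\<exists>y :: nat \<Rightarrow> int.
    (\<forall>j. (\<Sum>u | u ^ k = 1. (\<Prod>q\<in>P. u ^ (k div q) - 1) * u ^ j) = of_nat k * (of_int (y j) :: complex)) \<and>
    (\<forall>j. \<bar>y j\<bar> \<le> 1) \<and> (\<exists>j. y j \<noteq> 0) \<and>
    (\<forall>j q. y j \<noteq> 0 \<longrightarrow> q \<in> prime_factors k - P \<longrightarrow> q ^ multiplicity q k dvd j)"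
  using assms
proof (induct P rule: finite_induct)
  case empty
  have mult: "q ^ multiplicity q k dvd k" for q :: nat by (rule multiplicity_dvd)
  show ?case
    by (intro exI[of _ "\<lambda>j. if k dvd j then 1 else 0"] conjI)
      (auto simp: primitive_root_sum_powers[OF prim] intro: dvd_trans[OF mult] exI[of _ 0])
next
  case (insert q P)
  then have "P \<subseteq> prime_factors k" by simp
  from insert(3)[OF this] obtain y :: "nat \<Rightarrow> int" where
    "\<forall>j. (\<Sum>u | u ^ k = 1. (\<Prod>q\<in>P. u ^ (k div q) - 1) * u ^ j) = of_nat k * (of_int (y j) :: complex)"
    "\<forall>j. \<bar>y j\<bar> \<le> 1" and yn: "\<exists>j. y j \<noteq> 0" and
    "\<forall>j q. y j \<noteq> 0 \<longrightarrow> q \<in> prime_factors k - P \<longrightarrow> q ^ multiplicity q k dvd j"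
    by blast
  then have
    y: "\<And>j. (\<Sum>u | u ^ k = 1. (\<Prod>q\<in>P. u ^ (k div q) - 1) * u ^ j) = of_nat k * (of_int (y j) :: complex)"
    and y1: "\<And>j. \<bar>y j\<bar> \<le> 1"
    and yd: "\<And>j q. y j \<noteq> 0 \<Longrightarrow> q \<in> prime_factors k - P \<Longrightarrow> q ^ multiplicity q k dvd j"
    by blast+
  have q: "q \<in> prime_factors k" "q \<notin> P" using insert by auto
  then have qp: "prime q" and qk: "q dvd k" by auto
  define y' where "y' j = y (j + k div q) - y j" for j
  \<comment> \<open>No power of \<open>q\<close> as high as in \<open>k\<close> divides \<open>k/q\<close>, so the two terms of the
    new factor never overlap.\<close>
  have not_both: "y j = 0 \<or> y (j + k div q) = 0" for j
  proof (rule ccontr)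
    assume "\<not> ?thesis"
    then have d: "q ^ multiplicity q k dvd j" "q ^ multiplicity q k dvd j + k div q"
      using yd q by auto
    then have "q ^ multiplicity q k dvd k div q" by (simp add: dvd_add_right_iff)
    then have "q ^ multiplicity q k * q dvd k" using qk prime_gt_0_nat[OF qp]
      by (metis dvd_div_iff_mult not_less_zero)
    then have "q ^ Suc (multiplicity q k) dvd k" by (simp add: mult.commute)
    moreover have "\<not> q ^ Suc (multiplicity q k) dvd k"
      using k_pos qp power_dvd_iff_le_multiplicity[of k q "Suc (multiplicity q k)"] not_prime_unit by auto
    ultimately show False by simp
  qed
  have "(\<Sum>u | u ^ k = 1. (\<Prod>r\<in>insert q P. u ^ (k div r) - 1) * u ^ j) = of_nat k * (of_int (y' j) :: complex)" for j
  proof -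
    have step: "(\<Sum>u | u ^ k = 1. (\<Prod>r\<in>insert q P. u ^ (k div r) - 1) * (u::complex) ^ j)
        = (\<Sum>u | u ^ k = 1. (\<Prod>r\<in>P. u ^ (k div r) - 1) * u ^ (j + k div q))
          - (\<Sum>u | u ^ k = 1. (\<Prod>r\<in>P. u ^ (k div r) - 1) * u ^ j)"
      unfolding sum_subtractf[symmetric] using insert(1,2)
      by (intro sum.cong refl) (simp add: power_add algebra_simps)
    show ?thesis unfolding step y by (simp add: y'_def right_diff_distrib)
  qed
  moreover have "\<bar>y' j\<bar> \<le> 1" for j
    using not_both[of j] y1[of j] y1[of "j + k div q"] by (auto simp: y'_def)
  moreover have "\<exists>j. y' j \<noteq> 0"
  proof -
    obtain j where "y j \<noteq> 0" using yn by blast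
    then have "y' j \<noteq> 0" using not_both[of j] by (auto simp: y'_def)
    then show ?thesis by blast
  qed
  moreover have "r ^ multiplicity r k dvd j" if "y' j \<noteq> 0" "r \<in> prime_factors k - insert q P" for j r
  proof (cases "y j = 0")
    case False
    then show ?thesis using yd that by blast
  next
    case True
    then have "r ^ multiplicity r k dvd j + k div q" using yd that by (auto simp: y'_def)
    moreover have "r ^ multiplicity r k dvd k div q"
    proof -
      have "coprime (r ^ multiplicity r k) q"
        using that qp by (intro coprime_power_left_iff[THEN iffD2] disjI1 primes_coprime) auto
      moreover have "r ^ multiplicity r k dvd q * (k div q)" using qk by (simp add: multiplicity_dvd)
      ultimately show ?thesis by (simp add: coprime_dvd_mult_right_iff)
    qed
    ultimately show ?thesis by (simp add: dvd_add_left_iff)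
  qed
  ultimately show ?case by blast
qed

lemma exists_short_integral_functional:
  obtains lam where "functional lam" "\<And>j. lam (monom 1 j) \<in> \<int>" "\<exists>j. lam (monom 1 j) \<noteq> 0" "energy lam \<le> k"
proof -
  let ?P = "prime_factors k"
  obtain y :: "nat \<Rightarrow> int" where
    y: "\<And>j. (\<Sum>u | u ^ k = 1. (\<Prod>q\<in>?P. u ^ (k div q) - 1) * u ^ j) = of_nat k * (of_int (y j) :: complex)"
    and y1: "\<And>j. \<bar>y j\<bar> \<le> 1" and yn: "\<exists>j. y j \<noteq> 0"
    using trace_coefficients[of ?P] by auto
  define lam where "lam p = Re ((\<Sum>u | u ^ k = 1. (\<Prod>q\<in>?P. u ^ (k div q) - 1) * poly (map_poly of_real p) u)) / k" for p
  have mono: "lam (monom 1 j) = y j" for j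
  proof -
    have "lam (monom 1 j) = Re (of_nat k * of_int (y j)) / k"
      by (simp add: lam_def map_poly_monom poly_monom y)
    then show ?thesis using k_pos by simp
  qed
  have add: "map_poly complex_of_real (p + q) = map_poly of_real p + map_poly of_real q" for p q
    by (rule map_poly_hom_add) simp_all
  have mult: "map_poly complex_of_real (p * q) = map_poly of_real p * map_poly of_real q" for p q
    by (rule map_poly_hom_mult) simp_all
  have "functional lam"
    unfolding functional_def
  proof (intro conjI allI)
    show "lam (p + q) = lam p + lam q" for p q
      by (simp add: lam_def add distrib_left sum.distrib add_divide_distrib)
    show "lam (smult c p) = c * lam p" for c p
    proof -
      have "poly (map_poly complex_of_real (smult c p)) u = of_real c * poly (map_poly of_real p) u" for u
        by (simp add: map_poly_smult)
      then have "lam (smult c p) = Re (of_real c * (\<Sum>u | u ^ k = 1. (\<Prod>q\<in>?P. u ^ (k div q) - 1) * poly (map_poly of_real p) u)) / k"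
        by (simp add: lam_def sum_distrib_left mult.left_commute)
      then show ?thesis by (simp add: lam_def)
    qed
    show "lam (F * p) = 0" for p
    proof -
      have "(\<Prod>q\<in>?P. u ^ (k div q) - 1) * poly (map_poly of_real (F * p)) u = 0" if u: "u ^ k = 1" for u :: complex
      proof (cases "primitive_root_of_unity k u")
        case True
        then have "poly (map_poly of_real (F * p)) u = 0" by (simp add: mult of_real_map_F f_root)
        then show ?thesis by simp
      next
        case False
        obtain i where i: "u = z ^ i" using primitive_root_obtain_power[OF prim u] by blast
        then have "\<not> coprime i k" using False primitive_root_power_primitive_iff[OF prim] by simp
        then have "gcd i k \<noteq> 1" by (metis coprime_iff_gcd_eq_1)
        then obtain q where "prime q" "q dvd gcd i k" using prime_factor_nat by blast
        then have q: "prime q" "q dvd i" "q dvd k" by simp_all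
        then have "k dvd i * (k div q)"
          by (metis dvd_div_mult dvd_mult_div_cancel dvd_triv_right mult.commute mult_dvd_mono dvd_refl)
        then have "u ^ (k div q) - 1 = 0"
          by (simp add: i primitive_root_power_eq_1_iff[OF prim] flip: power_mult)
        moreover have "q \<in> ?P" using q k_pos by (simp add: prime_factors_dvd)
        ultimately have "(\<Prod>q\<in>?P. u ^ (k div q) - 1) = 0" by (intro prod_zero) auto
        then show ?thesis by simp
      qed
      then have "(\<Sum>u | u ^ k = 1. (\<Prod>q\<in>?P. u ^ (k div q) - 1) * poly (map_poly of_real (F * p)) u) = (0::complex)"
        by (intro sum.neutral) blast
      then show ?thesis unfolding lam_def by (simp only:) simp
    qed
  qed
  moreover have "energy lam \<le> k"
  proof -
    have "(real_of_int (y j))\<^sup>2 \<le> 1" for j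
      using y1[of j] by (simp add: abs_square_le_1)
    then have "energy lam \<le> (\<Sum>j<k. 1)" unfolding energy_def mono by (intro sum_mono) auto
    then show ?thesis by simp
  qed
  ultimately show ?thesis using that[of lam] mono yn by auto
qed

text \<open>The coordinates of the multiples of the vector \<open>(1, g, g\<^sup>2, \<dots>)/p\<close>. For \<open>g\<close>
  of order \<open>k\<close> modulo \<open>p\<close> the conjugates of the Gaussian period are the values of
  \<open>F\<^sub>k\<close> at the nonzero ones of these points.\<close>

definition line_point :: "nat \<Rightarrow> nat \<Rightarrow> int \<Rightarrow> nat \<Rightarrow> real" where
  "line_point p g c i = c * real g ^ i / p"

text \<open>Modulo \<open>p\<close> the number \<open>g\<close> is a root of \<open>f\<close>, so reducing
  \<open>X\<^sup>j\<close> modulo \<open>f\<close> does not change its value at \<open>g\<close>.\<close>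

lemma extend_line_point:
  assumes p: "p > 0" and g: "int p dvd poly f (int g)"
  shows "extend (line_point p g c) (monom 1 j) - line_point p g c j \<in> \<int>"
proof -
  obtain r where r: "monom 1 j mod F = map_poly of_int r" "f dvd monom 1 j - r" "degree r < totient k"
    using monom_mod_F_int by blast
  have "poly r (int g) = (\<Sum>i<totient k. coeff r i * int g ^ i)"
    unfolding poly_altdef using r(3) by (intro sum.mono_neutral_left) (auto simp: coeff_eq_0)
  then have "extend (line_point p g c) (monom 1 j) = c / p * poly r (int g)"
    by (simp add: extend_def r(1) coeff_map_poly line_point_def sum_distrib_left mult_ac)
  moreover have "int p dvd int g ^ j - poly r (int g)"
    using r(2) g by (auto simp: poly_monom elim!: dvdE dest!: arg_cong[of _ _ "\<lambda>p. poly p (int g)"])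
  then obtain b where b: "int g ^ j - poly r (int g) = int p * b" by blast
  have "real g ^ j = real_of_int (poly r (int g)) + real p * b"
    using arg_cong[OF b, of real_of_int] by simp
  ultimately have "extend (line_point p g c) (monom 1 j) - line_point p g c j = real_of_int (- c * b)"
    using p by (simp add: line_point_def field_simps)
  then show ?thesis by (metis Ints_of_int)
qed

text \<open>The \<open>p\<close> points of the line are distributed among the \<open>s\<^sup>d\<close> classes modulo \<open>s\<close> of nearby integral
  functionals, after magnification by \<open>s\<close>. Two points in one class differ by a short vector.\<close>

lemma exists_short_functional_mod_prime:
  fixes p s :: nat
  assumes p: "p > 0" and g: "int p dvd poly f (int g)" and s: "s > 0" "s ^ totient k < p"
  obtains lam c where "functional lam" "\<And>j. lam (monom 1 j) - line_point p g c j \<in> \<int>"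
    "lam (monom 1 0) \<noteq> 0" "sqrt (energy lam) \<le> k / s"
proof -
  obtain lam0 where lam0: "functional lam0" "\<And>j. lam0 (monom 1 j) \<in> \<int>" "\<exists>j. lam0 (monom 1 j) \<noteq> 0" "energy lam0 \<le> k"
    using exists_short_integral_functional by blast
  obtain i0 where i0: "lam0 (monom 1 i0) \<noteq> 0" using lam0(3) by blast
  define L where "L c = extend (line_point p g c)" for c
  have Lf: "functional (L c)" for c by (simp add: L_def functional_extend)
  have "\<exists>e::nat \<Rightarrow> int. energy (\<lambda>q. real s * L c q - (\<Sum>i<k. e i * lam0 (monom 1 i * q))) \<le> k / 4 * energy lam0" for c
  proof -
    have "1 * lam0 (monom 1 i) \<in> \<int>" for i using lam0(2) by simp
    note combination = exists_close_combination[OF lam0(1) this one_neq_zero i0 functional_scale[OF Lf[of c], of "real s"]]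
    obtain e :: "nat \<Rightarrow> int" where
      "energy (\<lambda>q. real s * L c q - (\<Sum>i<k. e i * lam0 (monom 1 i * q))) \<le> k / 4 * energy lam0"
      by (rule combination)
    then show ?thesis by (intro exI[of _ e])
  qed
  then have "\<forall>c. \<exists>e::nat \<Rightarrow> int. energy (\<lambda>q. real s * L c q - (\<Sum>i<k. e i * lam0 (monom 1 i * q))) \<le> k / 4 * energy lam0"
    by blast
  from choice[OF this] obtain e :: "int \<Rightarrow> nat \<Rightarrow> int" where
    e: "\<And>c. energy (\<lambda>q. real s * L c q - (\<Sum>i<k. e c i * lam0 (monom 1 i * q))) \<le> k / 4 * energy lam0"
    by blast
  define M where "M c q = (\<Sum>i<k. e c i * lam0 (monom 1 i * q))" for c q
  have Mf: "functional (M c)" for c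
    unfolding M_def by (intro functional_setsum functional_scale functional_times lam0)
  have MZ: "M c (monom 1 j) \<in> \<int>" for c j
    unfolding M_def by (intro Ints_sum Ints_mult) (auto simp: mult_monom lam0(2))
  have eb: "sqrt (energy (\<lambda>q. s * L c q + (-1) * M c q)) \<le> k / 2" for c
  proof -
    have "energy (\<lambda>q. s * L c q + (-1) * M c q) \<le> k / 4 * energy lam0" using e[of c] by (simp add: M_def)
    also have "\<dots> \<le> k / 4 * k" using lam0(4) by (intro mult_left_mono) auto
    also have "\<dots> = (k / 2)\<^sup>2" by (simp add: power2_eq_square)
    finally have "sqrt (energy (\<lambda>q. s * L c q + (-1) * M c q)) \<le> sqrt ((k / 2)\<^sup>2)" by (rule real_sqrt_le_mono)
    also have "\<dots> = k / 2" by (rule real_sqrt_unique) simp_all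
    finally show ?thesis .
  qed
  define h where "h c = (\<lambda>i\<in>{..<totient k}. \<lfloor>M (int c) (monom 1 i)\<rfloor> mod int s)" for c :: nat
  have "\<not> inj_on h {..<p}"
  proof (rule pigeonhole)
    have "h ` {..<p} \<subseteq> PiE {..<totient k} (\<lambda>_. {0..<int s})"
      unfolding h_def using s by (intro image_subsetI restrict_PiE_iff[THEN iffD2]) auto
    then have "card (h ` {..<p}) \<le> card (PiE {..<totient k} (\<lambda>_. {0..<int s}))"
      by (intro card_mono finite_PiE) auto
    also have "\<dots> = s ^ totient k" by (simp add: card_PiE)
    finally show "card (h ` {..<p}) < card {..<p}" using s by simp
  qed
  then obtain a b where ab: "a < p" "b < p" "a \<noteq> b" "h a = h b" by (auto simp: inj_on_def)
  define D where "D q = (1 / s) * M (int a) q + (- 1 / s) * M (int b) q" for q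
  have Df: "functional D" unfolding D_def by (intro functional_lincomb Mf)
  have DZ: "D (monom 1 j) \<in> \<int>" for j
  proof (rule functional_monom_int[OF Df])
    fix i assume i: "i < totient k"
    obtain x where x: "M (int a) (monom 1 i) = of_int x" using MZ[of "int a" i] by (elim Ints_cases)
    obtain y where y: "M (int b) (monom 1 i) = of_int y" using MZ[of "int b" i] by (elim Ints_cases)
    have "x mod int s = y mod int s" using fun_cong[OF ab(4), of i] i by (simp add: h_def x y)
    then have "int s dvd x - y" by (simp add: mod_eq_dvd_iff)
    then obtain w where "x - y = int s * w" by blast
    then have "real_of_int (x - y) = real_of_int (int s * w)" by simp
    then have "real_of_int x - of_int y = real s * of_int w" by simp
    moreover have "D (monom 1 i) = (real_of_int x - of_int y) / s"
      unfolding D_def x y by (simp add: diff_divide_distrib)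
    ultimately have "D (monom 1 i) = of_int w" using s by simp
    then show "D (monom 1 i) \<in> \<int>" by simp
  qed
  define G where "G c q = s * L c q + (-1) * M c q" for c q
  define lam where "lam q = (1 / s) * G (int a) q + (- 1 / s) * G (int b) q" for q
  have lam_eq: "lam q = L (int a) q - L (int b) q - D q" for q
    using s by (simp add: lam_def G_def D_def field_simps)
  define c where "c = int a - int b"
  have lf: "functional lam" unfolding lam_def G_def by (intro functional_lincomb Mf Lf)
  moreover have lc: "lam (monom 1 j) - line_point p g c j \<in> \<int>" for j
  proof -
    have "lam (monom 1 j) - line_point p g c j
        = (L (int a) (monom 1 j) - line_point p g (int a) j) - (L (int b) (monom 1 j) - line_point p g (int b) j) - D (monom 1 j)"
      by (simp add: lam_eq c_def line_point_def diff_divide_distrib left_diff_distrib)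
    also have "\<dots> \<in> \<int>" unfolding L_def by (intro Ints_diff extend_line_point[OF p g] DZ)
    finally show ?thesis .
  qed
  moreover have "lam (monom 1 0) \<noteq> 0"
  proof
    assume "lam (monom 1 0) = 0"
    then have "- line_point p g c 0 \<in> \<int>" using lc[of 0] by simp
    then have "line_point p g c 0 \<in> \<int>" by (simp only: minus_in_Ints_iff)
    then obtain w where w: "line_point p g c 0 = of_int w" by (elim Ints_cases)
    then have "real_of_int c = of_int w * real p" using p by (simp add: line_point_def divide_eq_eq)
    then have "real_of_int c = of_int (w * int p)" by simp
    then have "c = w * int p" by (simp only: of_int_eq_iff)
    moreover have "\<bar>c\<bar> < int p" "c \<noteq> 0" using ab by (auto simp: c_def)
    ultimately show False using dvd_imp_le_int[of c "int p"] by auto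
  qed
  moreover have "sqrt (energy lam) \<le> k / s"
  proof -
    have "sqrt (energy lam) \<le> \<bar>1 / real s\<bar> * sqrt (energy (G (int a))) + \<bar>- 1 / real s\<bar> * sqrt (energy (G (int b)))"
      unfolding lam_def by (rule sqrt_energy_lincomb)
    also have "\<dots> \<le> \<bar>1 / real s\<bar> * (k / 2) + \<bar>- 1 / real s\<bar> * (k / 2)"
      unfolding G_def by (intro add_mono mult_left_mono eb) auto
    finally show ?thesis using s by (simp add: field_simps)
  qed
  ultimately show ?thesis using that by blast
qed

text \<open>The multiples of a short vector congruent to a point of the line are dense enough to come near every functional,
  and each of their integral combinations is congruent to a point of the line.\<close>

lemma exists_close_line_point:
  fixes p s :: nat
  assumes p: "p > 0" and g: "int p dvd poly f (int g)" and s: "s > 0" "s ^ totient k < p"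
  obtains c :: int and m :: "nat \<Rightarrow> int" where
    "(\<Sum>j<k. \<bar>extend x (monom 1 j) - line_point p g c j - m j\<bar>) \<le> (real k)\<^sup>2 / (2 * s)"
proof -
  obtain lam c0 where lam: "functional lam" "\<And>j. lam (monom 1 j) - line_point p g c0 j \<in> \<int>"
    "lam (monom 1 0) \<noteq> 0" "sqrt (energy lam) \<le> k / s"
    using exists_short_functional_mod_prime[OF p g s] by blast
  define b where "b j = \<lfloor>lam (monom 1 j) - line_point p g c0 j\<rfloor>" for j
  have b: "lam (monom 1 j) = line_point p g c0 j + b j" for j
  proof -
    obtain w where w: "lam (monom 1 j) - line_point p g c0 j = of_int w" by (rule Ints_cases[OF lam(2)])
    have "b j = w" unfolding b_def w by simp
    then show ?thesis using w by simp
  qed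
  have pZ: "real p * lam (monom 1 i) \<in> \<int>" for i
  proof -
    have "real p * lam (monom 1 i) = of_int (c0 * int g ^ i + int p * b i)"
      unfolding b distrib_left using p by (simp add: line_point_def)
    then show ?thesis by (simp only: Ints_of_int)
  qed
  have p0: "real p \<noteq> 0" using p by simp
  obtain e :: "nat \<Rightarrow> int" where
    e: "energy (\<lambda>q. extend x q - (\<Sum>i<k. e i * lam (monom 1 i * q))) \<le> k / 4 * energy lam"
    by (rule exists_close_combination[OF lam(1) pZ p0 lam(3) functional_extend[of x]])
  define c where "c = (\<Sum>i<k. e i * c0 * int g ^ i)"
  define m where "m j = (\<Sum>i<k. e i * b (i + j))" for j
  have eq: "(\<Sum>i<k. e i * lam (monom 1 i * monom 1 j)) = line_point p g c j + m j" for j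
  proof -
    have "line_point p g c j = (\<Sum>i<k. e i * c0 * real g ^ i * real g ^ j / p)"
      by (simp add: line_point_def c_def sum_distrib_right sum_divide_distrib)
    also have "\<dots> = (\<Sum>i<k. e i * line_point p g c0 (i + j))"
      by (intro sum.cong refl) (simp add: line_point_def power_add)
    finally show ?thesis by (simp add: mult_monom b m_def distrib_left sum.distrib)
  qed
  let ?E = "\<lambda>j. \<bar>extend x (monom 1 j) - line_point p g c j - m j\<bar>"
  have lam4: "energy lam \<le> (k / s)\<^sup>2"
    using lam(4) by (metis real_sqrt_le_iff real_sqrt_abs abs_of_nonneg divide_nonneg_nonneg of_nat_0_le_iff)
  \<comment> \<open>From the energy to the sum of the distances by the Cauchy-Schwarz inequality.\<close>
  have "(\<Sum>j<k. ?E j)\<^sup>2 \<le> (\<Sum>j<k. (?E j)\<^sup>2) * card {..<k}"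
    by (rule sum_squared_le_sum_of_squares)
  also have "(\<Sum>j<k. (?E j)\<^sup>2) = energy (\<lambda>q. extend x q - (\<Sum>i<k. e i * lam (monom 1 i * q)))"
    unfolding energy_def eq by (simp add: diff_diff_eq)
  also have "\<dots> * card {..<k} \<le> (k / 4 * (k / s)\<^sup>2) * card {..<k}"
    using e lam4 by (intro mult_right_mono order_trans[OF e] mult_left_mono) auto
  also have "\<dots> = ((real k)\<^sup>2 / (2 * s))\<^sup>2" using s by (simp add: power2_eq_square field_simps)
  finally have "(\<Sum>j<k. ?E j) \<le> (real k)\<^sup>2 / (2 * s)" by (rule power2_le_imp_le) simp
  then show ?thesis by (rule that)
qed

end

section \<open>Integration over the circle and Jensen's formula\<close>

text \<open>The circle \<open>\<real>/\<int>\<close> with its invariant measure, as a measure on the real line concentrated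
  on a fundamental domain.\<close>

definition circle :: "real measure" where
  "circle = density lborel (indicator {0..<1})"

definition circ :: "real \<Rightarrow> complex" where
  "circ t = cis (2 * pi * t)"

lemma circ_add: "circ (s + t) = circ s * circ t"
  by (simp add: circ_def cis_mult distrib_left)

lemma norm_circ [simp]: "cmod (circ t) = 1"
  by (simp add: circ_def)

lemma circ_of_int [simp]: "circ (of_int n) = 1"
  by (simp add: circ_def cis_multiple_2pi)

lemma circ_add_int: "n \<in> \<int> \<Longrightarrow> circ (t + n) = circ t"
  by (auto elim!: Ints_cases simp: circ_add)

lemma frac_add_of_int: "frac (t + of_int n) = frac (t :: real)"
  by (simp add: frac_def)

lemma circ_frac: "circ (frac t) = circ t"
proof -
  have "circ t = circ (frac t + of_int \<lfloor>t\<rfloor>)" by (simp add: frac_def)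
  also have "\<dots> = circ (frac t)" by (simp add: circ_add)
  finally show ?thesis ..
qed

lemma measurable_circ [measurable]: "circ \<in> borel_measurable borel"
  unfolding circ_def by (intro borel_measurable_continuous_onI continuous_intros)

lemma sets_circle [measurable_cong, simp]: "sets circle = sets borel"
  by (simp add: circle_def)

lemma space_circle [simp]: "space circle = UNIV"
  by (simp add: circle_def)

lemma emeasure_circle: "A \<in> sets borel \<Longrightarrow> emeasure circle A = emeasure lborel ({0..<1} \<inter> A)"
  unfolding circle_def by (simp add: emeasure_density nn_integral_indicator' flip: indicator_inter_arith)

lemma prob_space_circle: "prob_space circle"
  by standard (simp add: emeasure_circle)

interpretation circle: prob_space circle by (rule prob_space_circle)

interpretation circle_product: product_sigma_finite "\<lambda>_. circle"
  by standard

lemma circle_closed: "circle = density lborel (indicator {0..1})"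
  unfolding circle_def
proof (rule density_cong)
  have "AE x in lborel. x \<noteq> (1::real)" by (rule AE_lborel_singleton)
  then show "AE x::real in lborel. indicator {0..<1} x = (indicator {0..1} x :: ennreal)"
    by eventually_elim (auto simp: indicator_def)
qed auto

lemma emeasure_lborel_shift:
  fixes c :: real
  assumes "A \<in> sets borel"
  shows "emeasure lborel {t. t + c \<in> A} = emeasure lborel A"
proof -
  have "emeasure lborel A = emeasure (distr lborel borel ((+) c)) A" by (simp add: lborel_distr_plus)
  also have "\<dots> = emeasure lborel {t. t + c \<in> A}"
    using assms by (subst emeasure_distr) (auto simp: vimage_def add.commute)
  finally show ?thesis ..
qed

lemma measurable_frac [measurable]: "(frac :: real \<Rightarrow> real) \<in> borel_measurable borel"
  unfolding frac_def by measurable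

text \<open>Rotation by \<open>b\<close> exchanges two intervals, translating one by \<open>b\<close> and the other by
  \<open>b - 1\<close>.\<close>

lemma distr_circle_rotate: "distr circle borel (\<lambda>t. frac (t + c)) = circle"
proof (rule measure_eqI)
  fix A :: "real set" assume "A \<in> sets (distr circle borel (\<lambda>t. frac (t + c)))"
  then have A [measurable]: "A \<in> sets borel" by simp
  define b where "b = frac c"
  have b: "0 \<le> b" "b < 1" by (auto simp: b_def frac_lt_1)
  have fr: "frac (t + c) = frac (t + b)" for t
  proof -
    have "t + c = (t + b) + of_int \<lfloor>c\<rfloor>" by (simp add: b_def frac_def)
    then show ?thesis by (simp only: frac_add_of_int)
  qed
  have f1: "frac (t + b) = t + b" if "0 \<le> t" "t < 1 - b" for t using that b by (simp add: frac_eq)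
  have f2: "frac (t + b) = t + (b - 1)" if "1 - b \<le> t" "t < 1" for t
    using that b by (subst frac_unique_iff) auto
  have m1 [measurable]: "{t. t + b \<in> {b..<1} \<inter> A} \<in> sets borel" by measurable
  have m2 [measurable]: "{t. t + (b - 1) \<in> {0..<b} \<inter> A} \<in> sets borel" by measurable
  have "emeasure (distr circle borel (\<lambda>t. frac (t + c))) A = emeasure circle {t. frac (t + c) \<in> A}"
    by (subst emeasure_distr) (auto simp: vimage_def)
  also have "\<dots> = emeasure lborel ({0..<1} \<inter> {t. frac (t + b) \<in> A})"
    by (subst emeasure_circle) (auto simp: fr)
  also have "{0..<1} \<inter> {t. frac (t + b) \<in> A} = {t. t + b \<in> {b..<1} \<inter> A} \<union> {t. t + (b - 1) \<in> {0..<b} \<inter> A}"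
    (is "?L = ?R")
  proof (rule Set.set_eqI)
    fix t
    consider "t < 0 \<or> t \<ge> 1" | "0 \<le> t" "t < 1 - b" | "1 - b \<le> t" "t < 1" by linarith
    then show "t \<in> ?L \<longleftrightarrow> t \<in> ?R"
    proof cases
      case 1
      then show ?thesis using b by auto
    next
      case 2
      then show ?thesis using b f1[OF 2] by auto
    next
      case 3
      then show ?thesis using b f2[OF 3] by auto
    qed
  qed
  also have "emeasure lborel \<dots> = emeasure lborel {t. t + b \<in> {b..<1} \<inter> A} + emeasure lborel {t. t + (b - 1) \<in> {0..<b} \<inter> A}"
    using b by (intro plus_emeasure[symmetric]) auto
  also have "\<dots> = emeasure lborel ({b..<1} \<inter> A) + emeasure lborel ({0..<b} \<inter> A)"
    by (subst (1 2) emeasure_lborel_shift) auto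
  also have "\<dots> = emeasure lborel (({b..<1} \<inter> A) \<union> ({0..<b} \<inter> A))"
    by (intro plus_emeasure) auto
  also have "({b..<1} \<inter> A) \<union> ({0..<b} \<inter> A) = {0..<1} \<inter> A" using b by auto
  also have "emeasure lborel \<dots> = emeasure circle A" by (simp add: emeasure_circle)
  finally show "emeasure (distr circle borel (\<lambda>t. frac (t + c))) A = emeasure circle A" .
qed simp

text \<open>Rotations of a torus preserve the measure, as they do so in every coordinate.\<close>

lemma distr_torus_rotate:
  assumes I: "finite I"
  shows "distr (PiM I (\<lambda>_. circle)) (PiM I (\<lambda>_. circle)) (\<lambda>x. \<lambda>i\<in>I. frac (x i + v i)) = PiM I (\<lambda>_. circle)"
proof (rule circle_product.PiM_eqI[OF I])
  fix A assume A: "\<And>i. i \<in> I \<Longrightarrow> A i \<in> sets circle"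
  let ?T = "\<lambda>x. \<lambda>i\<in>I. frac (x i + v i)"
  have m: "?T \<in> measurable (PiM I (\<lambda>_. circle)) (PiM I (\<lambda>_. circle))" by measurable
  have B: "{t. frac (t + v i) \<in> A i} \<in> sets borel" if "i \<in> I" for i
  proof -
    have [measurable]: "A i \<in> sets borel" using A that by simp
    show ?thesis by measurable
  qed
  have "emeasure (distr (PiM I (\<lambda>_. circle)) (PiM I (\<lambda>_. circle)) ?T) (PiE I A)
      = emeasure (PiM I (\<lambda>_. circle)) (?T -` PiE I A \<inter> space (PiM I (\<lambda>_. circle)))"
    using A I by (intro emeasure_distr m sets_PiM_I_finite) auto
  also have "?T -` PiE I A \<inter> space (PiM I (\<lambda>_. circle)) = PiE I (\<lambda>i. {t. frac (t + v i) \<in> A i})"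
    by (auto simp: space_PiM PiE_iff)
  also have "emeasure (PiM I (\<lambda>_. circle)) \<dots> = (\<Prod>i\<in>I. emeasure circle {t. frac (t + v i) \<in> A i})"
    using I B by (intro circle_product.emeasure_PiM) auto
  also have "\<dots> = (\<Prod>i\<in>I. emeasure circle (A i))"
  proof (rule prod.cong[OF refl])
    fix i assume i: "i \<in> I"
    have "emeasure circle (A i) = emeasure (distr circle borel (\<lambda>t. frac (t + v i))) (A i)"
      by (simp add: distr_circle_rotate)
    also have "\<dots> = emeasure circle {t. frac (t + v i) \<in> A i}"
      using A[OF i] by (subst emeasure_distr) (auto simp: vimage_def)
    finally show "emeasure circle {t. frac (t + v i) \<in> A i} = emeasure circle (A i)" ..
  qed
  finally show "emeasure (distr (PiM I (\<lambda>_. circle)) (PiM I (\<lambda>_. circle)) ?T) (PiE I A) = (\<Prod>i\<in>I. emeasure circle (A i))" .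
qed simp

lemma integral_torus_rotate:
  fixes f :: "(nat \<Rightarrow> real) \<Rightarrow> real"
  assumes I: "finite I" and f: "f \<in> borel_measurable (PiM I (\<lambda>_. circle))"
    and per: "\<And>x. f (\<lambda>i\<in>I. frac (x i)) = f x"
  shows "integral\<^sup>L (PiM I (\<lambda>_. circle)) (\<lambda>x. f (\<lambda>i. x i + v i)) = integral\<^sup>L (PiM I (\<lambda>_. circle)) f"
proof -
  let ?T = "\<lambda>x. \<lambda>i\<in>I. frac (x i + v i)"
  have m: "?T \<in> measurable (PiM I (\<lambda>_. circle)) (PiM I (\<lambda>_. circle))" by measurable
  have "integral\<^sup>L (PiM I (\<lambda>_. circle)) f = integral\<^sup>L (distr (PiM I (\<lambda>_. circle)) (PiM I (\<lambda>_. circle)) ?T) f"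
    by (simp add: distr_torus_rotate[OF I])
  also have "\<dots> = integral\<^sup>L (PiM I (\<lambda>_. circle)) (\<lambda>x. f (?T x))" by (rule integral_distr[OF m f])
  also have "(\<lambda>x. f (?T x)) = (\<lambda>x. f (\<lambda>i. x i + v i))"
    using per[of "\<lambda>i. _ i + v i"] by (auto simp: fun_eq_iff)
  finally show ?thesis by simp
qed

lemma integral_circle_rotate:
  fixes h :: "real \<Rightarrow> real"
  assumes h [measurable]: "h \<in> borel_measurable borel" and per: "\<And>t. h (frac t) = h t"
  shows "integral\<^sup>L circle (\<lambda>t. h (t + c)) = integral\<^sup>L circle h"
    and "integrable circle h \<Longrightarrow> integrable circle (\<lambda>t. h (t + c))"
proof -
  have m: "(\<lambda>t. frac (t + c)) \<in> measurable circle borel" by measurable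
  have "integral\<^sup>L circle h = integral\<^sup>L (distr circle borel (\<lambda>t. frac (t + c))) h"
    by (simp add: distr_circle_rotate)
  also have "\<dots> = integral\<^sup>L circle (\<lambda>t. h (t + c))"
    by (subst integral_distr[OF m]) (auto simp: per)
  finally show "integral\<^sup>L circle (\<lambda>t. h (t + c)) = integral\<^sup>L circle h" ..
  assume "integrable circle h"
  then have "integrable (distr circle borel (\<lambda>t. frac (t + c))) h" by (simp add: distr_circle_rotate)
  then have "integrable circle (\<lambda>t. h (frac (t + c)))" by (rule integrable_distr[OF m])
  then show "integrable circle (\<lambda>t. h (t + c))" by (simp add: per)
qed

lemma integral_circle_eq: "integral\<^sup>L circle h = integral\<^sup>L lborel (\<lambda>t. indicator {0..<1} t * h t)"
  and integrable_circle_iff: "integrable circle h \<longleftrightarrow> integrable lborel (\<lambda>t. indicator {0..<1} t * h t)"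
  if "h \<in> borel_measurable borel" for h :: "real \<Rightarrow> real"
proof -
  have c: "circle = density lborel (\<lambda>t. ennreal (indicator {0..<1} t))"
    unfolding circle_def by (rule arg_cong[of _ _ "density lborel"]) (auto simp: indicator_def)
  show "integral\<^sup>L circle h = integral\<^sup>L lborel (\<lambda>t. indicator {0..<1} t * h t)"
    unfolding c using that by (subst integral_density) auto
  show "integrable circle h \<longleftrightarrow> integrable lborel (\<lambda>t. indicator {0..<1} t * h t)"
    unfolding c using that by (subst integrable_density) auto
qed

lemma integral_circle_double:
  fixes h :: "real \<Rightarrow> real"
  assumes h [measurable]: "h \<in> borel_measurable borel" and per: "\<And>t. h (frac t) = h t"
    and int: "integrable circle h"
  shows "integral\<^sup>L circle (\<lambda>t. h (2 * t)) = integral\<^sup>L circle h"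
proof -
  define g where "g = (\<lambda>t. indicator {0..<1} t * h t)"
  have g: "integrable lborel g" using int by (simp add: g_def integrable_circle_iff)
  have h1: "h (t - 1) = h t" for t using per[of t] per[of "t - 1"] by (metis frac_1_eq diff_add_cancel)
  have e: "indicator {0..<1} t * h (2 * t) = g (0 + 2 * t) + g (-1 + 2 * t)" for t :: real
    using h1[of "2 * t"] by (auto simp: g_def indicator_def)
  have "integral\<^sup>L circle (\<lambda>t. h (2 * t)) = integral\<^sup>L lborel (\<lambda>t. g (0 + 2 * t) + g (-1 + 2 * t))"
    by (subst integral_circle_eq) (auto simp: e)
  also have "\<dots> = integral\<^sup>L lborel (\<lambda>t. g (0 + 2 * t)) + integral\<^sup>L lborel (\<lambda>t. g (-1 + 2 * t))"
    by (intro Bochner_Integration.integral_add lborel_integrable_real_affine g) auto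
  also have "\<dots> = integral\<^sup>L lborel g"
    using lborel_integral_real_affine[of 2 g 0] lborel_integral_real_affine[of 2 g "-1"] by simp
  finally show ?thesis by (simp add: g_def integral_circle_eq)
qed

text \<open>The function \<open>log\<^sup>+\<close>.\<close>

definition lnp :: "real \<Rightarrow> real" where
  "lnp r = ln (max 1 r)"

lemma lnp_nonneg: "lnp r \<ge> 0"
  by (simp add: lnp_def)

lemma lnp_mono: "r \<le> s \<Longrightarrow> lnp r \<le> lnp s"
  by (simp add: lnp_def)

lemma lnp_lipschitz: "\<bar>lnp r - lnp s\<bar> \<le> \<bar>r - s\<bar>"
proof -
  have *: "ln (max 1 r) - ln (max 1 s) \<le> \<bar>r - s\<bar>" for r s :: real
  proof -
    have "ln (max 1 r) - ln (max 1 s) = ln (max 1 r / max 1 s)"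
      by (subst ln_div) (auto simp: max_def)
    also have "\<dots> \<le> max 1 r / max 1 s - 1" by (rule ln_le_minus_one) (auto simp: max_def intro!: divide_pos_pos)
    also have "\<dots> = (max 1 r - max 1 s) / max 1 s"
      by (simp add: diff_divide_distrib max_def)
    also have "\<dots> \<le> \<bar>r - s\<bar> / 1" by (intro frac_le) auto
    finally show ?thesis by simp
  qed
  show ?thesis using *[of r s] *[of s r] by (auto simp: lnp_def abs_le_iff)
qed

lemma abs_ln_eq: "\<bar>ln r\<bar> = 2 * lnp r - ln r" if "r \<ge> 0" for r :: real
  using that by (cases "r = 0") (auto simp: lnp_def max_def abs_if)

lemma measurable_ln_circ [measurable]: "(\<lambda>t. ln (cmod (circ t - a))) \<in> borel_measurable borel"
  by measurable

lemma frac_ln_circ: "ln (cmod (circ (frac t) - a)) = ln (cmod (circ t - a))"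
  by (simp add: circ_frac)

lemma integrable_ln_circ_off_circle:
  assumes "cmod a \<noteq> 1"
  shows "integrable circle (\<lambda>t. ln (cmod (circ t - a)))"
    and "cmod a < 1 \<Longrightarrow> \<bar>integral\<^sup>L circle (\<lambda>t. ln (cmod (circ t - a)))\<bar> \<le> - ln (1 - cmod a)"
proof -
  let ?l = "\<bar>1 - cmod a\<bar>" and ?u = "1 + cmod a"
  have l: "?l > 0" using assms by simp
  have low: "?l \<le> cmod (circ t - a)" for t using norm_triangle_ineq3[of "circ t" a] by simp
  have up: "cmod (circ t - a) \<le> ?u" for t using norm_triangle_ineq4[of "circ t" a] by simp
  have b1: "ln ?l \<le> ln (cmod (circ t - a))" for t
    by (rule ln_mono) (use low[of t] l in linarith)+
  have b2: "ln (cmod (circ t - a)) \<le> ln ?u" for t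
  proof -
    have "0 < cmod (circ t - a)" using low[of t] l by linarith
    then show ?thesis using up[of t] by (intro ln_mono) auto
  qed
  have "\<bar>ln (cmod (circ t - a))\<bar> \<le> \<bar>ln ?l\<bar> + \<bar>ln ?u\<bar>" for t using b1[of t] b2[of t] by linarith
  then show int: "integrable circle (\<lambda>t. ln (cmod (circ t - a)))"
    by (intro circle.integrable_const_bound[of _ "\<bar>ln ?l\<bar> + \<bar>ln ?u\<bar>"]) auto
  assume a: "cmod a < 1"
  have "?u * ?l \<le> 1" using a by (simp add: algebra_simps abs_if)
  then have "ln (?u * ?l) \<le> 0" using l by (subst ln_le_zero_iff) (auto intro!: mult_pos_pos add_pos_nonneg)
  moreover have "ln (?u * ?l) = ln ?u + ln ?l" using l by (intro ln_mult_pos add_pos_nonneg) auto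
  ultimately have b: "\<bar>ln (cmod (circ t - a))\<bar> \<le> - ln ?l" for t using b1[of t] b2[of t] by linarith
  have "\<bar>integral\<^sup>L circle (\<lambda>t. ln (cmod (circ t - a)))\<bar> \<le> integral\<^sup>L circle (\<lambda>t. \<bar>ln (cmod (circ t - a))\<bar>)"
    by (rule integral_abs_bound)
  also have "\<dots> \<le> integral\<^sup>L circle (\<lambda>t. - ln ?l)"
    by (rule integral_mono) (use int b in auto)
  also have "\<dots> = - ln (1 - cmod a)" using a circle.prob_space by simp
  finally show "\<bar>integral\<^sup>L circle (\<lambda>t. ln (cmod (circ t - a)))\<bar> \<le> - ln (1 - cmod a)" .
qed

lemma AE_circ_neq: "AE t in circle. circ t \<noteq> b"
proof -
  have "countable {t\<in>{0..<1}. circ t = b}"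
  proof (rule countable_subset)
    show "{t\<in>{0..<1}. circ t = b} \<subseteq> {SOME t. t \<in> {0..<1} \<and> circ t = b}"
    proof
      fix t assume t: "t \<in> {t\<in>{0..<1}. circ t = b}"
      define s where "s = (SOME t. t \<in> {0..<1} \<and> circ t = b)"
      have s: "s \<in> {0..<1} \<and> circ s = b" unfolding s_def by (rule someI[of _ t]) (use t in auto)
      then have "cis (2 * pi * t) = cis (2 * pi * s)" using t by (simp add: circ_def)
      then obtain n :: int where "2 * pi * t = 2 * pi * s + 2 * pi * n"
        using sin_cos_eq_iff[of "2 * pi * t" "2 * pi * s"] by (auto simp: complex_eq_iff)
      then have "2 * pi * t = 2 * pi * (s + n)" by (simp only: distrib_left)
      then have "t = s + n" by simp
      moreover have "\<bar>t - s\<bar> < 1" using s t by auto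
      ultimately have "n = 0" by simp
      then show "t \<in> {SOME t. t \<in> {0..<1} \<and> circ t = b}" using \<open>t = s + n\<close> by (simp add: s_def)
    qed
  qed simp
  then have "emeasure lborel {t\<in>{0..<1}. circ t = b} = 0" by (rule emeasure_lborel_countable)
  moreover have "{t\<in>{0..<1}. circ t = b} = {0..<1} \<inter> {t. circ t = b}" by auto
  ultimately have "emeasure circle {t. circ t = b} = 0" by (simp add: emeasure_circle)
  then show ?thesis by (intro AE_I[of _ _ "{t. circ t = b}"]) auto
qed

text \<open>The logarithmic Mahler measure of \<open>X - a\<close>.\<close>

definition jensen :: "complex \<Rightarrow> real" where
  "jensen a = integral\<^sup>L circle (\<lambda>t. ln (cmod (circ t - a)))"

text \<open>On the circle \<open>x\<^sup>2 - a\<^sup>2 = (x - a)(x + a)\<close>. The left side is a function of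
  \<open>2t\<close>, and \<open>x + a\<close> is a rotation of \<open>x - a\<close>.\<close>

lemma jensen_square:
  assumes a: "integrable circle (\<lambda>t. ln (cmod (circ t - a)))"
    and a2: "integrable circle (\<lambda>t. ln (cmod (circ t - a\<^sup>2)))"
  shows "jensen (a\<^sup>2) = 2 * jensen a"
proof -
  let ?h = "\<lambda>t. ln (cmod (circ t - a))"
  have half: "circ (t + 1 / 2) = - circ t" for t by (simp add: circ_add) (simp add: circ_def)
  have "jensen (a\<^sup>2) = integral\<^sup>L circle (\<lambda>t. ln (cmod (circ (2 * t) - a\<^sup>2)))"
    unfolding jensen_def by (rule integral_circle_double[symmetric]) (auto simp: frac_ln_circ a2)
  also have "\<dots> = integral\<^sup>L circle (\<lambda>t. ?h t + ?h (t + 1 / 2))"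
  proof (rule integral_cong_AE)
    show "AE t in circle. ln (cmod (circ (2 * t) - a\<^sup>2)) = ?h t + ?h (t + 1 / 2)"
      using AE_circ_neq[of a] AE_circ_neq[of "- a"]
    proof eventually_elim
      case (elim t)
      have "circ (2 * t) - a\<^sup>2 = - ((circ t - a) * (circ (t + 1 / 2) - a))"
        using circ_add[of t t] by (simp add: half power2_eq_square algebra_simps)
      moreover have "circ t - a \<noteq> 0" "circ (t + 1 / 2) - a \<noteq> 0"
        using elim by (auto simp: half)
      ultimately show ?case by (simp add: norm_mult ln_mult)
    qed
  qed auto
  also have "\<dots> = integral\<^sup>L circle ?h + integral\<^sup>L circle (\<lambda>t. ?h (t + 1 / 2))"
    by (intro Bochner_Integration.integral_add a integral_circle_rotate(2)) (auto simp: frac_ln_circ)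
  also have "integral\<^sup>L circle (\<lambda>t. ?h (t + 1 / 2)) = integral\<^sup>L circle ?h"
    by (rule integral_circle_rotate(1)) (auto simp: frac_ln_circ)
  finally show ?thesis by (simp add: jensen_def)
qed

text \<open>The integral is bounded on a disc of radius less than \<open>1\<close>, yet repeated squaring doubles it at each
  step.\<close>

lemma jensen_inside:
  assumes "cmod a < 1"
  shows "jensen a = 0"
proof (rule ccontr)
  assume nz: "jensen a \<noteq> 0"
  have pow: "cmod (a ^ (2 ^ n)) \<le> cmod a \<and> jensen (a ^ (2 ^ n)) = 2 ^ n * jensen a" for n
  proof (induct n)
    case (Suc n)
    let ?b = "a ^ (2 ^ n)"
    have b: "cmod ?b < 1" using Suc assms by linarith
    have sq: "?b\<^sup>2 = a ^ (2 ^ Suc n)" by (simp add: power_mult[symmetric] mult.commute)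
    have "cmod (?b\<^sup>2) \<le> cmod ?b"
      unfolding power2_eq_square norm_mult by (rule mult_left_le[OF less_imp_le[OF b] norm_ge_zero])
    then have c: "cmod (?b\<^sup>2) \<le> cmod a" using Suc by linarith
    moreover have "jensen (?b\<^sup>2) = 2 * jensen ?b"
      by (rule jensen_square; rule integrable_ln_circ_off_circle) (use b c assms in auto)
    ultimately show ?case using Suc unfolding sq by simp
  qed simp
  obtain n where n: "- ln (1 - cmod a) / \<bar>jensen a\<bar> < 2 ^ n"
    using real_arch_pow[of 2] by auto
  have "\<bar>jensen (a ^ (2 ^ n))\<bar> \<le> - ln (1 - cmod (a ^ (2 ^ n)))"
    unfolding jensen_def using pow[of n] assms by (intro integrable_ln_circ_off_circle(2)) auto
  also have "\<dots> \<le> - ln (1 - cmod a)"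
    using pow[of n] assms by (simp add: ln_mono)
  finally have "2 ^ n * \<bar>jensen a\<bar> \<le> - ln (1 - cmod a)" using pow[of n] by (simp add: abs_mult)
  moreover have "- ln (1 - cmod a) < 2 ^ n * \<bar>jensen a\<bar>" using n nz by (subst (asm) divide_less_eq) auto
  ultimately show False by simp
qed

text \<open>On the unit circle itself integrability comes from Fatou's lemma: approach \<open>a\<close> from inside.\<close>

lemma integrable_ln_circ:
  "integrable circle (\<lambda>t. ln (cmod (circ t - a)))"
proof (cases "cmod a = 1")
  case False
  then show ?thesis by (rule integrable_ln_circ_off_circle)
next
  case True
  define b where "b n = of_real (1 - 1 / (real n + 2)) * a" for n
  have bn: "cmod (b n) < 1" for n
    using True by (simp add: b_def norm_mult abs_if del: of_real_diff)
  have blim: "b \<longlonglongrightarrow> a"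
  proof -
    have "(\<lambda>n. 1 / real (n + 2)) \<longlonglongrightarrow> 0" by (rule LIMSEQ_ignore_initial_segment[OF lim_1_over_n])
    then have "(\<lambda>n. 1 / (real n + 2)) \<longlonglongrightarrow> 0" by (simp add: add.commute)
    then have "(\<lambda>n. 1 - 1 / (real n + 2)) \<longlonglongrightarrow> 1 - 0" by (intro tendsto_diff tendsto_const)
    then have "(\<lambda>n. of_real (1 - 1 / (real n + 2)) * a) \<longlonglongrightarrow> of_real (1 - 0) * a"
      by (intro tendsto_mult tendsto_of_real tendsto_const)
    then show ?thesis by (simp add: b_def[abs_def])
  qed
  let ?h = "\<lambda>b t. \<bar>ln (cmod (circ t - b))\<bar>"
  have bound: "(\<integral>\<^sup>+t. ennreal (?h (b n) t) \<partial>circle) \<le> ennreal (2 * ln 2)" for n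
  proof -
    have i: "integrable circle (\<lambda>t. ln (cmod (circ t - b n)))" using bn[of n] by (intro integrable_ln_circ_off_circle) auto
    have "?h (b n) t \<le> 2 * ln 2 - ln (cmod (circ t - b n))" for t
    proof -
      have "cmod (circ t - b n) \<le> 2" using norm_triangle_ineq4[of "circ t" "b n"] bn[of n] by simp
      then have "lnp (cmod (circ t - b n)) \<le> lnp 2" by (rule lnp_mono)
      then show ?thesis by (simp add: abs_ln_eq) (simp add: lnp_def)
    qed
    then have "integral\<^sup>L circle (?h (b n)) \<le> integral\<^sup>L circle (\<lambda>t. 2 * ln 2 - ln (cmod (circ t - b n)))"
      using i by (intro integral_mono) auto
    also have "\<dots> = 2 * ln 2 - jensen (b n)" using i circle.prob_space by (simp add: jensen_def)
    also have "\<dots> = 2 * ln 2" using jensen_inside[OF bn] by simp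
    finally show ?thesis using i by (subst nn_integral_eq_integral) (auto intro: ennreal_leI)
  qed
  \<comment> \<open>At the singularity \<open>circ t = a\<close> the inequality is trivial because \<open>ln 0 = 0\<close>.\<close>
  have lim: "ennreal (?h a t) \<le> liminf (\<lambda>n. ennreal (?h (b n) t))" for t
  proof (cases "circ t = a")
    case False
    then have "(\<lambda>n. ennreal (?h (b n) t)) \<longlonglongrightarrow> ennreal (?h a t)"
      by (intro tendsto_intros blim) auto
    from lim_imp_Liminf[OF trivial_limit_sequentially this] show ?thesis by simp
  qed simp
  have "(\<integral>\<^sup>+t. ennreal (?h a t) \<partial>circle) \<le> (\<integral>\<^sup>+t. liminf (\<lambda>n. ennreal (?h (b n) t)) \<partial>circle)"
    by (intro nn_integral_mono lim)
  also have "\<dots> \<le> liminf (\<lambda>n. \<integral>\<^sup>+t. ennreal (?h (b n) t) \<partial>circle)"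
    by (intro nn_integral_liminf) measurable
  also have "\<dots> \<le> liminf (\<lambda>n::nat. ennreal (2 * ln 2))" by (intro Liminf_mono always_eventually allI bound)
  also have "\<dots> < \<infinity>" by (simp add: Liminf_const)
  finally show ?thesis by (intro integrableI_bounded) auto
qed

text \<open>Jensen's formula for a linear factor. For \<open>\<bar>a\<bar> = 1\<close> the integral does not depend on \<open>a\<close>, by rotation, and
  equals twice itself, by the doubling formula.\<close>

theorem jensen_formula: "jensen a = lnp (cmod a)"
proof (cases "cmod a" "1::real" rule: linorder_cases)
  case less
  then show ?thesis by (simp add: jensen_inside lnp_def)
next
  case equal
  have rot: "jensen (circ s) = jensen 1" for s
  proof -
    have "jensen (circ s) = integral\<^sup>L circle (\<lambda>t. ln (cmod (circ (t + s) - circ s)))"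
      unfolding jensen_def by (rule integral_circle_rotate(1)[symmetric]) (auto simp: frac_ln_circ)
    also have "(\<lambda>t. ln (cmod (circ (t + s) - circ s))) = (\<lambda>t. ln (cmod (circ t - 1)))"
    proof
      fix t
      have "circ (t + s) - circ s = (circ t - 1) * circ s" by (simp add: circ_add algebra_simps)
      then show "ln (cmod (circ (t + s) - circ s)) = ln (cmod (circ t - 1))" by (simp add: norm_mult)
    qed
    finally show ?thesis by (simp add: jensen_def)
  qed
  have "a = cis (Arg a)" using equal rcis_cmod_Arg[of a] by (simp add: rcis_def)
  then have "a = circ (Arg a / (2 * pi))" by (simp add: circ_def)
  then have "jensen a = jensen 1" using rot by metis
  moreover have "jensen 1 = 0"
    using jensen_square[OF integrable_ln_circ integrable_ln_circ, of 1] by simp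
  ultimately show ?thesis using equal by (simp add: lnp_def)
next
  case greater
  \<comment> \<open>Reflection in the unit circle: \<open>\<bar>x - a\<bar> = \<bar>a\<bar> \<bar>x - b\<bar>\<close> for
    \<open>\<bar>x\<bar> = 1\<close>.\<close>
  define b where "b = cnj (1 / a)"
  have b: "cmod b < 1" using greater by (simp add: b_def norm_divide divide_less_eq)
  have a0: "a \<noteq> 0" using greater by auto
  have eq: "ln (cmod (circ t - a)) = ln (cmod a) + ln (cmod (circ t - b))" for t
  proof -
    have cc: "circ t * cnj (circ t) = 1" by (simp flip: complex_norm_square)
    have "circ t - a = - (a * circ t * cnj (circ t - b))"
    proof -
      have "a * circ t * cnj (circ t - b) = a * (circ t * cnj (circ t)) - a * (1 / a) * circ t"
        by (simp add: b_def algebra_simps)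
      then show ?thesis using cc a0 by simp
    qed
    then have "cmod (circ t - a) = cmod a * cmod (circ t - b)" by (simp add: norm_mult del: complex_cnj_diff)
    moreover have "circ t \<noteq> b" using b norm_circ[of t] by auto
    ultimately show ?thesis using a0 by (simp add: ln_mult)
  qed
  have "jensen a = ln (cmod a) + jensen b"
    unfolding jensen_def eq using integrable_ln_circ[of b] circle.prob_space by simp
  then show ?thesis using greater jensen_inside[OF b] by (simp add: lnp_def)
qed

section \<open>Mahler measures as integrals over the torus\<close>

lemma circ_eq_exp: "exp (2 * of_real pi * \<i> * of_real t) = circ t"
  by (simp add: circ_def cis_conv_exp mult_ac)

lemma circ_power_int: "circ t powi n = circ (of_int n * t)"
proof -
  have nat: "circ s ^ m = circ (of_nat m * s)" for s and m :: nat
  proof (induct m)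
    case 0
    then show ?case using circ_of_int[of 0] by simp
  next
    case (Suc m)
    then show ?case by (simp add: distrib_right flip: circ_add)
  qed
  have neg: "inverse (circ s) = circ (- s)" for s
  proof -
    have "circ s * circ (- s) = 1" using circ_add[of s "- s"] circ_of_int[of 0] by simp
    then show ?thesis by (rule inverse_unique)
  qed
  show ?thesis
  proof (cases "n \<ge> 0")
    case True
    then show ?thesis by (simp add: power_int_def nat)
  next
    case False
    then show ?thesis by (simp add: power_int_def power_inverse nat neg flip: power_inverse)
  qed
qed

lemma circ_sum: "circ (\<Sum>i\<in>I. x i) = (\<Prod>i\<in>I. circ (x i))"
  using circ_of_int[of 0] by (induct I rule: infinite_finite_induct) (simp_all add: circ_add)

lemma norm_circ_minus_1: "cmod (circ t - 1) \<le> 2 * pi * \<bar>t\<bar>"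
proof -
  have "cmod (circ t - 1) = 2 * \<bar>sin (2 * pi * t / 2)\<bar>"
    unfolding circ_def cis_conv_exp by (rule dist_exp_i_1)
  also have "\<dots> \<le> 2 * \<bar>2 * pi * t / 2\<bar>" by (intro mult_left_mono abs_sin_x_le_abs_x) simp
  also have "\<dots> = 2 * pi * \<bar>t\<bar>" by (simp add: abs_mult)
  finally show ?thesis .
qed

lemma measurable_lnp [measurable]: "lnp \<in> borel_measurable borel"
  unfolding lnp_def by measurable

lemma emeasure_torus_space: "finite I \<Longrightarrow> emeasure (PiM I (\<lambda>_. circle)) (space (PiM I (\<lambda>_. circle))) = 1"
  using circle_product.emeasure_PiM[of I "\<lambda>_. UNIV"] circle.emeasure_space_1 by (simp add: space_PiM)

lemma prob_space_torus: "finite I \<Longrightarrow> prob_space (PiM I (\<lambda>_. circle))"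
  by (rule prob_spaceI) (rule emeasure_torus_space)

lemma torus_eq_density:
  assumes I: "finite I"
  shows "density (PiM I (\<lambda>_. lborel)) (\<lambda>x. ennreal (indicator (PiE I (\<lambda>_. {0..1})) x)) = PiM I (\<lambda>_. circle)"
proof (rule circle_product.PiM_eqI[OF I])
  interpret L: product_sigma_finite "\<lambda>_. lborel :: real measure" by standard
  have sets_eq: "sets (PiM I (\<lambda>_. lborel)) = sets (PiM I (\<lambda>_. circle))" by (rule sets_PiM_cong) simp_all
  let ?B = "PiE I (\<lambda>_. {0..1::real})"
  have B: "?B \<in> sets (PiM I (\<lambda>_. lborel))" using I by (intro sets_PiM_I_finite) auto
  show "sets (density (PiM I (\<lambda>_. lborel)) (\<lambda>x. ennreal (indicator ?B x))) = sets (PiM I (\<lambda>_. circle))"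
    using sets_eq by simp
  fix A assume A: "\<And>i. i \<in> I \<Longrightarrow> A i \<in> sets circle"
  have PA: "PiE I A \<in> sets (PiM I (\<lambda>_. lborel))" using A I by (intro sets_PiM_I_finite) auto
  have "emeasure (density (PiM I (\<lambda>_. lborel)) (\<lambda>x. ennreal (indicator ?B x))) (PiE I A)
      = (\<integral>\<^sup>+x. ennreal (indicator ?B x) * indicator (PiE I A) x \<partial>PiM I (\<lambda>_. lborel))"
    using B PA by (intro emeasure_density) auto
  also have "\<dots> = (\<integral>\<^sup>+x. indicator (?B \<inter> PiE I A) x \<partial>PiM I (\<lambda>_. lborel))"
    by (intro nn_integral_cong) (auto simp: indicator_def)
  also have "\<dots> = emeasure (PiM I (\<lambda>_. lborel)) (?B \<inter> PiE I A)" using B PA by (intro nn_integral_indicator) auto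
  also have "?B \<inter> PiE I A = PiE I (\<lambda>i. {0..1} \<inter> A i)" by (rule PiE_Int)
  also have "emeasure (PiM I (\<lambda>_. lborel)) \<dots> = (\<Prod>i\<in>I. emeasure lborel ({0..1} \<inter> A i))"
    using A I by (intro L.emeasure_PiM) auto
  also have "\<dots> = (\<Prod>i\<in>I. emeasure circle (A i))"
  proof (rule prod.cong[OF refl])
    fix i assume "i \<in> I"
    then have "A i \<in> sets borel" using A by simp
    then show "emeasure lborel ({0..1} \<inter> A i) = emeasure circle (A i)"
      unfolding circle_closed by (simp add: emeasure_density nn_integral_indicator' flip: indicator_inter_arith)
  qed
  finally show "emeasure (density (PiM I (\<lambda>_. lborel)) (\<lambda>x. ennreal (indicator ?B x))) (PiE I A) = (\<Prod>i\<in>I. emeasure circle (A i))" .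
qed

lemma laurent_eval_superset:
  assumes "finite A" "Poly_Mapping.keys f \<subseteq> A"
  shows "laurent_eval N f x = (\<Sum>a\<in>A. Poly_Mapping.lookup f a * (\<Prod>i<N. x i powi Poly_Mapping.lookup a i))"
  unfolding laurent_eval_def using assms by (intro sum.mono_neutral_left) (auto simp: in_keys_iff)

lemma laurent_eval_add: "laurent_eval N (f + h) x = laurent_eval N f x + laurent_eval N h x"
proof -
  let ?A = "Poly_Mapping.keys f \<union> Poly_Mapping.keys h"
  have A: "finite ?A" "Poly_Mapping.keys f \<subseteq> ?A" "Poly_Mapping.keys h \<subseteq> ?A" "Poly_Mapping.keys (f + h) \<subseteq> ?A"
    using keys_add[of f h] by auto
  show ?thesis
    unfolding laurent_eval_superset[OF A(1,2)] laurent_eval_superset[OF A(1,3)] laurent_eval_superset[OF A(1,4)]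
    by (simp add: lookup_add distrib_right sum.distrib)
qed

lemma laurent_eval_single:
  "laurent_eval N (Poly_Mapping.single a c) x = c * (\<Prod>i<N. x i powi Poly_Mapping.lookup a i)"
  by (subst laurent_eval_superset[of "{a}"]) (auto simp: lookup_single)

lemma laurent_eval_sum: "laurent_eval N (\<Sum>i\<in>I. f i) x = (\<Sum>i\<in>I. laurent_eval N (f i) x)"
proof (induct I rule: infinite_finite_induct)
  case (insert i I)
  then show ?case by (simp add: laurent_eval_add)
qed (simp_all add: laurent_eval_def)

lemma mahler_eq_torus_integral:
  assumes f: "(\<lambda>\<theta>. ln (cmod (laurent_eval N f (\<lambda>i. circ (\<theta> i))))) \<in> borel_measurable (PiM {..<N} (\<lambda>_. circle))"
  shows "mahler N f = integral\<^sup>L (PiM {..<N} (\<lambda>_. circle)) (\<lambda>\<theta>. ln (cmod (laurent_eval N f (\<lambda>i. circ (\<theta> i)))))"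
proof -
  let ?h = "\<lambda>\<theta>. ln (cmod (laurent_eval N f (\<lambda>i. circ (\<theta> i))))"
  let ?B = "PiE {..<N} (\<lambda>_. {0..1::real})"
  have sets_eq: "sets (PiM {..<N} (\<lambda>_. lborel :: real measure)) = sets (PiM {..<N} (\<lambda>_. circle))"
    by (rule sets_PiM_cong) simp_all
  have h: "?h \<in> borel_measurable (PiM {..<N} (\<lambda>_. lborel))"
    using f measurable_cong_sets[OF sets_eq refl, of "borel :: real measure"] by simp
  have B: "?B \<in> sets (PiM {..<N} (\<lambda>_. lborel))" by (intro sets_PiM_I_finite) auto
  have "integral\<^sup>L (PiM {..<N} (\<lambda>_. circle)) ?h = integral\<^sup>L (PiM {..<N} (\<lambda>_. lborel)) (\<lambda>x. indicator ?B x *\<^sub>R ?h x)"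
    unfolding torus_eq_density[OF finite_lessThan, symmetric] using h B by (intro integral_density) auto
  then show ?thesis by (simp add: mahler_def set_lebesgue_integral_def circ_eq_exp)
qed

lemma laurent_eval_of_poly: "laurent_eval 1 (laurent_of_poly f) x = poly f (x 0)"
proof -
  have "laurent_eval 1 (laurent_of_poly f) x = (\<Sum>j\<le>degree f. coeff f j * (\<Prod>i<1::nat. x i powi Poly_Mapping.lookup (Poly_Mapping.single 0 (int j)) i))"
    by (simp only: laurent_of_poly_def laurent_eval_sum laurent_eval_single)
  also have "\<dots> = (\<Sum>j\<le>degree f. coeff f j * x 0 ^ j)"
  proof (rule sum.cong[OF refl])
    fix j
    have I: "{..<1::nat} = {0}" by auto
    have "(\<Prod>i<1::nat. x i powi Poly_Mapping.lookup (Poly_Mapping.single 0 (int j)) i) = x 0 ^ j"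
      unfolding I by (simp only: prod.insert finite.emptyI empty_iff not_False_eq_True prod.empty mult_1_right
          lookup_single_eq power_int_of_nat)
    then show "coeff f j * (\<Prod>i<1::nat. x i powi Poly_Mapping.lookup (Poly_Mapping.single 0 (int j)) i) = coeff f j * x 0 ^ j"
      by (simp only:)
  qed
  finally show ?thesis by (simp add: poly_altdef)
qed

text \<open>Jensen's formula for every root. Off a finite set of points of the circle the logarithm of the product is the
  sum of the logarithms.\<close>

lemma mahler_of_linear_factors:
  assumes S: "finite S"
  shows "mahler 1 (laurent_of_poly (\<Prod>a\<in>S. [:- a, 1:])) = (\<Sum>a\<in>S. lnp (cmod a))"
proof -
  let ?P = "\<Prod>a\<in>S. [:- a, 1:]"
  have ev: "laurent_eval 1 (laurent_of_poly ?P) x = (\<Prod>a\<in>S. x 0 - a)" for x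
    unfolding laurent_eval_of_poly by (simp add: poly_prod)
  have meas: "(\<lambda>t. ln (cmod (\<Prod>a\<in>S. circ t - a))) \<in> borel_measurable borel" by measurable
  have I: "{..<1::nat} = {0}" by auto
  have m0: "(\<lambda>\<theta>. \<theta> 0) \<in> measurable (PiM {..<1::nat} (\<lambda>_. circle)) borel"
    using measurable_component_singleton[of 0 "{..<1::nat}" "\<lambda>_. circle"] by simp
  have "mahler 1 (laurent_of_poly ?P)
      = integral\<^sup>L (PiM {..<1} (\<lambda>_. circle)) (\<lambda>\<theta>. ln (cmod (laurent_eval 1 (laurent_of_poly ?P) (\<lambda>i. circ (\<theta> i)))))"
    by (rule mahler_eq_torus_integral) (unfold ev, rule measurable_compose[OF m0 meas])
  also have "\<dots> = integral\<^sup>L (PiM {0::nat} (\<lambda>_. circle)) (\<lambda>\<theta>. (\<lambda>t. ln (cmod (\<Prod>a\<in>S. circ t - a))) (\<theta> 0))"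
    unfolding ev I ..
  also have "\<dots> = integral\<^sup>L circle (\<lambda>t. ln (cmod (\<Prod>a\<in>S. circ t - a)))"
    by (rule circle_product.product_integral_singleton) (use meas in simp)
  also have "\<dots> = integral\<^sup>L circle (\<lambda>t. \<Sum>a\<in>S. ln (cmod (circ t - a)))"
  proof (rule integral_cong_AE)
    have "AE t in circle. \<forall>a\<in>S. circ t \<noteq> a" using S AE_circ_neq by (intro AE_finite_allI) auto
    then show "AE t in circle. ln (cmod (\<Prod>a\<in>S. circ t - a)) = (\<Sum>a\<in>S. ln (cmod (circ t - a)))"
    proof eventually_elim
      case (elim t)
      show ?case using S elim by (simp add: ln_prod flip: prod_norm)
    qed
  qed (use meas in simp_all)
  also have "\<dots> = (\<Sum>a\<in>S. integral\<^sup>L circle (\<lambda>t. ln (cmod (circ t - a))))"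
    by (intro Bochner_Integration.integral_sum integrable_ln_circ)
  also have "\<dots> = (\<Sum>a\<in>S. lnp (cmod a))" by (simp add: jensen_formula flip: jensen_def)
  finally show ?thesis .
qed

lemma nn_integral_abs_ln_circ:
  "(\<integral>\<^sup>+t. ennreal \<bar>ln (cmod (circ t + a))\<bar> \<partial>circle) \<le> ennreal (2 * lnp (1 + cmod a))"
proof -
  have i: "integrable circle (\<lambda>t. ln (cmod (circ t + a)))" using integrable_ln_circ[of "- a"] by simp
  have "\<bar>ln (cmod (circ t + a))\<bar> \<le> 2 * lnp (1 + cmod a) - ln (cmod (circ t + a))" for t
  proof -
    have "lnp (cmod (circ t + a)) \<le> lnp (1 + cmod a)"
      using norm_triangle_ineq[of "circ t" a] by (intro lnp_mono) simp
    then show ?thesis by (simp add: abs_ln_eq)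
  qed
  then have "integral\<^sup>L circle (\<lambda>t. \<bar>ln (cmod (circ t + a))\<bar>)
      \<le> integral\<^sup>L circle (\<lambda>t. 2 * lnp (1 + cmod a) - ln (cmod (circ t + a)))"
    using i by (intro integral_mono) auto
  also have "\<dots> = 2 * lnp (1 + cmod a) - jensen (- a)" using i circle.prob_space by (simp add: jensen_def)
  also have "\<dots> \<le> 2 * lnp (1 + cmod a)" using lnp_nonneg by (simp add: jensen_formula)
  finally show ?thesis using i by (subst nn_integral_eq_integral) (auto intro: ennreal_leI)
qed

text \<open>Jensen's formula in one variable integrates \<open>x\<^sub>0\<close> out. Fubini's theorem applies because the integral
  of \<open>\<bar>log \<bar>x\<^sub>0 + a\<bar>\<bar>\<close> over \<open>x\<^sub>0\<close> is bounded for bounded \<open>a\<close>.\<close>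

lemma integral_torus_eliminate:
  fixes G :: "(nat \<Rightarrow> real) \<Rightarrow> complex"
  assumes I: "finite I" "i \<notin> I"
    and G: "G \<in> borel_measurable (PiM (insert i I) (\<lambda>_. circle))"
    and bound: "\<And>x. cmod (G x) \<le> B" and upd: "\<And>x y. G (x(i := y)) = G x"
  shows "integral\<^sup>L (PiM (insert i I) (\<lambda>_. circle)) (\<lambda>x. ln (cmod (circ (x i) + G x)))
    = integral\<^sup>L (PiM I (\<lambda>_. circle)) (\<lambda>x. lnp (cmod (G x)))"
proof -
  let ?h = "\<lambda>x. ln (cmod (circ (x i) + G x))"
  have mi: "(\<lambda>x. x i) \<in> measurable (PiM (insert i I) (\<lambda>_. circle)) borel"
    using measurable_component_singleton[of i "insert i I" "\<lambda>_. circle"] by simp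
  have mc: "(\<lambda>x. circ (x i)) \<in> borel_measurable (PiM (insert i I) (\<lambda>_. circle))"
    by (rule measurable_compose[OF mi measurable_circ])
  have h: "?h \<in> borel_measurable (PiM (insert i I) (\<lambda>_. circle))" using G mc by measurable
  have "(\<integral>\<^sup>+x. ennreal (norm (?h x)) \<partial>PiM (insert i I) (\<lambda>_. circle))
      = (\<integral>\<^sup>+x. (\<integral>\<^sup>+y. ennreal (norm (?h (x(i := y)))) \<partial>circle) \<partial>PiM I (\<lambda>_. circle))"
    by (rule circle_product.product_nn_integral_insert[OF I measurable_compose[OF h]]) measurable
  also have "\<dots> \<le> (\<integral>\<^sup>+x. ennreal (2 * lnp (1 + B)) \<partial>PiM I (\<lambda>_. circle))"
  proof (rule nn_integral_mono)
    fix x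
    have "(\<integral>\<^sup>+y. ennreal (norm (?h (x(i := y)))) \<partial>circle) = (\<integral>\<^sup>+y. ennreal \<bar>ln (cmod (circ y + G x))\<bar> \<partial>circle)"
      by (simp add: upd)
    also have "\<dots> \<le> ennreal (2 * lnp (1 + cmod (G x)))" by (rule nn_integral_abs_ln_circ)
    also have "\<dots> \<le> ennreal (2 * lnp (1 + B))" using bound[of x] by (intro ennreal_leI mult_left_mono lnp_mono) auto
    finally show "(\<integral>\<^sup>+y. ennreal (norm (?h (x(i := y)))) \<partial>circle) \<le> ennreal (2 * lnp (1 + B))" .
  qed
  also have "\<dots> < \<infinity>" using emeasure_torus_space[OF I(1)] by simp
  finally have int: "integrable (PiM (insert i I) (\<lambda>_. circle)) ?h" using h by (intro integrableI_bounded) auto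
  have "integral\<^sup>L (PiM (insert i I) (\<lambda>_. circle)) ?h
      = integral\<^sup>L (PiM I (\<lambda>_. circle)) (\<lambda>x. integral\<^sup>L circle (\<lambda>y. ?h (x(i := y))))"
    by (rule circle_product.product_integral_insert[OF I int])
  also have "(\<lambda>x. integral\<^sup>L circle (\<lambda>y. ?h (x(i := y)))) = (\<lambda>x. lnp (cmod (G x)))"
  proof
    fix x
    have "integral\<^sup>L circle (\<lambda>y. ?h (x(i := y))) = jensen (- G x)" by (simp add: upd jensen_def)
    then show "integral\<^sup>L circle (\<lambda>y. ?h (x(i := y))) = lnp (cmod (G x))" by (simp add: jensen_formula)
  qed
  finally show ?thesis .
qed

section \<open>The minimal polynomial of a Gaussian period\<close>

lemma rpoly_pcompose: "rpoly (pcompose q r) w = rpoly q (rpoly r w)"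
  by (induct q) (simp_all add: pcompose_pCons rpoly_simps rpoly_pCons)

text \<open>A monic rational polynomial of least degree with root \<open>a\<close> is irreducible and divides all others, so
  it is the only one that the definite description can mean.\<close>

lemma min_poly_props:
  assumes Q: "Q \<noteq> 0" "rpoly Q a = 0"
  shows "lead_coeff (min_poly a) = 1" "rpoly (min_poly a) a = 0" "\<And>q. rpoly q a = 0 \<Longrightarrow> min_poly a dvd q"
proof -
  let ?P = "\<lambda>q. q \<noteq> 0 \<and> rpoly q a = 0"
  obtain m0 where m0: "m0 \<noteq> 0" "rpoly m0 a = 0" and min0: "\<And>q. ?P q \<Longrightarrow> degree m0 \<le> degree q"
    using ex_has_least_nat[of ?P Q degree] Q by blast
  define m where "m = smult (inverse (lead_coeff m0)) m0"
  have c: "inverse (lead_coeff m0) \<noteq> 0" using m0 by simp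
  have monic: "lead_coeff m = 1" using m0 by (simp add: m_def)
  have ma: "rpoly m a = 0" using m0 by (simp add: m_def rpoly_simps)
  have deg: "degree m = degree m0" using c by (simp add: m_def)
  have dvd: "m dvd q" if q: "rpoly q a = 0" for q
  proof -
    have m_nz: "m \<noteq> 0" using monic by auto
    have "rpoly (q div m * m + q mod m) a = 0" using q by simp
    then have "rpoly (q mod m) a = 0" by (simp only: rpoly_simps ma mult_zero_right add_0_left)
    moreover have "q mod m = 0 \<or> degree (q mod m) < degree m" using degree_mod_less[OF m_nz] .
    ultimately have "q mod m = 0" using min0[of "q mod m"] deg by linarith
    then show ?thesis by (rule mod_0_imp_dvd)
  qed
  have deg_pos: "degree m > 0"
  proof (rule ccontr)
    assume "\<not> degree m > 0"
    then obtain b where "m = [:b:]" by (metis degree_eq_zeroE not_gr_zero)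
    then have "m = [:1:]" using monic by simp
    then show False using ma by (simp only: rpoly_simps) simp
  qed
  have irr: "irreducible m"
  proof (rule Factorial_Ring.irreducibleI)
    show "m \<noteq> 0" using monic by auto
    show "\<not> is_unit m" using deg_pos monic is_unit_iff_degree[of m] by (cases "m = 0") auto
    fix b c assume bc: "m = b * c"
    have nz: "b \<noteq> 0" "c \<noteq> 0" using bc monic by auto
    have dbc: "degree m = degree b + degree c" using nz by (simp add: bc degree_mult_eq)
    have "rpoly b a * rpoly c a = 0" using ma unfolding bc rpoly_simps .
    then consider "rpoly b a = 0" | "rpoly c a = 0" by auto
    then show "b dvd 1 \<or> c dvd 1"
    proof cases
      case 1
      then have "degree m \<le> degree b" using min0[of b] nz deg by simp
      then have "degree c = 0" using dbc by simp
      then show ?thesis using nz is_unit_iff_degree by blast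
    next
      case 2
      then have "degree m \<le> degree c" using min0[of c] nz deg by simp
      then have "degree b = 0" using dbc by simp
      then show ?thesis using nz is_unit_iff_degree by blast
    qed
  qed
  have "min_poly a = m"
    unfolding min_poly_def
  proof (rule the_equality)
    show "lead_coeff m = 1 \<and> irreducible m \<and> rpoly m a = 0" using monic irr ma by simp
    fix q assume q: "lead_coeff q = 1 \<and> irreducible q \<and> rpoly q a = 0"
    then have "m dvd q" using dvd by simp
    then obtain c where c: "q = m * c" by blast
    have "\<not> is_unit m" using irr by (simp add: Factorial_Ring.irreducible_def)
    then have "is_unit c" using q c Factorial_Ring.irreducibleD[of q m c] by blast
    then obtain b where b: "c = [:b:]" by (metis is_unit_polyE)
    have "lead_coeff q = lead_coeff m * lead_coeff c" unfolding c by (rule lead_coeff_mult)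
    then have "b = 1" using q monic b by simp
    then show "q = m" using c b by (simp flip: one_pCons)
  qed
  then show "lead_coeff (min_poly a) = 1" "rpoly (min_poly a) a = 0" "\<And>q. rpoly q a = 0 \<Longrightarrow> min_poly a dvd q"
    using monic ma dvd by simp_all
qed

context
  fixes p :: nat and z :: complex and g k :: nat
  assumes p: "prime p" and z: "primitive_root_of_unity p z" and g: "ord p g = k" and k: "k > 0"
begin

definition period :: "complex \<Rightarrow> complex" where
  "period u = (\<Sum>i<k. u ^ (g ^ i))"

definition period_poly :: "rat poly" where
  "period_poly = (\<Sum>i<k. monom 1 (g ^ i))"

definition prim_roots :: "complex set" where
  "prim_roots = {u. primitive_root_of_unity p u}"

lemma rpoly_sum: "rpoly (\<Sum>i\<in>I. q i) w = (\<Sum>i\<in>I. rpoly (q i) w)"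
  by (induct I rule: infinite_finite_induct) (simp_all add: rpoly_simps)

lemma rpoly_period_poly: "rpoly period_poly u = period u"
  by (simp add: period_poly_def period_def rpoly_sum rpoly_simps)

lemma g_not_dvd: "\<not> p dvd g"
proof -
  have "coprime p g" using g k ord_gt_0_iff[of p g] by simp
  then show ?thesis using p by (metis coprime_absorb_left not_prime_unit)
qed

lemma prim_roots_eq: "prim_roots = (\<lambda>c. z ^ c) ` {1..<p}"
proof -
  have cop: "coprime c p \<longleftrightarrow> c \<noteq> 0" if "c < p" for c
  proof
    assume "coprime c p"
    then show "c \<noteq> 0" using prime_gt_1_nat[OF p] by (metis coprime_0_left_iff less_irrefl nat_dvd_1_iff_1)
  next
    assume "c \<noteq> 0"
    then have "\<not> p dvd c" using that by (auto dest: dvd_imp_le)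
    then show "coprime c p" using p prime_imp_coprime coprime_commute by blast
  qed
  show ?thesis
  proof (intro equalityI subsetI)
    fix u assume "u \<in> prim_roots"
    then have u: "primitive_root_of_unity p u" by (simp add: prim_roots_def)
    have "u ^ p = 1" using primitive_root_power[OF u] .
    then obtain c where c: "c < p" "u = z ^ c" by (rule primitive_root_obtain_power[OF z])
    then have "c \<noteq> 0" using u cop primitive_root_power_primitive_iff[OF z] by simp
    then show "u \<in> (\<lambda>c. z ^ c) ` {1..<p}" using c by auto
  next
    fix u assume "u \<in> (\<lambda>c. z ^ c) ` {1..<p}"
    then obtain c where c: "1 \<le> c" "c < p" "u = z ^ c" by auto
    then show "u \<in> prim_roots" using cop[of c] primitive_root_power_primitive_iff[OF z] by (simp add: prim_roots_def)
  qed
qed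

lemma inj_powers: "inj_on (\<lambda>c. z ^ c) {1..<p}"
  by (rule inj_on_subset[OF primitive_root_inj[OF z]]) auto

lemma card_prim_roots: "card prim_roots = p - 1" and finite_prim_roots: "finite prim_roots"
  using inj_powers by (simp_all add: prim_roots_eq card_image)

lemma all_roots: "{u::complex. u ^ p = 1} = insert 1 prim_roots" and one_notin_prim_roots: "1 \<notin> prim_roots"
proof -
  have "{u::complex. u ^ p = 1} = (\<lambda>c. z ^ c) ` {..<p}" by (rule roots_of_unity_eq_powers[OF z])
  also have "{..<p} = insert 0 {1..<p}" using prime_gt_0_nat[OF p] by auto
  finally show "{u::complex. u ^ p = 1} = insert 1 prim_roots" by (simp add: prim_roots_eq)
  show "1 \<notin> prim_roots"
  proof
    assume "1 \<in> prim_roots"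
    then have u: "primitive_root_of_unity p 1" by (simp add: prim_roots_def)
    show False using primitive_root_power_eq_1_iff[OF u, of 1] prime_gt_1_nat[OF p] by simp
  qed
qed

lemma root_prim_roots: "u \<in> prim_roots \<Longrightarrow> v \<in> prim_roots \<Longrightarrow> rpoly q u = 0 \<Longrightarrow> rpoly q v = 0"
  unfolding prim_roots_def by (auto intro: rat_poly_root_primitive)

lemma prim_roots_power: "u \<in> prim_roots \<Longrightarrow> \<not> p dvd a \<Longrightarrow> u ^ a \<in> prim_roots"
  using p by (auto simp: prim_roots_def primitive_root_power_primitive_iff coprime_commute[of a] prime_imp_coprime)

text \<open>The sum of the \<open>j\<close>-th powers of the primitive \<open>p\<close>-th roots of unity is \<open>p - 1\<close> or \<open>-1\<close>.\<close>

lemma sum_prim_roots_rational: "(\<Sum>u\<in>prim_roots. rpoly q u) \<in> \<rat>"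
proof -
  have pow: "(\<Sum>u\<in>prim_roots. u ^ j) \<in> \<rat>" for j
  proof -
    have "(\<Sum>u\<in>insert 1 prim_roots. u ^ j) = (\<Sum>u\<in>prim_roots. u ^ j) + 1" using one_notin_prim_roots finite_prim_roots by simp
    then have trace: "(\<Sum>u\<in>prim_roots. u ^ j) + 1 = (if p dvd j then of_nat p else 0)"
      using primitive_root_sum_powers[OF z, of j] unfolding all_roots by (simp only:)
    have "(\<Sum>u\<in>prim_roots. u ^ j) + 1 \<in> \<rat>" unfolding trace by simp
    then have "((\<Sum>u\<in>prim_roots. u ^ j) + 1) - 1 \<in> \<rat>" by (intro Rats_diff) auto
    then show ?thesis by simp
  qed
  have "(\<Sum>u\<in>prim_roots. rpoly q u) = (\<Sum>u\<in>prim_roots. \<Sum>i\<le>degree (map_poly of_rat q :: complex poly). coeff (map_poly of_rat q) i * u ^ i)"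
    by (simp add: poly_altdef)
  also have "\<dots> = (\<Sum>i\<le>degree (map_poly of_rat q :: complex poly). of_rat (coeff q i) * (\<Sum>u\<in>prim_roots. u ^ i))"
    by (subst sum.swap) (simp add: sum_distrib_left coeff_map_poly)
  also have "\<dots> \<in> \<rat>"
  proof -
    have "(\<Sum>i\<in>I. of_rat (coeff q i) * (\<Sum>u\<in>prim_roots. u ^ i)) \<in> \<rat>" for I
    proof (induct I rule: infinite_finite_induct)
      case (insert i I)
      show ?case unfolding sum.insert[OF insert(1,2)] by (intro Rats_add Rats_mult Rats_of_rat pow insert(3))
    qed simp_all
    then show ?thesis .
  qed
  finally show ?thesis .
qed

text \<open>Each coefficient is a rational polynomial expression in \<open>u\<close> which takes the same value at all
  conjugates of \<open>u\<close>, as these merely permute the factors. So its value is its trace divided by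
  \<open>p - 1\<close>.\<close>

lemma conjugate_product_rational:
  obtains Q where "map_poly of_rat Q = (\<Prod>u\<in>prim_roots. [:- period u, 1:])"
proof -
  \<comment> \<open>The product with the root of unity replaced by an indeterminate.\<close>
  define B :: "rat poly poly" where "B = (\<Prod>c\<in>{1..<p}. [:- pcompose period_poly (monom 1 c), 1:])"
  have ev_mult: "map_poly (\<lambda>q. rpoly q u) (b * b') = map_poly (\<lambda>q. rpoly q u) b * map_poly (\<lambda>q. rpoly q u) b'" for u b b'
    by (rule map_poly_hom_mult) (simp_all add: rpoly_simps)
  have neg: "rpoly (- q) u = - rpoly q u" for q u
    using rpoly_simps(3)[of 0 q u] by simp
  have evB: "map_poly (\<lambda>q. rpoly q u) B = (\<Prod>v\<in>prim_roots. [:- period v, 1:])" if u: "u \<in> prim_roots" for u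
  proof -
    have pu: "primitive_root_of_unity p u" using u by (simp add: prim_roots_def)
    have "map_poly (\<lambda>q. rpoly q u) (\<Prod>c\<in>C. [:- pcompose period_poly (monom 1 c), 1:]) = (\<Prod>c\<in>C. [:- period (u ^ c), 1:])"
      for C :: "nat set"
    proof (induct C rule: infinite_finite_induct)
      case (insert c C)
      have lin: "map_poly (\<lambda>q. rpoly q u) [:- pcompose period_poly (monom 1 c), 1:] = [:- period (u ^ c), 1:]"
        by (simp add: map_poly_pCons neg rpoly_pcompose rpoly_period_poly rpoly_simps)
      show ?case by (simp only: prod.insert[OF insert(1,2)] ev_mult insert(3) lin)
    qed simp_all
    then have "map_poly (\<lambda>q. rpoly q u) B = (\<Prod>c\<in>{1..<p}. [:- period (u ^ c), 1:])" by (simp only: B_def)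
    also have "\<dots> = (\<Prod>v\<in>(\<lambda>c. u ^ c) ` {1..<p}. [:- period v, 1:])"
    proof (subst prod.reindex)
      show "inj_on (\<lambda>c. u ^ c) {1..<p}" by (rule inj_on_subset[OF primitive_root_inj[OF pu]]) auto
    qed simp
    also have "(\<lambda>c. u ^ c) ` {1..<p} = prim_roots"
    proof (rule card_seteq)
      show "(\<lambda>c. u ^ c) ` {1..<p} \<subseteq> prim_roots" using u by (auto intro!: prim_roots_power dest: dvd_imp_le)
      have "card ((\<lambda>c. u ^ c) ` {1..<p}) = p - 1"
        by (subst card_image[OF inj_on_subset[OF primitive_root_inj[OF pu]]]) auto
      then show "card prim_roots \<le> card ((\<lambda>c. u ^ c) ` {1..<p})" by (simp add: card_prim_roots)
    qed (rule finite_prim_roots)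
    finally show ?thesis .
  qed
  let ?G = "\<Prod>v\<in>prim_roots. [:- period v, 1:]"
  have rat: "coeff ?G n \<in> \<rat>" for n
  proof -
    have "rpoly (coeff B n) u = coeff ?G n" if "u \<in> prim_roots" for u
      using arg_cong[OF evB[OF that], of "\<lambda>q. coeff q n"] by (simp add: coeff_map_poly)
    then have "(\<Sum>u\<in>prim_roots. rpoly (coeff B n) u) = of_nat (p - 1) * coeff ?G n" by (simp add: card_prim_roots)
    then have "of_nat (p - 1) * coeff ?G n \<in> \<rat>" using sum_prim_roots_rational[of "coeff B n"] by simp
    then have "of_nat (p - 1) * coeff ?G n / of_nat (p - 1) \<in> \<rat>" by (intro Rats_divide) auto
    then show ?thesis using prime_gt_1_nat[OF p] by simp
  qed
  define Q where "Q = map_poly (\<lambda>x. THE r. x = of_rat r) ?G"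
  have "map_poly of_rat Q = ?G"
  proof (rule poly_eqI)
    fix n
    obtain r where r: "coeff ?G n = of_rat r" using rat[of n] by (rule Rats_cases)
    have "(THE r'. coeff ?G n = of_rat r') = r" using r by (intro the_equality) auto
    moreover have "(THE r. (0::complex) = of_rat r) = 0" by (intro the_equality) auto
    ultimately have "coeff Q n = r" unfolding Q_def by (subst coeff_map_poly) simp_all
    then show "coeff (map_poly of_rat Q) n = coeff ?G n" by (simp add: coeff_map_poly r)
  qed
  then show ?thesis by (rule that)
qed

text \<open>Two of the conjugates coincide only if they obviously do, since the powers \<open>u, \<dots>, u\<^sup>p\<^sup>-\<^sup>1\<close> are linearly
  independent: a relation with integer coefficients is a constant multiple of \<open>\<Phi>\<^sub>p\<close>, without constant
  term.\<close>

lemma period_eq_imp: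
  assumes u: "u \<in> prim_roots" and v: "v \<in> prim_roots" and eq: "period u = period v"
  obtains i where "i < k" "u = v ^ (g ^ i)"
proof -
  have pu: "primitive_root_of_unity p u" using u by (simp add: prim_roots_def)
  have "v ^ p = 1" using v by (auto simp: prim_roots_def primitive_root_power)
  then obtain h where h: "h < p" "v = u ^ h" by (rule primitive_root_obtain_power[OF pu])
  have hp: "\<not> p dvd h"
  proof
    assume "p dvd h"
    then have "v = 1" using h primitive_root_power_eq_1_iff[OF pu] by simp
    then show False using v one_notin_prim_roots by simp
  qed
  obtain f where monic: "lead_coeff f = 1" and deg: "degree f = totient p"
    and root: "\<And>u. ipoly f u = (0::complex) \<longleftrightarrow> primitive_root_of_unity p u"
    and dvd: "\<And>u g. primitive_root_of_unity p u \<Longrightarrow> ipoly g u = (0::complex) \<longleftrightarrow> f dvd g"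
    by (rule cyclotomic_polynomial[OF z]) (rule that)
  define D :: "int poly" where "D = (\<Sum>i<k. monom 1 (g ^ i mod p)) - (\<Sum>i<k. monom 1 (h * g ^ i mod p))"
  have ipoly_sum: "ipoly (\<Sum>i\<in>I. q i) w = (\<Sum>i\<in>I. ipoly (q i) w)" for I :: "nat set" and q and w :: complex
    by (induct I rule: infinite_finite_induct) (simp_all add: of_int_poly_add)
  have "ipoly D u = period u - period v"
    by (simp add: D_def of_int_poly_diff ipoly_sum ipoly_monom primitive_root_power_mod[OF pu] period_def h(2) power_mult)
  then have "f dvd D" using dvd[OF pu] eq by simp
  then obtain C where C: "D = f * C" by blast
  have c0: "coeff (monom 1 (a mod p)) 0 = (0::int)" if "\<not> p dvd a" for a
    using that by (simp add: dvd_eq_mod_eq_0)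
  have gi: "\<not> p dvd g ^ i" "\<not> p dvd h * g ^ i" for i
    using g_not_dvd hp p by (simp_all add: prime_dvd_mult_iff prime_dvd_power_iff) (metis prime_dvd_power)+
  have D0: "coeff D 0 = 0" unfolding D_def coeff_diff coeff_sum using c0[OF gi(1)] c0[OF gi(2)] by simp
  have "D = 0"
  proof (rule ccontr)
    assume "D \<noteq> 0"
    then have "C \<noteq> 0" "f \<noteq> 0" using C by auto
    then have "degree D = (p - 1) + degree C" using deg p by (simp add: C degree_mult_eq totient_prime)
    moreover have "degree D \<le> p - 1"
    proof -
      have "degree (monom 1 (a mod p) :: int poly) \<le> p - 1" for a
        unfolding degree_monom_eq[OF one_neq_zero] using mod_less_divisor[OF prime_gt_0_nat[OF p], of a] by linarith
      then show ?thesis unfolding D_def by (intro degree_diff_le degree_sum_le) auto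
    qed
    ultimately have "degree C = 0" by simp
    then obtain c where c: "C = [:c:]" by (rule degree_eq_zeroE)
    then have "D = smult c f" by (simp add: C)
    then have "coeff f 0 * c = 0" using D0 by auto
    moreover have "coeff f 0 \<noteq> 0"
    proof
      assume "coeff f 0 = 0"
      then have "ipoly f 0 = (0::complex)" by (simp add: poly_0_coeff_0 coeff_map_poly)
      then have "primitive_root_of_unity p 0" by (simp add: root)
      then show False using primitive_root_nonzero by blast
    qed
    ultimately show False using c \<open>C \<noteq> 0\<close> by simp
  qed
  then have "coeff (\<Sum>i<k. monom 1 (g ^ i mod p)) 1 = (coeff (\<Sum>i<k. monom 1 (h * g ^ i mod p)) 1 :: int)"
    by (simp add: D_def)
  then have eq1: "(\<Sum>i<k. if g ^ i mod p = 1 then 1 else 0) = (\<Sum>i<k. if h * g ^ i mod p = 1 then 1 else (0::int))"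
    by (simp add: coeff_sum)
  \<comment> \<open>The term \<open>X\<close> occurs in the first sum, for \<open>i = 0\<close>, hence also in the second.\<close>
  have "(if g ^ 0 mod p = 1 then 1 else 0) \<le> (\<Sum>i<k. if g ^ i mod p = 1 then 1 else (0::int))"
    using k by (intro member_le_sum[where f = "\<lambda>i. if g ^ i mod p = 1 then 1 else 0"]) auto
  then have "(\<Sum>i<k. if h * g ^ i mod p = 1 then 1 else (0::int)) \<noteq> 0" using eq1 prime_gt_1_nat[OF p] by simp
  then obtain i where "i \<in> {..<k}" "(if h * g ^ i mod p = 1 then 1 else (0::int)) \<noteq> 0"
    by (rule sum.not_neutral_contains_not_neutral)
  then have i: "i < k" "h * g ^ i mod p = 1" by (auto split: if_splits)
  have "v ^ (g ^ i) = u ^ (h * g ^ i)" by (simp add: h(2) power_mult)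
  also have "\<dots> = u ^ (h * g ^ i mod p)" by (rule primitive_root_power_mod[OF pu, symmetric])
  finally show ?thesis using that i by simp
qed

lemma cong_g_mod: "[g ^ i = g ^ (i mod k)] (mod p)"
proof -
  have "[g ^ (k * (i div k)) = 1] (mod p)" using ord_divides[of g "k * (i div k)" p] g by simp
  then have "[g ^ (k * (i div k)) * g ^ (i mod k) = 1 * g ^ (i mod k)] (mod p)" by (rule cong_mult) simp
  moreover have "g ^ (k * (i div k)) * g ^ (i mod k) = g ^ i" by (simp flip: power_add)
  ultimately show ?thesis by simp
qed

lemma prim_roots_power_g:
  assumes u: "u \<in> prim_roots"
  shows "u ^ (g ^ i) = u ^ (g ^ (i mod k))"
proof -
  have pu: "primitive_root_of_unity p u" using u by (simp add: prim_roots_def)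
  show ?thesis using cong_g_mod primitive_root_power_eq_iff[OF pu] by blast
qed

lemma period_power_g:
  assumes u: "u \<in> prim_roots"
  shows "period (u ^ (g ^ i)) = period u"
proof (induct i)
  case (Suc i)
  let ?v = "u ^ (g ^ i)"
  have v: "?v \<in> prim_roots" using prim_roots_power[OF u] g_not_dvd p prime_dvd_power by blast
  have "u ^ (g ^ Suc i) = ?v ^ g" by (simp add: mult.commute flip: power_mult)
  then have "period (u ^ (g ^ Suc i)) = (\<Sum>j<k. ?v ^ (g ^ Suc j))"
    by (simp add: period_def mult_ac flip: power_mult)
  also have "\<dots> = (\<Sum>j<Suc k. ?v ^ (g ^ j)) - ?v ^ (g ^ 0)"
    by (simp add: sum.lessThan_Suc_shift del: sum.lessThan_Suc)
  also have "\<dots> = period ?v + ?v ^ (g ^ k) - ?v ^ (g ^ 0)" by (simp add: period_def)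
  also have "?v ^ (g ^ k) = ?v ^ (g ^ 0)" using prim_roots_power_g[OF v, of k] by simp
  finally show ?case using Suc by simp
qed simp

lemma fibre:
  assumes u: "u \<in> prim_roots"
  shows "card {v\<in>prim_roots. period v = period u} = k"
proof -
  have pu: "primitive_root_of_unity p u" using u by (simp add: prim_roots_def)
  have "{v\<in>prim_roots. period v = period u} = (\<lambda>i. u ^ (g ^ i)) ` {..<k}"
  proof (intro equalityI subsetI)
    fix v assume "v \<in> {v\<in>prim_roots. period v = period u}"
    then show "v \<in> (\<lambda>i. u ^ (g ^ i)) ` {..<k}" using period_eq_imp[of v u] u by auto
  next
    fix v assume "v \<in> (\<lambda>i. u ^ (g ^ i)) ` {..<k}"
    then obtain i where "v = u ^ (g ^ i)" by blast
    then show "v \<in> {v\<in>prim_roots. period v = period u}"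
      using period_power_g[OF u] prim_roots_power[OF u] g_not_dvd p prime_dvd_power by blast
  qed
  moreover have "inj_on (\<lambda>i. u ^ (g ^ i)) {..<k}"
  proof (rule inj_onI)
    fix i j assume ij: "i \<in> {..<k}" "j \<in> {..<k}" "u ^ (g ^ i) = u ^ (g ^ j)"
    then have "g ^ i mod p = g ^ j mod p" by (simp add: primitive_root_power_eq_iff[OF pu] cong_def)
    moreover have "coprime p g" using g k ord_gt_0_iff[of p g] by simp
    ultimately show "i = j" using inj_power_mod[of p g] ij g by (auto simp: inj_on_def)
  qed
  ultimately show ?thesis by (simp add: card_image)
qed

text \<open>The conjugates of the period are roots of its minimal polynomial, since an automorphism carries one to the
  other, and there are no further ones because that polynomial divides the product over all conjugates. A double
  root would, by conjugation, make the period a root of the derivative.\<close>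

lemma min_poly_period:
  shows "map_poly of_rat (min_poly (period z)) = (\<Prod>a\<in>period ` prim_roots. [:- a, 1:])"
proof -
  have z_prim: "z \<in> prim_roots" using z by (simp add: prim_roots_def)
  obtain Q where Q: "map_poly of_rat Q = (\<Prod>u\<in>prim_roots. [:- period u, 1:])" by (rule conjugate_product_rational)
  have Qroot: "rpoly Q w = 0 \<longleftrightarrow> w \<in> period ` prim_roots" for w
    unfolding Q using finite_prim_roots by (auto simp: poly_prod)
  have "Q \<noteq> 0"
  proof
    assume "Q = 0"
    then have "(\<Prod>u\<in>prim_roots. [:- period u, 1:]) = 0" using Q by simp
    then show False using finite_prim_roots by (simp add: prod_zero_iff)
  qed
  moreover have "rpoly Q (period z) = 0" using Qroot z_prim by blast
  ultimately have m: "lead_coeff (min_poly (period z)) = 1" "rpoly (min_poly (period z)) (period z) = 0"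
    "\<And>q. rpoly q (period z) = 0 \<Longrightarrow> min_poly (period z) dvd q" by (rule min_poly_props)+
  let ?m = "min_poly (period z)"
  let ?M = "map_poly of_rat ?m :: complex poly"
  have conj: "rpoly q (period v) = 0" if "rpoly q (period u) = 0" "u \<in> prim_roots" "v \<in> prim_roots" for q u v
  proof -
    have "rpoly (pcompose q period_poly) u = 0" using that by (simp add: rpoly_pcompose rpoly_period_poly)
    then have "rpoly (pcompose q period_poly) v = 0" using root_prim_roots that by blast
    then show ?thesis by (simp add: rpoly_pcompose rpoly_period_poly)
  qed
  have roots: "{w. poly ?M w = 0} = period ` prim_roots"
  proof (intro equalityI subsetI)
    fix w assume w: "w \<in> {w. poly ?M w = 0}"
    have "?m dvd Q" using m(3) Qroot z_prim by blast
    then obtain c where c: "Q = ?m * c" by blast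
    have "rpoly Q w = 0" unfolding c rpoly_simps using w by simp
    then show "w \<in> period ` prim_roots" using Qroot by blast
  next
    fix w assume "w \<in> period ` prim_roots"
    then show "w \<in> {w. poly ?M w = 0}" using conj[OF m(2) z_prim] by auto
  qed
  have dM: "degree ?M = degree ?m" by (rule degree_map_poly) simp
  have sq: "rsquarefree ?M"
    unfolding rsquarefree_roots
  proof (intro allI notI, elim conjE)
    fix w assume w: "poly ?M w = 0" "poly (pderiv ?M) w = 0"
    then obtain u where u: "u \<in> prim_roots" "w = period u" using roots by blast
    have pd: "pderiv ?M = map_poly of_rat (pderiv ?m)"
      by (rule poly_eqI) (simp add: coeff_pderiv coeff_map_poly of_rat_mult of_rat_add)
    have "rpoly (pderiv ?m) (period u) = 0" using w(2) unfolding pd u(2) .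
    then have "rpoly (pderiv ?m) (period z) = 0" using conj u z_prim by blast
    then have dvd: "?m dvd pderiv ?m" by (rule m(3))
    have deg: "degree ?m > 0"
    proof (rule ccontr)
      assume "\<not> degree ?m > 0"
      then obtain b where b: "?m = [:b:]" by (metis degree_eq_zeroE not_gr_zero)
      then have "?m = [:1:]" using m(1) by simp
      then show False using m(2) by (simp only: rpoly_simps) simp
    qed
    then have "pderiv ?m \<noteq> 0" by (simp add: pderiv_eq_0_iff)
    then have "degree ?m \<le> degree (pderiv ?m)" using dvd by (rule dvd_imp_degree_le[rotated])
    then show False using deg by (simp add: degree_pderiv)
  qed
  have lead: "lead_coeff ?M = 1" unfolding dM using m(1) by (simp add: coeff_map_poly)
  have "smult (lead_coeff ?M) (\<Prod>w|poly ?M w = 0. [:-w, 1:]) = ?M" by (rule complex_poly_decompose_rsquarefree[OF sq])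
  then show ?thesis unfolding lead roots by simp
qed

lemma sum_conjugates:
  fixes F :: "complex \<Rightarrow> real"
  shows "(\<Sum>u\<in>prim_roots. F (period u)) = k * (\<Sum>a\<in>period ` prim_roots. F a)"
proof -
  have "(\<Sum>u\<in>prim_roots. F (period u)) = (\<Sum>a\<in>period ` prim_roots. \<Sum>u\<in>{u\<in>prim_roots. period u = a}. F (period u))"
    by (rule sum.image_gen[OF finite_prim_roots])
  also have "\<dots> = (\<Sum>a\<in>period ` prim_roots. k * F a)"
  proof (rule sum.cong[OF refl])
    fix a assume "a \<in> period ` prim_roots"
    then obtain u where u: "u \<in> prim_roots" "a = period u" by blast
    have "(\<Sum>v\<in>{v\<in>prim_roots. period v = a}. F (period v)) = (\<Sum>v\<in>{v\<in>prim_roots. period v = a}. F a)" by (rule sum.cong) auto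
    then show "(\<Sum>u\<in>{u\<in>prim_roots. period u = a}. F (period u)) = k * F a" using fibre[OF u(1)] u(2) by simp
  qed
  finally show ?thesis by (simp add: sum_distrib_left)
qed

end

section \<open>The Mahler measure of the cyclovariety\<close>

context cyclotomic
begin

definition rem_monom :: "nat \<Rightarrow> int poly" where
  "rem_monom j = (SOME r. monom 1 j mod F = map_poly of_int r \<and> f dvd monom 1 j - r \<and> degree r < totient k)"

lemma rem_monom:
  "monom 1 j mod F = map_poly of_int (rem_monom j)" "f dvd monom 1 j - rem_monom j" "degree (rem_monom j) < totient k"
  using someI_ex[OF monom_mod_F_int[of j]] unfolding rem_monom_def by blast+

lemma extend_monom_rem: "extend x (monom 1 j) = (\<Sum>i<totient k. of_int (coeff (rem_monom j) i) * x i)"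
  by (simp add: extend_def rem_monom(1) coeff_map_poly)

text \<open>The exponents of the monomial of \<open>F\<^sub>k\<close> that belongs to the \<open>j\<close>-th power of the
  root of unity. The variable \<open>x\<^sub>i\<close> belongs to the coefficient of
  \<open>X\<^sup>i\<^sup>-\<^sup>1\<close>.\<close>

definition exponent_vector :: "nat \<Rightarrow> nat \<Rightarrow>\<^sub>0 int" where
  "exponent_vector j = (\<Sum>i\<in>{1..totient k}. Poly_Mapping.single i (coeff (rem_monom j) (i - 1)))"

lemma lookup_exponent_vector:
  "Poly_Mapping.lookup (exponent_vector j) i = (if i \<in> {1..totient k} then coeff (rem_monom j) (i - 1) else 0)"
  by (simp add: exponent_vector_def lookup_sum lookup_single when_def)

lemma ipoly_low_degree:
  assumes "degree q < totient k"
  shows "ipoly q z = (\<Sum>i=1..totient k. of_int (coeff q (i - 1)) * z ^ (i - 1))"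
proof -
  have "ipoly q z = (\<Sum>i\<le>degree q. of_int (coeff q i) * z ^ i)" by (simp add: poly_altdef coeff_map_poly)
  also have "\<dots> = (\<Sum>i<totient k. of_int (coeff q i) * z ^ i)"
    using assms by (intro sum.mono_neutral_left) (auto simp: coeff_eq_0)
  also have "\<dots> = (\<Sum>i=1..totient k. of_int (coeff q (i - 1)) * z ^ (i - 1))"
    by (rule sum.reindex_bij_witness[of _ "\<lambda>i. i - 1" Suc]) auto
  finally show ?thesis .
qed

text \<open>Coefficient vectors of a \<open>k\<close>-th root of unity are unique because \<open>f\<close> divides the
  difference of two of them, of smaller degree.\<close>

lemma A_set_eq:
  assumes "zeta k = z"
  shows "A_set zeta k = exponent_vector ` {..<k}"
proof (intro equalityI subsetI)
  fix a assume "a \<in> A_set zeta k"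
  then obtain w where a: "Poly_Mapping.keys a \<subseteq> {1..totient k}" and w: "w ^ k = 1"
    "w = (\<Sum>i=1..totient k. of_int (Poly_Mapping.lookup a i) * z ^ (i - 1))"
    unfolding A_set_def assms by blast
  obtain j where j: "j < k" "w = z ^ j" by (rule primitive_root_obtain_power[OF prim w(1)])
  define q :: "int poly" where "q = (\<Sum>i<totient k. monom (Poly_Mapping.lookup a (Suc i)) i)"
  have cq: "coeff q i = (if i < totient k then Poly_Mapping.lookup a (Suc i) else 0)" for i
    by (simp add: q_def coeff_sum)
  have dq: "degree q < totient k"
  proof -
    have "degree q \<le> totient k - 1" by (rule degree_le) (auto simp: cq)
    moreover have "totient k > 0" using k_pos by simp
    ultimately show ?thesis by linarith
  qed
  have "ipoly q z = (\<Sum>i=1..totient k. of_int (Poly_Mapping.lookup a i) * z ^ (i - 1))"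
    unfolding ipoly_low_degree[OF dq] by (intro sum.cong refl) (auto simp: cq)
  then have "ipoly q z = z ^ j" using w(2) j(2) by simp
  then have "ipoly (monom 1 j - q) z = 0" by (simp add: ipoly_simps)
  then have "f dvd monom 1 j - q" using f_dvd[OF prim] by blast
  then have "f dvd (monom 1 j - q) - (monom 1 j - rem_monom j)" using rem_monom(2)[of j] by (rule dvd_diff)
  then have dvd: "f dvd rem_monom j - q" by (simp add: algebra_simps)
  have eq: "rem_monom j = q"
  proof (rule ccontr)
    assume "rem_monom j \<noteq> q"
    then have "degree f \<le> degree (rem_monom j - q)" using dvd by (intro dvd_imp_degree_le) auto
    moreover have "degree (rem_monom j - q) < totient k" by (rule degree_diff_less[OF rem_monom(3) dq])
    ultimately show False using degree_f by simp
  qed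
  have "a = exponent_vector j"
  proof (rule poly_mapping_eqI)
    fix i
    show "Poly_Mapping.lookup a i = Poly_Mapping.lookup (exponent_vector j) i"
    proof (cases "i \<in> {1..totient k}")
      case True
      then have "coeff q (i - 1) = Poly_Mapping.lookup a i" unfolding cq by (cases i) auto
      then show ?thesis unfolding lookup_exponent_vector eq using True by simp
    next
      case False
      then have "Poly_Mapping.lookup a i = 0" using a by (auto simp: in_keys_iff)
      then show ?thesis unfolding lookup_exponent_vector using False by (simp only: if_False)
    qed
  qed
  then show "a \<in> exponent_vector ` {..<k}" using j(1) by blast
next
  fix a assume "a \<in> exponent_vector ` {..<k}"
  then obtain j where a: "a = exponent_vector j" by blast
  have "Poly_Mapping.keys a \<subseteq> {1..totient k}"
  proof
    fix i assume "i \<in> Poly_Mapping.keys a"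
    then have "Poly_Mapping.lookup a i \<noteq> 0" by (simp add: in_keys_iff)
    then show "i \<in> {1..totient k}" unfolding a lookup_exponent_vector by (meson)
  qed
  moreover have "z ^ j = (\<Sum>i=1..totient k. of_int (Poly_Mapping.lookup a i) * z ^ (i - 1))"
  proof -
    have "ipoly (monom 1 j - rem_monom j) z = 0" using f_dvd[OF prim] rem_monom(2) by blast
    then have "z ^ j = ipoly (rem_monom j) z" by (simp add: ipoly_simps)
    also have "\<dots> = (\<Sum>i=1..totient k. of_int (Poly_Mapping.lookup a i) * z ^ (i - 1))"
      unfolding ipoly_low_degree[OF rem_monom(3)] a by (intro sum.cong refl) (simp add: lookup_exponent_vector)
    finally show ?thesis .
  qed
  moreover have "(z ^ j) ^ k = 1" using primitive_root_power[OF prim] by (metis mult.commute power_mult power_one)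
  ultimately show "a \<in> A_set zeta k" unfolding A_set_def assms by blast
qed

lemma inj_exponent_vector: "inj_on exponent_vector {..<k}"
proof (rule inj_onI)
  fix i j assume ij: "i \<in> {..<k}" "j \<in> {..<k}" "exponent_vector i = exponent_vector j"
  have "coeff (rem_monom i) l = coeff (rem_monom j) l" for l
  proof (cases "l < totient k")
    case True
    have "Poly_Mapping.lookup (exponent_vector i) (Suc l) = Poly_Mapping.lookup (exponent_vector j) (Suc l)"
      using ij(3) by simp
    then show ?thesis using True by (simp add: lookup_exponent_vector)
  next
    case False
    then show ?thesis using rem_monom(3)[of i] rem_monom(3)[of j] by (simp add: coeff_eq_0)
  qed
  then have eq: "rem_monom i = rem_monom j" by (rule poly_eqI)
  have "z ^ l = ipoly (rem_monom l) z" for l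
  proof -
    have "ipoly (monom 1 l - rem_monom l) z = 0" using f_dvd[OF prim] rem_monom(2) by blast
    then show ?thesis by (simp add: ipoly_simps)
  qed
  then have "z ^ i = z ^ j" using eq by metis
  then show "i = j" using primitive_root_inj[OF prim] ij by (auto simp: inj_on_def)
qed

definition F_torus :: "(nat \<Rightarrow> real) \<Rightarrow> complex" where
  "F_torus \<theta> = (\<Sum>j<k. circ (extend (\<lambda>i. \<theta> (Suc i)) (monom 1 j)))"

definition torus :: "(nat \<Rightarrow> real) measure" where
  "torus = PiM {1..totient k} (\<lambda>_. circle)"

text \<open>By Jensen's formula in the variable \<open>x\<^sub>0\<close> this is the Mahler measure of the cyclovariety.\<close>

definition mean_log :: real where
  "mean_log = integral\<^sup>L torus (\<lambda>\<theta>. lnp (cmod (F_torus \<theta>)))"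

lemma norm_sum_circ: "cmod (\<Sum>j<k. circ (x j)) \<le> k"
  by (rule order_trans[OF norm_sum]) simp

lemma measurable_extend_torus:
  assumes "{1..totient k} \<subseteq> I"
  shows "(\<lambda>\<theta>. extend (\<lambda>i. \<theta> (Suc i)) q) \<in> borel_measurable (PiM I (\<lambda>_. circle))"
proof -
  have "(\<lambda>\<theta>. \<theta> (Suc i)) \<in> borel_measurable (PiM I (\<lambda>_. circle))" if "i < totient k" for i
  proof -
    have "Suc i \<in> I" using that assms by auto
    then have "(\<lambda>\<theta>. \<theta> (Suc i)) \<in> measurable (PiM I (\<lambda>_. circle)) circle" by (rule measurable_component_singleton)
    then show ?thesis by (simp only: measurable_cong_sets[OF refl sets_circle])
  qed
  then show ?thesis unfolding extend_def by (intro borel_measurable_sum borel_measurable_times) auto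
qed

lemma measurable_F_torus:
  assumes "{1..totient k} \<subseteq> I"
  shows "F_torus \<in> borel_measurable (PiM I (\<lambda>_. circle))"
  unfolding F_torus_def[abs_def]
  by (intro borel_measurable_sum measurable_compose[OF measurable_extend_torus[OF assms] measurable_circ])

lemma laurent_eval_P_poly:
  assumes "zeta k = z"
  shows "laurent_eval (totient k + 1) (P_poly zeta k) (\<lambda>i. circ (\<theta> i)) = circ (\<theta> 0) + F_torus \<theta>"
proof -
  let ?N = "totient k + 1"
  have 0: "(\<Prod>i<?N. circ (\<theta> i) powi Poly_Mapping.lookup (Poly_Mapping.single 0 1) i) = circ (\<theta> 0)"
  proof -
    have "circ (\<theta> i) powi Poly_Mapping.lookup (Poly_Mapping.single 0 1) i = (if i = 0 then circ (\<theta> 0) else 1)" for i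
      by (auto simp: lookup_single lookup_one when_def)
    then show ?thesis by (simp add: prod.delta del: prod.lessThan_Suc)
  qed
  have 1: "(\<Prod>i<?N. circ (\<theta> i) powi Poly_Mapping.lookup (exponent_vector j) i)
      = circ (extend (\<lambda>i. \<theta> (Suc i)) (monom 1 j))" for j
  proof -
    have "(\<Prod>i<?N. circ (\<theta> i) powi Poly_Mapping.lookup (exponent_vector j) i)
        = circ (\<Sum>i<?N. of_int (Poly_Mapping.lookup (exponent_vector j) i) * \<theta> i)"
      by (simp only: circ_power_int circ_sum)
    also have "(\<Sum>i<?N. of_int (Poly_Mapping.lookup (exponent_vector j) i) * \<theta> i)
        = (\<Sum>i<totient k. of_int (coeff (rem_monom j) i) * \<theta> (Suc i))"
      by (simp add: sum.lessThan_Suc_shift lookup_exponent_vector del: sum.lessThan_Suc)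
    finally show ?thesis by (simp only: extend_monom_rem)
  qed
  have "laurent_eval ?N (P_poly zeta k) (\<lambda>i. circ (\<theta> i))
      = (\<Prod>i<?N. circ (\<theta> i) powi Poly_Mapping.lookup (Poly_Mapping.single 0 1) i)
        + (\<Sum>a\<in>exponent_vector ` {..<k}. \<Prod>i<?N. circ (\<theta> i) powi Poly_Mapping.lookup a i)"
    unfolding P_poly_def F_poly_def laurent_eval_add laurent_eval_sum laurent_eval_single A_set_eq[of zeta, OF assms]
    by (simp only: mult_1)
  also have "(\<Sum>a\<in>exponent_vector ` {..<k}. \<Prod>i<?N. circ (\<theta> i) powi Poly_Mapping.lookup a i) = F_torus \<theta>"
    by (simp only: sum.reindex[OF inj_exponent_vector] o_def 1 F_torus_def)
  finally show ?thesis by (simp only: 0)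
qed

lemma mahler_cyclovariety_eq:
  assumes "zeta k = z"
  shows "mahler_cyclovariety zeta k = mean_log"
proof -
  let ?N = "totient k + 1"
  have I: "{..<?N} = insert 0 {1..totient k}" by auto
  have mF: "F_torus \<in> borel_measurable (PiM (insert 0 {1..totient k}) (\<lambda>_. circle))"
    by (rule measurable_F_torus) auto
  have m0: "(\<lambda>\<theta>. circ (\<theta> 0)) \<in> borel_measurable (PiM (insert 0 {1..totient k}) (\<lambda>_. circle))"
    by (rule measurable_compose[OF _ measurable_circ])
      (use measurable_component_singleton[of 0 "insert 0 {1..totient k}" "\<lambda>_. circle"] in simp)
  have m: "(\<lambda>\<theta>. ln (cmod (circ (\<theta> 0) + F_torus \<theta>))) \<in> borel_measurable (PiM (insert 0 {1..totient k}) (\<lambda>_. circle))"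
    by (rule measurable_compose[OF borel_measurable_add[OF m0 mF]]) measurable
  have "mahler_cyclovariety zeta k
      = integral\<^sup>L (PiM {..<?N} (\<lambda>_. circle)) (\<lambda>\<theta>. ln (cmod (laurent_eval ?N (P_poly zeta k) (\<lambda>i. circ (\<theta> i)))))"
    unfolding mahler_cyclovariety_def
    by (rule mahler_eq_torus_integral) (unfold laurent_eval_P_poly[of zeta, OF assms] I, rule m)
  also have "\<dots> = integral\<^sup>L (PiM (insert 0 {1..totient k}) (\<lambda>_. circle)) (\<lambda>\<theta>. ln (cmod (circ (\<theta> 0) + F_torus \<theta>)))"
    unfolding laurent_eval_P_poly[of zeta, OF assms] I ..
  also have "\<dots> = mean_log"
    unfolding mean_log_def torus_def
  proof (rule integral_torus_eliminate[OF _ _ mF])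
    show "cmod (F_torus x) \<le> k" for x unfolding F_torus_def by (rule norm_sum_circ)
    show "F_torus (x(0 := y)) = F_torus x" for x y by (simp add: F_torus_def)
  qed auto
  finally show ?thesis .
qed

section \<open>Equidistribution on the torus\<close>

text \<open>For \<open>c\<close> prime to \<open>p\<close> this is the contribution of a conjugate to the Mahler measure of
  the Gaussian period.\<close>

definition line_log :: "nat \<Rightarrow> nat \<Rightarrow> int \<Rightarrow> real" where
  "line_log p g c = lnp (cmod (\<Sum>j<k. circ (line_point p g c j)))"

lemma circ_line_point_cong:
  assumes p: "p > 0" and c: "[c = c'] (mod int p)"
  shows "circ (line_point p g c j) = circ (line_point p g c' j)"
proof -
  obtain b where b: "c - c' = int p * b" using c by (auto simp: cong_iff_dvd_diff)
  then have "real_of_int c = c' + p * b" by (metis add_diff_cancel_left' add_diff_eq diff_add_cancel of_int_add of_int_mult of_int_of_nat_eq)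
  then have "line_point p g c j = line_point p g c' j + of_int (b * int g ^ j)"
    using p by (simp add: line_point_def field_simps)
  then show ?thesis by (simp only: circ_add circ_of_int mult_1_right)
qed

lemma sum_line_log_shift:
  assumes p: "p > 0"
  shows "(\<Sum>c\<in>{0..<int p}. line_log p g (c + c0)) = (\<Sum>c\<in>{0..<int p}. line_log p g c)"
proof (rule sum.reindex_bij_witness[of _ "\<lambda>c. (c - c0) mod int p" "\<lambda>c. (c + c0) mod int p"])
  fix a assume a: "a \<in> {0..<int p}"
  show "(a + c0) mod int p \<in> {0..<int p}" "(a - c0) mod int p \<in> {0..<int p}" using p by auto
  show "((a + c0) mod int p - c0) mod int p = a" "((a - c0) mod int p + c0) mod int p = a"
    using a by (simp_all add: mod_diff_left_eq mod_add_left_eq)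
  show "line_log p g ((a + c0) mod int p) = line_log p g (a + c0)"
    unfolding line_log_def by (subst circ_line_point_cong[OF p, of "(a + c0) mod int p" "a + c0"]) (auto simp: cong_def)
qed

lemma circ_extend_frac:
  "circ (extend (\<lambda>i. (\<lambda>i\<in>{1..totient k}. frac (\<theta> i)) (Suc i)) (monom 1 j)) = circ (extend (\<lambda>i. \<theta> (Suc i)) (monom 1 j))"
proof -
  let ?n = "\<Sum>i<totient k. coeff (rem_monom j) i * \<lfloor>\<theta> (Suc i)\<rfloor>"
  have "extend (\<lambda>i. \<theta> (Suc i)) (monom 1 j)
      = (\<Sum>i<totient k. of_int (coeff (rem_monom j) i) * frac (\<theta> (Suc i)) + of_int (coeff (rem_monom j) i * \<lfloor>\<theta> (Suc i)\<rfloor>))"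
    unfolding extend_monom_rem by (intro sum.cong refl) (simp add: frac_def algebra_simps)
  also have "\<dots> = (\<Sum>i<totient k. of_int (coeff (rem_monom j) i) * frac (\<theta> (Suc i))) + of_int ?n"
    by (simp add: sum.distrib)
  finally have "circ (extend (\<lambda>i. \<theta> (Suc i)) (monom 1 j)) = circ (\<Sum>i<totient k. of_int (coeff (rem_monom j) i) * frac (\<theta> (Suc i)))"
    by (simp only: circ_add circ_of_int mult_1_right)
  then show ?thesis by (simp add: extend_monom_rem)
qed

text \<open>Averaging over the \<open>p\<close> translates by the points of the line does not change the mean over the torus. The averaged
  function is invariant under these translations, and every point is close to the line, so the averaged
  function is nearly constant.\<close>

lemma equidistribution:
  assumes p: "p > 0" and g: "int p dvd poly f (int g)" and s: "s > 0" "s ^ totient k < p"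
  shows "\<bar>(\<Sum>c\<in>{0..<int p}. line_log p g c) / p - mean_log\<bar> \<le> pi * (real k)\<^sup>2 / s"
proof -
  interpret T: prob_space torus unfolding torus_def by (rule prob_space_torus) simp
  define Y where "Y \<theta> j = extend (\<lambda>i. \<theta> (Suc i)) (monom 1 j)" for \<theta> :: "nat \<Rightarrow> real" and j
  define h where "h c \<theta> = lnp (cmod (\<Sum>j<k. circ (Y \<theta> j + line_point p g c j)))" for c \<theta>
  define A where "A = (\<Sum>c\<in>{0..<int p}. line_log p g c)"
  define E where "E = pi * (real k)\<^sup>2 / s"
  have mY: "(\<lambda>\<theta>. Y \<theta> j) \<in> borel_measurable torus" for j
    unfolding Y_def torus_def by (rule measurable_extend_torus) simp
  have mh: "h c \<in> borel_measurable torus" for c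
  proof -
    have "(\<lambda>\<theta>. \<Sum>j<k. circ (Y \<theta> j + line_point p g c j)) \<in> borel_measurable torus"
      by (intro borel_measurable_sum measurable_compose[OF _ measurable_circ] borel_measurable_add mY borel_measurable_const)
    then have "(\<lambda>\<theta>. cmod (\<Sum>j<k. circ (Y \<theta> j + line_point p g c j))) \<in> borel_measurable torus"
      by (rule measurable_compose[OF _ borel_measurable_norm])
    then show ?thesis unfolding h_def[abs_def] by (rule measurable_compose[OF _ measurable_lnp])
  qed
  have bh: "\<bar>h c \<theta>\<bar> \<le> lnp k" for c \<theta>
    unfolding h_def by (simp only: abs_of_nonneg[OF lnp_nonneg]) (rule lnp_mono[OF norm_sum_circ])
  have ih: "integrable torus (h c)" for c
    by (rule T.integrable_const_bound[of _ "lnp k"]) (use bh mh in auto)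
  have mean: "integral\<^sup>L torus (h c) = mean_log" for c
  proof -
    define v where "v i = line_point p g c (i - 1)" for i
    define H where "H \<theta> = lnp (cmod (F_torus \<theta>))" for \<theta>
    have "h c \<theta> = H (\<lambda>i. \<theta> i + v i)" for \<theta>
    proof -
      have "circ (Y (\<lambda>i. \<theta> i + v i) j) = circ (Y \<theta> j + line_point p g c j)" for j
      proof -
        have "Y (\<lambda>i. \<theta> i + v i) j = Y \<theta> j + extend (line_point p g c) (monom 1 j)"
          by (simp add: Y_def extend_def v_def distrib_left sum.distrib)
        also have "\<dots> = (Y \<theta> j + line_point p g c j) + (extend (line_point p g c) (monom 1 j) - line_point p g c j)" by simp
        finally show ?thesis using circ_add_int[OF extend_line_point[OF p g]] by (simp only:)
      qed
      then show ?thesis by (simp only: h_def H_def F_torus_def Y_def)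
    qed
    \<comment> \<open>Each summand of the average is a translate of the same periodic function.\<close>
    then have "integral\<^sup>L torus (h c) = integral\<^sup>L torus (\<lambda>\<theta>. H (\<lambda>i. \<theta> i + v i))" by presburger
    also have "\<dots> = integral\<^sup>L torus H"
      unfolding torus_def
    proof (rule integral_torus_rotate)
      have "F_torus \<in> borel_measurable (PiM {1..totient k} (\<lambda>_. circle))" by (rule measurable_F_torus) simp
      then have "(\<lambda>\<theta>. cmod (F_torus \<theta>)) \<in> borel_measurable (PiM {1..totient k} (\<lambda>_. circle))" by (rule measurable_compose[OF _ borel_measurable_norm])
      then show "H \<in> borel_measurable (PiM {1..totient k} (\<lambda>_. circle))"
        unfolding H_def[abs_def] by (rule measurable_compose[OF _ measurable_lnp])
      show "H (\<lambda>i\<in>{1..totient k}. frac (\<theta> i)) = H \<theta>" for \<theta>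
        unfolding H_def F_torus_def circ_extend_frac ..
    qed simp
    finally show ?thesis by (simp add: H_def[abs_def] mean_log_def)
  qed
  define S where "S \<theta> = (\<Sum>c\<in>{0..<int p}. h c \<theta>)" for \<theta>
  have iS: "integrable torus S" unfolding S_def[abs_def] by (intro Bochner_Integration.integrable_sum ih)
  have mS: "integral\<^sup>L torus S = p * mean_log"
    unfolding S_def[abs_def] using ih by (subst Bochner_Integration.integral_sum) (auto simp: mean)
  have close: "\<bar>S \<theta> - A\<bar> \<le> p * E" for \<theta>
  proof -
    \<comment> \<open>Move the whole line by the point of it that is nearest to \<open>\<theta>\<close>; the sum over the line does
      not notice.\<close>
    obtain c0 and m :: "nat \<Rightarrow> int" where
      c0: "(\<Sum>j<k. \<bar>extend (\<lambda>i. \<theta> (Suc i)) (monom 1 j) - line_point p g c0 j - m j\<bar>) \<le> (real k)\<^sup>2 / (2 * s)"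
      by (rule exists_close_line_point[OF p g s])
    have diff: "\<bar>h c \<theta> - line_log p g (c + c0)\<bar> \<le> E" for c
    proof -
      have "\<bar>h c \<theta> - line_log p g (c + c0)\<bar>
          \<le> \<bar>cmod (\<Sum>j<k. circ (Y \<theta> j + line_point p g c j)) - cmod (\<Sum>j<k. circ (line_point p g (c + c0) j))\<bar>"
        unfolding h_def line_log_def by (rule lnp_lipschitz)
      also have "\<dots> \<le> cmod ((\<Sum>j<k. circ (Y \<theta> j + line_point p g c j)) - (\<Sum>j<k. circ (line_point p g (c + c0) j)))"
        by (rule norm_triangle_ineq3)
      also have "\<dots> = cmod (\<Sum>j<k. circ (Y \<theta> j + line_point p g c j) - circ (line_point p g (c + c0) j))"
        by (simp only: sum_subtractf)
      also have "\<dots> \<le> (\<Sum>j<k. cmod (circ (Y \<theta> j + line_point p g c j) - circ (line_point p g (c + c0) j)))" by (rule norm_sum)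
      also have "\<dots> \<le> (\<Sum>j<k. 2 * pi * \<bar>Y \<theta> j - line_point p g c0 j - m j\<bar>)"
      proof (rule sum_mono)
        fix j
        let ?t = "Y \<theta> j - line_point p g c0 j - m j"
        have "Y \<theta> j + line_point p g c j = (line_point p g (c + c0) j + ?t) + of_int (m j)"
          by (simp add: line_point_def add_divide_distrib distrib_right)
        then have "circ (Y \<theta> j + line_point p g c j) = circ (line_point p g (c + c0) j) * circ ?t"
          by (simp only: circ_add circ_of_int mult_1_right)
        then have "circ (Y \<theta> j + line_point p g c j) - circ (line_point p g (c + c0) j)
            = circ (line_point p g (c + c0) j) * (circ ?t - 1)" by (simp add: right_diff_distrib)
        then have "cmod (circ (Y \<theta> j + line_point p g c j) - circ (line_point p g (c + c0) j)) = cmod (circ ?t - 1)"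
          by (simp add: norm_mult)
        also have "\<dots> \<le> 2 * pi * \<bar>?t\<bar>" by (rule norm_circ_minus_1)
        finally show "cmod (circ (Y \<theta> j + line_point p g c j) - circ (line_point p g (c + c0) j)) \<le> 2 * pi * \<bar>?t\<bar>" .
      qed
      also have "\<dots> = 2 * pi * (\<Sum>j<k. \<bar>Y \<theta> j - line_point p g c0 j - m j\<bar>)" by (simp add: sum_distrib_left)
      also have "\<dots> \<le> 2 * pi * ((real k)\<^sup>2 / (2 * s))" using c0 unfolding Y_def by (intro mult_left_mono) auto
      also have "\<dots> = E" by (simp add: E_def)
      finally show ?thesis .
    qed
    have "\<bar>S \<theta> - A\<bar> = \<bar>\<Sum>c\<in>{0..<int p}. h c \<theta> - line_log p g (c + c0)\<bar>"
      by (simp add: S_def A_def sum_subtractf sum_line_log_shift[OF p])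
    also have "\<dots> \<le> (\<Sum>c\<in>{0..<int p}. \<bar>h c \<theta> - line_log p g (c + c0)\<bar>)" by (rule sum_abs)
    also have "\<dots> \<le> (\<Sum>c\<in>{0..<int p}. E)" by (intro sum_mono diff)
    finally show ?thesis by simp
  qed
  have "p * mean_log - A = integral\<^sup>L torus (\<lambda>\<theta>. S \<theta> - A)" using iS T.prob_space by (simp add: mS)
  then have "\<bar>p * mean_log - A\<bar> \<le> integral\<^sup>L torus (\<lambda>\<theta>. \<bar>S \<theta> - A\<bar>)" by (simp only: integral_abs_bound)
  also have "\<dots> \<le> integral\<^sup>L torus (\<lambda>\<theta>. p * E)" using iS close by (intro integral_mono) auto
  also have "\<dots> = p * E" using T.prob_space by simp
  finally have "\<bar>A - p * mean_log\<bar> \<le> p * E" by (simp only: abs_minus_commute)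
  moreover have "A / p - mean_log = (A - p * mean_log) / p" using p by (simp add: field_simps)
  ultimately have "\<bar>A / p - mean_log\<bar> \<le> E" using p by (simp add: abs_divide divide_le_eq mult.commute)
  then show ?thesis by (simp only: A_def E_def)
qed

lemma mean_log_1: "k = 1 \<Longrightarrow> mean_log = 0"
proof -
  assume "k = 1"
  then have "{..<k} = {0}" by auto
  then have "cmod (F_torus \<theta>) = 1" for \<theta> unfolding F_torus_def by (simp only:) simp
  then show ?thesis by (simp add: mean_log_def lnp_def)
qed

text \<open>Near the origin \<open>\<bar>F\<^sub>k\<bar>\<close> is close to \<open>k\<close>.\<close>

lemma mean_log_pos:
  assumes k: "k \<ge> 2"
  shows "mean_log > 0"
proof -
  interpret T: prob_space torus unfolding torus_def by (rule prob_space_torus) simp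
  \<comment> \<open>A Lipschitz constant for the phases; the summand \<open>1\<close> makes it positive.\<close>
  define M where "M = (\<Sum>j<k. \<Sum>i<totient k. \<bar>real_of_int (coeff (rem_monom j) i)\<bar>) + 1"
  have M: "M > 0" unfolding M_def by (intro add_nonneg_pos sum_nonneg) auto
  have lk: "ln (real k) > 0" using k by simp
  define \<delta> where "\<delta> = min 1 (ln k / (4 * pi * M))"
  have \<delta>: "0 < \<delta>" "\<delta> \<le> 1" using M lk by (auto simp: \<delta>_def)
  have \<delta>2: "2 * pi * (M * \<delta>) \<le> ln k / 2"
  proof -
    have "\<delta> \<le> ln k / (4 * pi * M)" by (simp add: \<delta>_def)
    then have "\<delta> * (4 * pi * M) \<le> ln k" using M by (simp add: pos_le_divide_eq)
    then show ?thesis by (simp add: mult_ac)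
  qed
  define B where "B = PiE {1..totient k} (\<lambda>_. {0..<\<delta>})"
  have B: "B \<in> sets torus" unfolding B_def torus_def by (intro sets_PiM_I_finite) auto
  have low: "ln k / 2 * indicator B \<theta> \<le> lnp (cmod (F_torus \<theta>))" for \<theta>
  proof (cases "\<theta> \<in> B")
    case True
    have th: "\<bar>\<theta> (Suc i)\<bar> \<le> \<delta>" if "i < totient k" for i
    proof -
      have "Suc i \<in> {1..totient k}" using that by simp
      then have "\<theta> (Suc i) \<in> {0..<\<delta>}" using True unfolding B_def by (rule PiE_mem[rotated])
      then show ?thesis by simp
    qed
    let ?Y = "\<lambda>j. extend (\<lambda>i. \<theta> (Suc i)) (monom 1 j)"
    have Y: "\<bar>?Y j\<bar> \<le> (\<Sum>i<totient k. \<bar>real_of_int (coeff (rem_monom j) i)\<bar>) * \<delta>" for j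
    proof -
      have "\<bar>?Y j\<bar> \<le> (\<Sum>i<totient k. \<bar>of_int (coeff (rem_monom j) i) * \<theta> (Suc i)\<bar>)"
        unfolding extend_monom_rem by (rule sum_abs)
      also have "\<dots> \<le> (\<Sum>i<totient k. \<bar>real_of_int (coeff (rem_monom j) i)\<bar> * \<delta>)"
        unfolding abs_mult using th by (intro sum_mono mult_left_mono) auto
      finally show ?thesis by (simp add: sum_distrib_right)
    qed
    have "\<bar>lnp (cmod (F_torus \<theta>)) - lnp k\<bar> \<le> \<bar>cmod (F_torus \<theta>) - cmod (of_nat k)\<bar>"
      using lnp_lipschitz[of "cmod (F_torus \<theta>)" "real k"] by simp
    also have "\<dots> \<le> cmod (F_torus \<theta> - of_nat k)" by (rule norm_triangle_ineq3)
    also have "F_torus \<theta> - of_nat k = (\<Sum>j<k. circ (?Y j) - 1)" by (simp add: F_torus_def sum_subtractf)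
    also have "cmod \<dots> \<le> (\<Sum>j<k. cmod (circ (?Y j) - 1))" by (rule norm_sum)
    also have "\<dots> \<le> (\<Sum>j<k. 2 * pi * ((\<Sum>i<totient k. \<bar>real_of_int (coeff (rem_monom j) i)\<bar>) * \<delta>))"
    proof (rule sum_mono)
      fix j
      have "cmod (circ (?Y j) - 1) \<le> 2 * pi * \<bar>?Y j\<bar>" by (rule norm_circ_minus_1)
      also have "\<dots> \<le> 2 * pi * ((\<Sum>i<totient k. \<bar>real_of_int (coeff (rem_monom j) i)\<bar>) * \<delta>)"
        using Y[of j] by (intro mult_left_mono) auto
      finally show "cmod (circ (?Y j) - 1) \<le> 2 * pi * ((\<Sum>i<totient k. \<bar>real_of_int (coeff (rem_monom j) i)\<bar>) * \<delta>)" .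
    qed
    also have "\<dots> = 2 * pi * ((M - 1) * \<delta>)" by (simp add: M_def sum_distrib_left sum_distrib_right)
    also have "\<dots> \<le> 2 * pi * (M * \<delta>)" using \<delta> by (intro mult_left_mono mult_right_mono) auto
    also note \<delta>2
    finally have "\<bar>lnp (cmod (F_torus \<theta>)) - lnp k\<bar> \<le> ln k / 2" .
    moreover have "lnp k = ln k" using k by (simp add: lnp_def)
    ultimately have "ln k / 2 \<le> lnp (cmod (F_torus \<theta>))" by linarith
    then show ?thesis using True by simp
  qed (simp add: lnp_nonneg)
  have "F_torus \<in> borel_measurable torus" unfolding torus_def by (rule measurable_F_torus) simp
  then have mH: "(\<lambda>\<theta>. lnp (cmod (F_torus \<theta>))) \<in> borel_measurable torus"
    by (rule measurable_compose[OF measurable_compose[OF _ borel_measurable_norm] measurable_lnp])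
  have bH: "\<bar>lnp (cmod (F_torus \<theta>))\<bar> \<le> lnp k" for \<theta>
    unfolding F_torus_def by (simp only: abs_of_nonneg[OF lnp_nonneg]) (rule lnp_mono[OF norm_sum_circ])
  have iH: "integrable torus (\<lambda>\<theta>. lnp (cmod (F_torus \<theta>)))"
    by (rule T.integrable_const_bound[of _ "lnp k"]) (use bH mH in auto)
  have mB: "measure torus B = \<delta> ^ totient k"
  proof -
    have "emeasure torus B = (\<Prod>i\<in>{1..totient k}. emeasure circle {0..<\<delta>})"
      unfolding torus_def B_def by (rule circle_product.emeasure_PiM) auto
    also have "emeasure circle {0..<\<delta>} = ennreal \<delta>"
    proof -
      have "{0..<1} \<inter> {0..<\<delta>} = {0..<\<delta>}" using \<delta> by auto
      then show ?thesis using \<delta> by (simp add: emeasure_circle)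
    qed
    finally have "emeasure torus B = ennreal (\<delta> ^ totient k)" using \<delta> by (simp add: ennreal_power)
    then show ?thesis using \<delta> by (simp add: measure_def)
  qed
  have "0 < ln k / 2 * \<delta> ^ totient k" using lk \<delta> by simp
  also have "\<dots> = integral\<^sup>L torus (\<lambda>\<theta>. ln k / 2 * indicator B \<theta>)" using B by (simp add: mB)
  also have "\<dots> \<le> mean_log"
    unfolding mean_log_def using B low by (intro integral_mono iH) (auto simp: T.emeasure_eq_measure intro!: integrable_mult_right integrable_real_indicator)
  finally show ?thesis .
qed

end

section \<open>The asymptotic formula\<close>

text \<open>The definition of \<open>\<kappa>\<close> by a least element needs a prime congruent to \<open>1\<close> modulo
  \<open>n\<close>.\<close>

lemma N_setD:
  assumes zeta: "\<And>m. m \<ge> 1 \<Longrightarrow> primitive_root_of_unity m (zeta m)" and n: "n \<in> N_set k"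
  shows "n \<ge> 1" "k \<ge> 1" "prime (k * n + 1)" "kappa n = k" "kappa_prime n = k * n + 1"
proof -
  show n1: "n \<ge> 1" and kn: "kappa n = k" using n by (simp_all add: N_set_def)
  obtain j where "j \<ge> 1" "prime (j * n + 1)" using exists_prime_cong_1[OF zeta[OF n1]] .
  then have "kappa n \<ge> 1 \<and> prime (kappa n * n + 1)"
    unfolding kappa_def by (intro LeastI_ex[of "\<lambda>k. k \<ge> 1 \<and> prime (k * n + 1)"]) blast
  then show "k \<ge> 1" "prime (k * n + 1)" "kappa_prime n = k * n + 1" by (simp_all add: kn kappa_prime_def)
qed

lemma cyclotomic_exists:
  assumes z: "primitive_root_of_unity k z"
  obtains f where "cyclotomic k z f"
proof -
  obtain f where "lead_coeff f = 1" "degree f = totient k"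
    "\<And>u. ipoly f u = (0::complex) \<longleftrightarrow> primitive_root_of_unity k u"
    "\<And>u g. primitive_root_of_unity k u \<Longrightarrow> ipoly g u = (0::complex) \<longleftrightarrow> f dvd g"
    by (rule cyclotomic_polynomial[OF z]) (rule that)
  then have "cyclotomic k z f" using z by unfold_locales
  then show ?thesis by (rule that)
qed

lemma sum_roots_eq_sum_circ:
  fixes G :: "complex \<Rightarrow> real"
  assumes "p > 0"
  shows "(\<Sum>u | u ^ p = 1. G u) = (\<Sum>c\<in>{0..<int p}. G (circ (c / p)))"
proof -
  have "(\<Sum>u | u ^ p = 1. G u) = (\<Sum>c<p. G (cis (2 * pi * real c / real p)))"
    by (rule sum.reindex_bij_betw[OF Complex.bij_betw_roots_unity[OF assms], symmetric])
  also have "\<dots> = (\<Sum>c\<in>{0..<int p}. G (circ (c / p)))"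
    by (rule sum.reindex_bij_witness[of _ nat int]) (auto simp: circ_def)
  finally show ?thesis .
qed

text \<open>Jensen's formula turns the Mahler measure into the sum of \<open>log\<^sup>+\<close> over the distinct conjugates. Each of them arises from \<open>k\<close>
  of the primitive \<open>p\<close>-th roots of unity; adding the root of unity \<open>1\<close>, where the period is \<open>k\<close>, completes the line.\<close>

lemma (in cyclotomic) mahler_gaussian_period:
  assumes p: "prime p" and w: "primitive_root_of_unity p w" and g: "ord p g = k"
  shows "k * mahler_alg (gaussian_period k w) = (\<Sum>c\<in>{0..<int p}. line_log p g c) - lnp k"
proof -
  note ctx = p w g k_pos
  have gp: "gaussian_period k w = period g k w"
    unfolding gaussian_period_eq_sum[OF p w g k_pos] period_def[OF ctx] ..
  have "mahler_alg (period g k w) = (\<Sum>a\<in>period g k ` prim_roots p. lnp (cmod a))"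
    unfolding mahler_alg_def min_poly_period[OF ctx]
    using finite_prim_roots[OF ctx] by (intro mahler_of_linear_factors) simp
  then have "k * mahler_alg (gaussian_period k w) = (\<Sum>u\<in>prim_roots p. lnp (cmod (period g k u)))"
    using sum_conjugates[OF ctx, of "\<lambda>a. lnp (cmod a)"] by (simp add: gp)
  also have "\<dots> = (\<Sum>u | u ^ p = 1. lnp (cmod (period g k u))) - lnp (cmod (period g k 1))"
    unfolding all_roots[OF ctx] using one_notin_prim_roots[OF ctx] finite_prim_roots[OF ctx] by simp
  also have "period g k 1 = of_nat k" by (simp add: period_def[OF ctx])
  also have "(\<Sum>u | u ^ p = 1. lnp (cmod (period g k u))) = (\<Sum>c\<in>{0..<int p}. lnp (cmod (period g k (circ (c / p)))))"
    by (rule sum_roots_eq_sum_circ[OF prime_gt_0_nat[OF p]])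
  also have "\<dots> = (\<Sum>c\<in>{0..<int p}. line_log p g c)"
  proof (rule sum.cong[OF refl])
    fix c :: int
    have "circ (c / p) ^ (g ^ i) = circ (line_point p g c i)" for i
    proof -
      have "circ (c / p) ^ (g ^ i) = circ (c / p) powi int (g ^ i)" by (simp only: power_int_of_nat)
      also have "\<dots> = circ (of_int (int (g ^ i)) * (c / p))" by (rule circ_power_int)
      also have "of_int (int (g ^ i)) * (c / p) = line_point p g c i" by (simp add: line_point_def)
      finally show ?thesis .
    qed
    then show "lnp (cmod (period g k (circ (c / p)))) = line_log p g c" by (simp add: period_def[OF ctx] line_log_def)
  qed
  finally show ?thesis by simp
qed

lemma exists_integer_below_root:
  assumes p: "p \<ge> 2" and d: "d > 0"
  obtains s :: nat where "s > 0" "s ^ d < p" "real p powr (1 / d) \<le> 2 * s"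
proof -
  define r where "r = real p powr (1 / real d)"
  have r1: "r > 1" unfolding r_def using p d by (intro gr_one_powr) auto
  have rd: "r ^ d = p"
  proof -
    have "r ^ d = r powr (real d)" using r1 by (simp add: powr_realpow)
    also have "\<dots> = p" unfolding r_def powr_powr using p d by simp
    finally show ?thesis .
  qed
  define s where "s = nat (\<lceil>r\<rceil> - 1)"
  have c: "\<lceil>r\<rceil> \<ge> 2" using r1 by linarith
  have s: "real s = of_int \<lceil>r\<rceil> - 1" using c by (simp add: s_def)
  have sr: "real s < r" unfolding s by linarith
  have s0: "s > 0" using c by (simp add: s_def)
  have "real s ^ d < r ^ d" using sr d by (intro power_strict_mono) auto
  then have "s ^ d < p" unfolding rd by (metis of_nat_less_iff of_nat_power)
  moreover have "r \<le> 2 * s"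
  proof -
    have "r \<le> real s + 1" unfolding s by linarith
    moreover have "1 \<le> real s" using s0 by simp
    ultimately show ?thesis by simp
  qed
  ultimately show ?thesis using that s0 unfolding r_def by blast
qed

text \<open>\<open>\<pi> \<le> 3.2 \<le> 2 \<surd>3\<close>.\<close>

lemma constant_bound: "2 * pi * (real k)\<^sup>2 \<le> 4 * sqrt 3 * real k * (real k + 1)"
proof -
  have "8 / 5 \<le> sqrt 3" by (rule real_le_rsqrt) (simp add: power2_eq_square)
  moreover have "pi \<le> 16 / 5" using pi_approx by simp
  ultimately have "2 * pi \<le> 4 * sqrt 3" by simp
  then have "2 * pi * (real k)\<^sup>2 \<le> 4 * sqrt 3 * (real k)\<^sup>2" by (rule mult_right_mono) simp
  also have "\<dots> \<le> 4 * sqrt 3 * (real k * (real k + 1))"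
    by (rule mult_left_mono) (simp_all add: power2_eq_square distrib_left)
  finally show ?thesis by (simp only: mult.assoc)
qed

text \<open>With \<open>S\<close> the sum over the \<open>p\<close> points of the line, equidistribution compares
  \<open>S/p\<close> with the Mahler measure of the cyclovariety, while the Mahler measure of the period divided
  by \<open>n\<close> is \<open>(S - log k)/(p - 1)\<close>. The two differ by at most \<open>log k / p\<close>,
  because every term of \<open>S\<close> lies between \<open>0\<close> and \<open>log k\<close>.\<close>

lemma mahler_alpha_estimate:
  fixes zeta :: "nat \<Rightarrow> complex"
  assumes zeta: "\<And>m. m \<ge> 1 \<Longrightarrow> primitive_root_of_unity m (zeta m)" and n: "n \<in> N_set k"
  shows "\<bar>mahler_alg (alpha zeta n) / real n - mahler_cyclovariety zeta k\<bar>
    \<le> 4 * sqrt 3 * real k * (real k + 1) / real (k * n + 1) powr (1 / real (totient k))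
      + 2 * ln (real k) / real (k * n + 1)"
proof -
  note N = N_setD[OF zeta n]
  define p where "p = k * n + 1"
  have pp: "prime p" using N(3) by (simp add: p_def)
  have p2: "p \<ge> 2" using prime_ge_2_nat[OF pp] .
  obtain f where "cyclotomic k (zeta k) f" using cyclotomic_exists[OF zeta[OF N(2)]] .
  then interpret cyclotomic k "zeta k" f .
  obtain g where g: "ord p g = k" using exists_ord_eq[OF pp, of k] by (auto simp: p_def)
  have root: "int p dvd poly f (int g)"
    by (rule cyclotomic_root_mod_prime[OF prim _ pp g]) (simp add: f_root)
  have wp: "primitive_root_of_unity p (zeta p)" using zeta p2 by simp
  define S where "S = (\<Sum>c\<in>{0..<int p}. line_log p g c)"
  define m where "m = mahler_alg (alpha zeta n)"
  have lk: "lnp k = ln k" using N(2) by (simp add: lnp_def)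
  have km: "k * m = S - ln k"
    using mahler_gaussian_period[OF pp wp g] N(4,5) by (simp add: m_def alpha_def S_def lk p_def)
  obtain s :: nat where s: "s > 0" "s ^ totient k < p" "real p powr (1 / totient k) \<le> 2 * s"
    using exists_integer_below_root[OF p2, of "totient k"] k_pos by auto
  have 1: "\<bar>S / p - mean_log\<bar> \<le> 4 * sqrt 3 * real k * (real k + 1) / p powr (1 / totient k)"
  proof -
    have "\<bar>S / p - mean_log\<bar> \<le> pi * (real k)\<^sup>2 / s"
      unfolding S_def using p2 by (intro equidistribution[OF _ root s(1,2)]) simp
    also have "\<dots> = 2 * pi * (real k)\<^sup>2 / (2 * s)" by simp
    also have "\<dots> \<le> 2 * pi * (real k)\<^sup>2 / p powr (1 / totient k)"
      using s p2 by (intro divide_left_mono mult_pos_pos) auto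
    also have "\<dots> \<le> 4 * sqrt 3 * real k * (real k + 1) / p powr (1 / totient k)"
      by (intro divide_right_mono constant_bound) simp
    finally show ?thesis .
  qed
  have lb: "line_log p g c \<le> ln k" for c
    unfolding line_log_def lk[symmetric] by (rule lnp_mono[OF norm_sum_circ])
  have S_up: "S \<le> p * ln k"
  proof -
    have "S \<le> (\<Sum>c\<in>{0..<int p}. ln k)" unfolding S_def by (intro sum_mono lb)
    then show ?thesis by simp
  qed
  have S_low: "ln k \<le> S"
  proof -
    have "line_log p g 0 = ln k" using circ_of_int[of 0] by (simp add: line_log_def line_point_def lk)
    moreover have "line_log p g 0 \<le> S"
      unfolding S_def using p2 by (intro member_le_sum) (auto simp: line_log_def lnp_nonneg)
    ultimately show ?thesis by simp
  qed
  have p1: "real p = k * n + 1" by (simp add: p_def)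
  have kn: "real k * real n > 0" using N(1,2) by simp
  have mn: "m / n = (S - ln k) / (real p - 1)"
  proof -
    have "m / n = (k * m) / (k * n)" using N(2) by simp
    then show ?thesis by (simp add: km p1)
  qed
  have 2: "\<bar>m / n - S / p\<bar> \<le> ln k / p"
  proof -
    have q: "real p - 1 > 0" "real p > 0" using p2 by simp_all
    have e: "m / n - S / p = - ((real p * ln k - S) / (real p * (real p - 1)))"
      unfolding mn using q by (simp add: field_simps)
    have "real p * ln k - S \<le> (real p - 1) * ln k" using S_low by (simp add: algebra_simps)
    then have "(real p * ln k - S) / (real p * (real p - 1)) \<le> ((real p - 1) * ln k) / (real p * (real p - 1))"
      using q by (intro divide_right_mono) auto
    also have "\<dots> = ln k / p" using q by simp
    finally have "(real p * ln k - S) / (real p * (real p - 1)) \<le> ln k / p" .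
    moreover have "(real p * ln k - S) / (real p * (real p - 1)) \<ge> 0" using S_up q by (intro divide_nonneg_nonneg) auto
    ultimately show ?thesis unfolding e by (simp only: abs_minus_cancel abs_of_nonneg)
  qed
  have "ln k / p \<le> 2 * ln k / p" using N(2) by (intro divide_right_mono) auto
  then have "\<bar>m / n - mean_log\<bar> \<le> 4 * sqrt 3 * real k * (real k + 1) / p powr (1 / totient k) + 2 * ln k / p"
    using 1 2 by linarith
  then show ?thesis unfolding m_def p_def mahler_cyclovariety_eq[of zeta, OF refl] .
qed

lemma mahler_alpha_1:
  fixes zeta :: "nat \<Rightarrow> complex"
  assumes zeta: "\<And>m. m \<ge> 1 \<Longrightarrow> primitive_root_of_unity m (zeta m)" and n: "n \<in> N_set 1"
  shows "mahler_alg (alpha zeta n) = 0"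
proof -
  note N = N_setD[OF zeta n]
  obtain f where "cyclotomic 1 (zeta 1) f" using cyclotomic_exists[OF zeta[of 1]] by auto
  then interpret cyclotomic 1 "zeta 1" f .
  have wp: "primitive_root_of_unity (1 * n + 1) (zeta (1 * n + 1))" by (rule zeta) simp
  have g: "ord (1 * n + 1) 1 = 1" by simp
  have line: "line_log (1 * n + 1) 1 c = 0" for c
    unfolding line_log_def by (simp add: lnp_def)
  have "real 1 * mahler_alg (gaussian_period 1 (zeta (1 * n + 1)))
      = (\<Sum>c\<in>{0..<int (1 * n + 1)}. line_log (1 * n + 1) 1 c) - lnp (real 1)"
    by (rule mahler_gaussian_period[OF N(3) wp g])
  also have "\<dots> = 0" unfolding line by (simp add: lnp_def)
  finally have "mahler_alg (gaussian_period 1 (zeta (1 * n + 1))) = 0" by simp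
  then show ?thesis using N(4,5) by (simp add: alpha_def)
qed

theorem theorem2:
  fixes zeta :: "nat \<Rightarrow> complex"
  assumes "\<And>m. m \<ge> 1 \<Longrightarrow> primitive_root_of_unity m (zeta m)"
  shows "(\<forall>n\<in>N_set 1. mahler_alg (alpha zeta n) = 0) \<and> mahler_cyclovariety zeta 1 = 0 \<and>
    (\<forall>k\<ge>2. (\<lambda>n. mahler_alg (alpha zeta n))
        \<sim>[inf at_top (principal (N_set k))] (\<lambda>n. mahler_cyclovariety zeta k * real n)) \<and>
    (\<forall>k\<ge>1. \<forall>n\<in>N_set k.
        \<bar>mahler_alg (alpha zeta n) / real n - mahler_cyclovariety zeta k\<bar>
          \<le> 4 * sqrt 3 * real k * (real k + 1) / real (k * n + 1) powr (1 / real (totient k))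
             + 2 * ln (real k) / real (k * n + 1))"
proof (intro conjI ballI allI impI)
  fix n assume n: "n \<in> N_set 1"
  show "mahler_alg (alpha zeta n) = 0" by (rule mahler_alpha_1[OF assms n])
next
  obtain f where "cyclotomic 1 (zeta 1) f" using cyclotomic_exists[OF assms[of 1]] by auto
  then interpret cyclotomic 1 "zeta 1" f .
  show "mahler_cyclovariety zeta 1 = 0" unfolding mahler_cyclovariety_eq[of zeta, OF refl] by (rule mean_log_1[OF refl])
next
  fix k n :: nat assume n: "n \<in> N_set k"
  show "\<bar>mahler_alg (alpha zeta n) / real n - mahler_cyclovariety zeta k\<bar>
      \<le> 4 * sqrt 3 * real k * (real k + 1) / real (k * n + 1) powr (1 / real (totient k))
        + 2 * ln (real k) / real (k * n + 1)"
    by (rule mahler_alpha_estimate[OF assms n])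
next
  fix k :: nat assume k: "k \<ge> 2"
  obtain f where "cyclotomic k (zeta k) f" using cyclotomic_exists[OF assms[of k]] k by auto
  then interpret cyclotomic k "zeta k" f .
  let ?C = "mahler_cyclovariety zeta k"
  let ?F = "inf at_top (principal (N_set k))"
  have C: "?C > 0" unfolding mahler_cyclovariety_eq[of zeta, OF refl] by (rule mean_log_pos[OF k])
  define E where "E n = 4 * sqrt 3 * real k * (real k + 1) / real (k * n + 1) powr (1 / real (totient k))
        + 2 * ln (real k) / real (k * n + 1)" for n
  have lin: "filterlim (\<lambda>n. real (k * n + 1)) at_top at_top"
  proof (rule filterlim_at_top_mono[OF filterlim_real_sequentially])
    have "n \<le> k * n + 1" for n using k_pos by (cases k) auto
    then show "\<forall>\<^sub>F n in sequentially. real n \<le> real (k * n + 1)" by (intro always_eventually allI) (simp only: of_nat_le_iff)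
  qed
  have d: "1 / real (totient k) > 0" using k_pos by simp
  have "(E \<longlongrightarrow> 0 + 0) at_top"
    unfolding E_def
  proof (intro tendsto_add)
    show "((\<lambda>n. 4 * sqrt 3 * real k * (real k + 1) / real (k * n + 1) powr (1 / real (totient k))) \<longlongrightarrow> 0) at_top"
    proof -
      have "((\<lambda>n. real (k * n + 1) powr - (1 / real (totient k))) \<longlongrightarrow> 0) at_top"
        by (rule tendsto_neg_powr[OF _ lin]) (use d in simp)
      from tendsto_mult_right_zero[OF this, of "4 * sqrt 3 * real k * (real k + 1)"]
      show ?thesis by (simp only: powr_minus_divide mult_1_right times_divide_eq_right)
    qed
    show "((\<lambda>n. 2 * ln (real k) / real (k * n + 1)) \<longlongrightarrow> 0) at_top"
      by (rule real_tendsto_divide_at_top[OF tendsto_const lin])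
  qed
  then have E0: "(E \<longlongrightarrow> 0) ?F" by (intro tendsto_mono[OF inf_le1]) simp
  have "((\<lambda>n. mahler_alg (alpha zeta n) / real n - ?C) \<longlongrightarrow> 0) ?F"
  proof (rule Lim_null_comparison[OF _ E0])
    show "\<forall>\<^sub>F n in ?F. norm (mahler_alg (alpha zeta n) / real n - ?C) \<le> E n"
      unfolding eventually_inf_principal
      by (intro always_eventually allI impI) (use mahler_alpha_estimate[OF assms] in \<open>simp add: E_def\<close>)
  qed
  then have "((\<lambda>n. mahler_alg (alpha zeta n) / real n) \<longlongrightarrow> ?C) ?F" by (rule LIM_zero_cancel)
  then show "(\<lambda>n. mahler_alg (alpha zeta n)) \<sim>[?F] (\<lambda>n. ?C * real n)"
    using C by (intro asymp_equivI'_const) auto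
qed

end
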